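(* Let $n>2$, let $S\subset\mathbb{CP}^n$ be a strongly $\mathbb{C}$-convex, simply-connected smooth real hypersurface, and let $\theta$ be a $\mathbb{C}$-valued contact form on $S$, that is, a non-vanishing complex 1-form with $\theta|_{H}\equiv0$. Let $\tilde{d'}$ be a linear operator from smooth functions on $S$ to smooth complex 1-forms on $S$ satisfying $\tilde{d'}u|_H=d'u$ for all $u$, with $d'$ as in the context. Then for every smooth $u\colon S\to\mathbb{C}$ the following are equivalent: (a) there is a smooth scalar function $\lambda\colon S\to\mathbb{C}$ such that $d(\tilde{d'}u)|_H=-\lambda\,d\theta|_H$; (b) $u$ may be decomposed as the sum of a CR function and a dual-CR function.
   Context: All objects are smooth ($C^\infty$); $J$ is the standard complex structure; $S$ is not assumed compact. $S$ is strongly $\mathbb{C}$-convex if it is locally projectively equivalent to a strongly convex hypersurface, i.e. near each of its points some projective automorphism of $\mathbb{CP}^n$ maps it to a hypersurface with definite second fundamental form in an affine chart. $H_pS=T_pS\cap JT_pS$, and $|_H$ denotes restriction to the spaces $H_pS$. Projective dual CR structure. Suppose first that $S\subset\mathbb{C}^n$ and no complex tangent hyperplane $p+H_pS$ passes through the origin, i.e. $\sum_m z_m\,\partial\rho/\partial z_m\ne0$ on $S$ for $\rho$ a (local) real-valued defining function. Put $w_j=\frac{\partial\rho/\partial z_j}{\sum_m z_m\,\partial\rho/\partial z_m}$ on $S$ (independent of $\rho$). The map $\mathscr D_S=(w_1,\dots,w_n)\colon S\to\mathbb{C}^n$ is a local diffeomorphism onto a real hypersurface and its derivative carries $H_pS$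 to a complex subspace; set $J^*=(\mathscr D_S'(p))^{-1}\circ J\circ\mathscr D_S'(p)\colon H_pS\to H_pS$. This construction is projectively invariant; for general $S\subset\mathbb{CP}^n$, $J^*$ is defined near each point of $S$ by first applying a projective automorphism after which, near the image of that point, the hypersurface lies in $\mathbb{C}^n$ and none of its complex tangent hyperplanes passes through the origin, and pulling back (the result does not depend on the automorphism). A smooth $f\colon S\to\mathbb{C}$ is CR if $df(Jv)=i\,df(v)$ for all $v\in H_pS$, $p\in S$; a smooth $g\colon S\to\mathbb{C}$ is dual-CR if $dg(J^*v)=i\,dg(v)$ for all $v\in H_pS$, $p\in S$. For smooth $u\colon S\to\mathbb{C}$, $d'u$ and $d''u$ are the uniquely determined smoothly varying $\mathbb{R}$-linear maps $H_pS\to\mathbb{C}$ ($p\in S$) such that $du|_H=d'u+d''u$, $d'u(Jv)=i\,d'u(v)$ and $d''u(J^*v)=i\,d''u(v)$ for $v\in H_pS$. *)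

theory Defs
  imports "HOL-Analysis.Analysis"
begin

section \<open>Smooth maps\<close>

fun Ck_on :: "nat \<Rightarrow> 'a::euclidean_space set \<Rightarrow> ('a \<Rightarrow> 'b::real_normed_vector) \<Rightarrow> bool" where
  "Ck_on 0 U f \<longleftrightarrow> continuous_on U f"
| "Ck_on (Suc k) U f \<longleftrightarrow>
     (\<forall>x\<in>U. f differentiable (at x)) \<and> (\<forall>v. Ck_on k U (\<lambda>x. frechet_derivative f (at x) v))"

text \<open>Only used for open \<open>U\<close>.\<close>
definition smooth_on :: "'a::euclidean_space set \<Rightarrow> ('a \<Rightarrow> 'b::real_normed_vector) \<Rightarrow> bool" where
  "smooth_on U f \<longleftrightarrow> (\<forall>k. Ck_on k U f)"


section \<open>Complex projective space and its tangent bundle\<close>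

text \<open>
  With \<open>n = CARD('n)\<close>, the type \<open>'n cproj\<close> is the projective space of dimension \<open>n\<close>, i.e. the
  quotient of the nonzero vectors with \<open>n + 1\<close> components, indexed by \<open>'n option\<close>.
\<close>

definition proj_rel :: "complex^('n::finite option) \<Rightarrow> complex^('n option) \<Rightarrow> bool" where
  "proj_rel v w \<longleftrightarrow> v \<noteq> 0 \<and> w \<noteq> 0 \<and> (\<exists>c. c \<noteq> 0 \<and> w = c *s v)"

lemma part_equivp_proj_rel: "part_equivp (proj_rel :: complex^('n::finite option) \<Rightarrow> _)"
proof (rule part_equivpI)
  have "axis None 1 \<noteq> (0 :: complex^('n option))" by (simp add: axis_eq_0_iff)
  then show "\<exists>v. proj_rel v (v :: complex^('n option))"
    unfolding proj_rel_def by (metis vector_smult_lid zero_neq_one)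
  show "symp (proj_rel :: complex^('n option) \<Rightarrow> _)"
  proof (rule sympI)
    fix v w :: "complex^('n option)"
    assume "proj_rel v w"
    then obtain c where c: "v \<noteq> 0" "w \<noteq> 0" "c \<noteq> 0" "w = c *s v" by (auto simp: proj_rel_def)
    then have "v = inverse c *s w" by (simp add: vector_smult_assoc)
    with c show "proj_rel w v" unfolding proj_rel_def by (metis inverse_nonzero_iff_nonzero)
  qed
  show "transp (proj_rel :: complex^('n option) \<Rightarrow> _)"
    by (rule transpI) (auto simp: proj_rel_def vector_smult_assoc intro: exI[of _ "_ * _"])
qed

quotient_type (overloaded) 'n cproj = "complex^('n::finite option)" / partial: proj_rel
  by (rule part_equivp_proj_rel)

text \<open>
  A tangent vector of projective space at the line spanned by \<open>v\<close> is the image of a pair \<open>(v, x)\<close>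
  under the differential of the quotient map, i.e. the velocity at \<open>t = 0\<close> of the class of
  \<open>v + t x\<close>. Rescaling this curve by \<open>c(t)\<close> with \<open>c(0) = c\<close>, \<open>c'(0) = m\<close> replaces the pair by
  \<open>(c v, c x + m v)\<close>.
\<close>

definition tangent_rel ::
  "(complex^('n::finite option)) \<times> (complex^('n option)) \<Rightarrow> (complex^('n option)) \<times> (complex^('n option)) \<Rightarrow> bool"
  where
  "tangent_rel vx wy \<longleftrightarrow> fst vx \<noteq> 0 \<and> fst wy \<noteq> 0 \<and>
     (\<exists>c m. c \<noteq> 0 \<and> fst wy = c *s fst vx \<and> snd wy = c *s snd vx + m *s fst vx)"

lemma part_equivp_tangent_rel:
  "part_equivp (tangent_rel :: (complex^('n::finite option)) \<times> _ \<Rightarrow> _)"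
proof (rule part_equivpI)
  have "axis None 1 \<noteq> (0 :: complex^('n option))" by (simp add: axis_eq_0_iff)
  then have "tangent_rel (axis None 1, 0) (axis None 1, 0 :: complex^('n option))"
    unfolding tangent_rel_def by (intro conjI exI[of _ 1] exI[of _ 0]) simp_all
  then show "\<exists>v. tangent_rel v (v :: (complex^('n option)) \<times> _)" by blast
  show "symp (tangent_rel :: (complex^('n option)) \<times> _ \<Rightarrow> _)"
  proof (rule sympI)
    fix p q :: "(complex^('n option)) \<times> (complex^('n option))"
    assume "tangent_rel p q"
    then obtain c m where c: "fst p \<noteq> 0" "fst q \<noteq> 0" "c \<noteq> 0" "fst q = c *s fst p"
      "snd q = c *s snd p + m *s fst p" by (auto simp: tangent_rel_def)
    have "fst p = inverse c *s fst q" using c by (simp add: vector_smult_assoc)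
    moreover have "snd p = inverse c *s snd q + (- m / c^2) *s fst q"
      using c by (simp add: vec_eq_iff field_simps power2_eq_square)
    ultimately show "tangent_rel q p" unfolding tangent_rel_def
      using c by (metis inverse_nonzero_iff_nonzero)
  qed
  show "transp (tangent_rel :: (complex^('n option)) \<times> _ \<Rightarrow> _)"
  proof (rule transpI)
    fix p q r :: "(complex^('n option)) \<times> (complex^('n option))"
    assume "tangent_rel p q" "tangent_rel q r"
    then obtain c m d l where c: "fst p \<noteq> 0" "fst q \<noteq> 0" "fst r \<noteq> 0" "c \<noteq> 0" "d \<noteq> 0"
      "fst q = c *s fst p" "snd q = c *s snd p + m *s fst p"
      "fst r = d *s fst q" "snd r = d *s snd q + l *s fst q" by (auto simp: tangent_rel_def)
    have "fst r = (d * c) *s fst p" using c by (simp add: vector_smult_assoc)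
    moreover have "snd r = (d * c) *s snd p + (d * m + l * c) *s fst p"
      using c by (simp add: vec_eq_iff algebra_simps)
    moreover have "d * c \<noteq> 0" using c by simp
    ultimately show "tangent_rel p r" unfolding tangent_rel_def using c by blast
  qed
qed

quotient_type (overloaded) 'n cproj_tangent =
  "(complex^('n::finite option)) \<times> (complex^('n option))" / partial: tangent_rel
  by (rule part_equivp_tangent_rel)

lift_definition tangent_J :: "'n::finite cproj_tangent \<Rightarrow> 'n cproj_tangent"
  is "\<lambda>(v, x). (v, \<i> *s x)"
proof -
  fix p q :: "(complex^('n option)) \<times> (complex^('n option))"
  assume "tangent_rel p q"
  then obtain c m where c: "fst p \<noteq> 0" "fst q \<noteq> 0" "c \<noteq> 0" "fst q = c *s fst p"
    "snd q = c *s snd p + m *s fst p" by (auto simp: tangent_rel_def)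
  then have "\<i> *s snd q = c *s (\<i> *s snd p) + (\<i> * m) *s fst p"
    by (simp add: vec_eq_iff algebra_simps)
  with c have "tangent_rel (fst p, \<i> *s snd p) (fst q, \<i> *s snd q)"
    unfolding tangent_rel_def fst_conv snd_conv by blast
  then show "tangent_rel (case p of (v, x) \<Rightarrow> (v, \<i> *s x)) (case q of (v, x) \<Rightarrow> (v, \<i> *s x))"
    by (simp add: case_prod_beta)
qed

instantiation cproj :: (finite) topological_space
begin

definition open_cproj :: "'a cproj set \<Rightarrow> bool" where
  "open_cproj W \<longleftrightarrow> open {v. v \<noteq> 0 \<and> abs_cproj v \<in> W}"

instance
proof
  have "{v. v \<noteq> 0 \<and> abs_cproj v \<in> (UNIV :: 'a cproj set)} = - {0}" by auto
  then show "open (UNIV :: 'a cproj set)" by (simp add: open_cproj_def open_Compl)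
next
  fix S T :: "'a cproj set"
  assume "open S" "open T"
  moreover have "{v. v \<noteq> 0 \<and> abs_cproj v \<in> S \<inter> T} =
    {v. v \<noteq> 0 \<and> abs_cproj v \<in> S} \<inter> {v. v \<noteq> 0 \<and> abs_cproj v \<in> T}" by auto
  ultimately show "open (S \<inter> T)" by (simp add: open_cproj_def open_Int)
next
  fix K :: "'a cproj set set"
  assume "\<forall>S\<in>K. open S"
  moreover have "{v. v \<noteq> 0 \<and> abs_cproj v \<in> \<Union>K} = (\<Union>S\<in>K. {v. v \<noteq> 0 \<and> abs_cproj v \<in> S})"
    by auto
  ultimately show "open (\<Union>K)" by (auto simp: open_cproj_def)
qed

end

text \<open>
  For invertible \<open>A\<close>, the map \<open>chart A\<close> sends \<open>z\<close> to the point with homogeneous coordinates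
  \<open>A (1 : z)\<close>. It is the inverse of the affine coordinates obtained by first applying the projective
  automorphism induced by the inverse of \<open>A\<close>; in particular \<open>chart A -` S\<close> is the part of the image
  of \<open>S\<close> under this automorphism that lies in the standard affine chart. The map \<open>dchart A z\<close> is the
  differential of \<open>chart A\<close> at \<open>z\<close>.
\<close>

definition chart :: "complex^('n option)^('n option) \<Rightarrow> complex^('n::finite) \<Rightarrow> 'n cproj" where
  "chart A z = abs_cproj (A *v (\<chi> k. case k of None \<Rightarrow> 1 | Some j \<Rightarrow> z $ j))"

definition dchart ::
  "complex^('n option)^('n option) \<Rightarrow> complex^('n::finite) \<Rightarrow> complex^'n \<Rightarrow> 'n cproj_tangent" where
  "dchart A z X = abs_cproj_tangent
     (A *v (\<chi> k. case k of None \<Rightarrow> 1 | Some j \<Rightarrow> z $ j),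
      A *v (\<chi> k. case k of None \<Rightarrow> 0 | Some j \<Rightarrow> X $ j))"


section \<open>Real hypersurfaces\<close>

definition defining_function ::
  "(complex^('n::finite)) set \<Rightarrow> (complex^'n) set \<Rightarrow> (complex^'n \<Rightarrow> real) \<Rightarrow> bool" where
  "defining_function M U \<rho> \<longleftrightarrow> open U \<and> smooth_on U \<rho> \<and> M \<inter> U = {z \<in> U. \<rho> z = 0} \<and>
     (\<forall>z\<in>M \<inter> U. frechet_derivative \<rho> (at z) \<noteq> (\<lambda>_. 0))"

definition real_hypersurface :: "'n::finite cproj set \<Rightarrow> bool" where
  "real_hypersurface S \<longleftrightarrow> (\<forall>p\<in>S. \<exists>A z U \<rho>. invertible A \<and> chart A z = p \<and> z \<in> U \<and>
     defining_function (chart A -` S) U \<rho>)"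

definition T_space :: "'n::finite cproj set \<Rightarrow> 'n cproj \<Rightarrow> 'n cproj_tangent set" where
  "T_space S p = {dchart A z X | A z X. p \<in> S \<and> invertible A \<and> chart A z = p \<and>
     (\<exists>U \<rho>. z \<in> U \<and> defining_function (chart A -` S) U \<rho> \<and> frechet_derivative \<rho> (at z) X = 0)}"

definition H_space :: "'n::finite cproj set \<Rightarrow> 'n cproj \<Rightarrow> 'n cproj_tangent set" where
  "H_space S p = T_space S p \<inter> tangent_J ` T_space S p"

definition gradient :: "('a::euclidean_space \<Rightarrow> real) \<Rightarrow> 'a \<Rightarrow> 'a" where
  "gradient \<rho> z = (\<Sum>b\<in>Basis. frechet_derivative \<rho> (at z) b *\<^sub>R b)"

text \<open>
  The second fundamental form of a level set of \<open>\<rho>\<close>, with respect to the unit normal field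
  \<open>sgn (gradient \<rho>)\<close>; \<open>X\<close> and \<open>Y\<close> are meant to be tangent to the level set.
\<close>
definition second_fundamental_form ::
  "('a::euclidean_space \<Rightarrow> real) \<Rightarrow> 'a \<Rightarrow> 'a \<Rightarrow> 'a \<Rightarrow> real" where
  "second_fundamental_form \<rho> z X Y =
     - (frechet_derivative (\<lambda>y. sgn (gradient \<rho> y)) (at z) X \<bullet> Y)"

definition definite_at :: "('a::euclidean_space \<Rightarrow> real) \<Rightarrow> 'a \<Rightarrow> bool" where
  "definite_at \<rho> z \<longleftrightarrow>
     (\<forall>X. frechet_derivative \<rho> (at z) X = 0 \<and> X \<noteq> 0 \<longrightarrow> second_fundamental_form \<rho> z X X > 0) \<or>
     (\<forall>X. frechet_derivative \<rho> (at z) X = 0 \<and> X \<noteq> 0 \<longrightarrow> second_fundamental_form \<rho> z X X < 0)"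

definition strongly_C_convex :: "'n::finite cproj set \<Rightarrow> bool" where
  "strongly_C_convex S \<longleftrightarrow> (\<forall>p\<in>S. \<exists>A z U \<rho>. invertible A \<and> chart A z = p \<and> z \<in> U \<and>
     defining_function (chart A -` S) U \<rho> \<and> (\<forall>y\<in>U. chart A y \<in> S \<longrightarrow> definite_at \<rho> y))"


section \<open>Smooth functions and forms on a hypersurface\<close>

text \<open>
  Functions and forms on \<open>S\<close> are total functions of which only the values at points of \<open>S\<close>, respectively
  at vectors in the relevant subspaces of its tangent spaces, matter. They are smooth if they extend
  locally to smooth objects on open sets of affine charts.
\<close>

definition local_extension ::
  "'n::finite cproj set \<Rightarrow> ('n cproj \<Rightarrow> complex) \<Rightarrow> complex^('n option)^('n option) \<Rightarrow>
    (complex^'n) set \<Rightarrow> (complex^'n \<Rightarrow> complex) \<Rightarrow> bool" where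
  "local_extension S u A U F \<longleftrightarrow> invertible A \<and> open U \<and> smooth_on U F \<and>
     (\<forall>z\<in>U. chart A z \<in> S \<longrightarrow> F z = u (chart A z))"

definition smooth_fun :: "'n::finite cproj set \<Rightarrow> ('n cproj \<Rightarrow> complex) \<Rightarrow> bool" where
  "smooth_fun S u \<longleftrightarrow> (\<forall>p\<in>S. \<exists>A z U F. chart A z = p \<and> z \<in> U \<and> local_extension S u A U F)"

text \<open>The value of \<open>du\<close> at a tangent vector \<open>\<xi>\<close> of \<open>S\<close>.\<close>
definition differential ::
  "'n::finite cproj set \<Rightarrow> ('n cproj \<Rightarrow> complex) \<Rightarrow> 'n cproj_tangent \<Rightarrow> complex" where
  "differential S u \<xi> = (THE c. \<exists>A z X U F. \<xi> = dchart A z X \<and> z \<in> U \<and>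
     local_extension S u A U F \<and> c = frechet_derivative F (at z) X)"

text \<open>
  Here \<open>E\<close> is \<open>T_space S\<close> or \<open>H_space S\<close>, and \<open>\<alpha>\<close> is a family of real-linear maps
  from the spaces \<open>E p\<close> to the complex numbers.
\<close>

definition local_form_extension ::
  "'n::finite cproj set \<Rightarrow> ('n cproj \<Rightarrow> 'n cproj_tangent set) \<Rightarrow> ('n cproj_tangent \<Rightarrow> complex) \<Rightarrow>
    complex^('n option)^('n option) \<Rightarrow> (complex^'n) set \<Rightarrow>
    (complex^'n \<Rightarrow> (complex^'n) \<Rightarrow>\<^sub>L complex) \<Rightarrow> bool" where
  "local_form_extension S E \<alpha> A U a \<longleftrightarrow> invertible A \<and> open U \<and> smooth_on U a \<and>
     (\<forall>z\<in>U. chart A z \<in> S \<longrightarrow>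
        (\<forall>X. dchart A z X \<in> E (chart A z) \<longrightarrow> blinfun_apply (a z) X = \<alpha> (dchart A z X)))"

definition smooth_covectors ::
  "'n::finite cproj set \<Rightarrow> ('n cproj \<Rightarrow> 'n cproj_tangent set) \<Rightarrow> ('n cproj_tangent \<Rightarrow> complex) \<Rightarrow> bool"
  where
  "smooth_covectors S E \<alpha> \<longleftrightarrow>
     (\<forall>p\<in>S. \<exists>A z U a. chart A z = p \<and> z \<in> U \<and> local_form_extension S E \<alpha> A U a)"

abbreviation smooth_one_form :: "'n::finite cproj set \<Rightarrow> ('n cproj_tangent \<Rightarrow> complex) \<Rightarrow> bool" where
  "smooth_one_form S \<equiv> smooth_covectors S (T_space S)"

text \<open>The exterior derivative, evaluated at vectors \<open>\<xi>\<close> and \<open>\<eta>\<close> in the same tangent space of \<open>S\<close>.\<close>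
definition ext_deriv ::
  "'n::finite cproj set \<Rightarrow> ('n cproj_tangent \<Rightarrow> complex) \<Rightarrow> 'n cproj_tangent \<Rightarrow> 'n cproj_tangent \<Rightarrow> complex"
  where
  "ext_deriv S \<alpha> \<xi> \<eta> = (THE c. \<exists>A z X Y U a. \<xi> = dchart A z X \<and> \<eta> = dchart A z Y \<and> z \<in> U \<and>
     local_form_extension S (T_space S) \<alpha> A U a \<and>
     c = blinfun_apply (frechet_derivative a (at z) X) Y
       - blinfun_apply (frechet_derivative a (at z) Y) X)"

definition contact_form :: "'n::finite cproj set \<Rightarrow> ('n cproj_tangent \<Rightarrow> complex) \<Rightarrow> bool" where
  "contact_form S \<theta> \<longleftrightarrow> smooth_one_form S \<theta> \<and>
     (\<forall>p\<in>S. \<exists>\<xi>\<in>T_space S p. \<theta> \<xi> \<noteq> 0) \<and> (\<forall>p\<in>S. \<forall>\<xi>\<in>H_space S p. \<theta> \<xi> = 0)"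


section \<open>The projective dual CR structure\<close>

definition wirtinger :: "(complex^('n::finite) \<Rightarrow> real) \<Rightarrow> complex^'n \<Rightarrow> 'n \<Rightarrow> complex" where
  "wirtinger \<rho> z j = (complex_of_real (frechet_derivative \<rho> (at z) (axis j 1))
     - \<i> * complex_of_real (frechet_derivative \<rho> (at z) (axis j \<i>))) / 2"

definition dual_denom :: "(complex^('n::finite) \<Rightarrow> real) \<Rightarrow> complex^'n \<Rightarrow> complex" where
  "dual_denom \<rho> z = (\<Sum>m\<in>UNIV. z $ m * wirtinger \<rho> z m)"

definition dual_map :: "(complex^('n::finite) \<Rightarrow> real) \<Rightarrow> complex^'n \<Rightarrow> complex^'n" where
  "dual_map \<rho> z = (\<chi> j. wirtinger \<rho> z j / dual_denom \<rho> z)"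

text \<open>
  On the hypersurface, \<open>dual_map \<rho>\<close> does not depend on \<open>\<rho>\<close>, so the derivative \<open>W\<close> below is determined
  by the hypersurface on its tangent spaces.
\<close>
definition dual_J :: "'n::finite cproj set \<Rightarrow> 'n cproj_tangent \<Rightarrow> 'n cproj_tangent" where
  "dual_J S \<xi> = (THE \<eta>. \<exists>A z X U \<rho>. invertible A \<and> chart A z \<in> S \<and> z \<in> U \<and>
     defining_function (chart A -` S) U \<rho> \<and>
     (\<forall>y\<in>U. chart A y \<in> S \<longrightarrow> dual_denom \<rho> y \<noteq> 0) \<and> \<xi> = dchart A z X \<and>
     (let W = frechet_derivative (dual_map \<rho>) (at z);
          H = {Y. dchart A z Y \<in> H_space S (chart A z)}
      in \<eta> = dchart A z (the_inv_into H W (\<i> *s W X))))"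


section \<open>CR functions, dual-CR functions and the operator \<open>d'\<close>\<close>

definition CR :: "'n::finite cproj set \<Rightarrow> ('n cproj \<Rightarrow> complex) \<Rightarrow> bool" where
  "CR S f \<longleftrightarrow> smooth_fun S f \<and>
     (\<forall>p\<in>S. \<forall>\<xi>\<in>H_space S p. differential S f (tangent_J \<xi>) = \<i> * differential S f \<xi>)"

definition dual_CR :: "'n::finite cproj set \<Rightarrow> ('n cproj \<Rightarrow> complex) \<Rightarrow> bool" where
  "dual_CR S g \<longleftrightarrow> smooth_fun S g \<and>
     (\<forall>p\<in>S. \<forall>\<xi>\<in>H_space S p. differential S g (dual_J S \<xi>) = \<i> * differential S g \<xi>)"

definition splitting ::
  "'n::finite cproj set \<Rightarrow> ('n cproj \<Rightarrow> complex) \<Rightarrow>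
    ('n cproj_tangent \<Rightarrow> complex) \<Rightarrow> ('n cproj_tangent \<Rightarrow> complex) \<Rightarrow> bool" where
  "splitting S u a b \<longleftrightarrow> smooth_covectors S (H_space S) a \<and> smooth_covectors S (H_space S) b \<and>
     (\<forall>p\<in>S. \<forall>\<xi>\<in>H_space S p. differential S u \<xi> = a \<xi> + b \<xi> \<and>
        a (tangent_J \<xi>) = \<i> * a \<xi> \<and> b (dual_J S \<xi>) = \<i> * b \<xi>)"

text \<open>Unique on the spaces \<open>H_space S p\<close>; its values at other vectors carry no meaning.\<close>
definition d_prime ::
  "'n::finite cproj set \<Rightarrow> ('n cproj \<Rightarrow> complex) \<Rightarrow> 'n cproj_tangent \<Rightarrow> complex" where
  "d_prime S u = (SOME a. \<exists>b. splitting S u a b)"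

text \<open>
  Complex-linear operators from smooth functions to smooth 1-forms on \<open>S\<close>. The second condition says
  that \<open>D\<close> is well defined on functions on \<open>S\<close>.
\<close>
definition linear_operator ::
  "'n::finite cproj set \<Rightarrow> (('n cproj \<Rightarrow> complex) \<Rightarrow> 'n cproj_tangent \<Rightarrow> complex) \<Rightarrow> bool" where
  "linear_operator S D \<longleftrightarrow>
     (\<forall>u. smooth_fun S u \<longrightarrow> smooth_one_form S (D u)) \<and>
     (\<forall>u v. smooth_fun S u \<and> smooth_fun S v \<and> (\<forall>p\<in>S. u p = v p) \<longrightarrow>
        (\<forall>p\<in>S. \<forall>\<xi>\<in>T_space S p. D u \<xi> = D v \<xi>)) \<and>
     (\<forall>u v c d. smooth_fun S u \<and> smooth_fun S v \<longrightarrow>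
        (\<forall>p\<in>S. \<forall>\<xi>\<in>T_space S p. D (\<lambda>q. c * u q + d * v q) \<xi> = c * D u \<xi> + d * D v \<xi>))"

end

theory Submission
  imports Defs
begin

text \<open>
  Write \<open>H\<close> for the bundle of complex tangent spaces of \<open>S\<close> and \<open>d'u\<close>, \<open>d''u\<close> for the parts of the
  differential of \<open>u\<close> on \<open>H\<close> that are linear for the complex structure \<open>J\<close> of projective space and for the
  dual structure \<open>J\<^sup>*\<close>. A CR function is a function with \<open>d'' = 0\<close>, and a dual-CR function one with \<open>d' = 0\<close>.

  If \<open>u = f + g\<close> with \<open>f\<close> CR and \<open>g\<close> dual-CR, then \<open>d'u\<close> is the restriction of \<open>df\<close> to \<open>H\<close>. Every form
  \<open>\<delta>\<close> that extends \<open>d'u\<close> is therefore \<open>df + m \<theta>\<close>, and \<open>d\<delta>\<close> restricts to \<open>m d\<theta>\<close> on \<open>H\<close>. Conversely, if \<open>d\<delta>\<close> is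
  \<open>- l d\<theta>\<close> on \<open>H\<close>, then the form \<open>\<alpha> = \<delta> + l \<theta>\<close> has \<open>d\<alpha> = 0\<close> on \<open>H\<close>, which means \<open>d\<alpha> = \<beta> \<and> \<theta>\<close>. Since \<open>d\<^sup>2 = 0\<close>, the
  3-form \<open>\<beta> \<and> d\<theta>\<close> vanishes on \<open>H\<close>, where \<open>d\<theta>\<close> is nondegenerate; as \<open>H\<close> has real dimension at least four,
  \<open>\<beta>\<close> vanishes on \<open>H\<close> and \<open>d\<alpha> = 0\<close> (\<open>contact_rigidity\<close>, \<open>closed_on_H_imp_closed\<close>). As \<open>S\<close> is simply connected,
  \<open>\<alpha> = df\<close> (\<open>locally_exact_imp_exact\<close>). On \<open>H\<close> this says \<open>df = d'u\<close>, so \<open>f\<close> is CR, and \<open>d(u - f) = d''u\<close>, so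
  \<open>u - f\<close> is dual-CR.

  Both directions use that \<open>d'u\<close> exists and is unique. This rests on the invertibility of \<open>J - J\<^sup>*\<close> on \<open>H\<close>,
  which is the nondegeneracy of the Levi form (\<open>convex_chart_injective\<close>): uniqueness holds because a form
  that is linear for both structures vanishes on the range of \<open>J - J\<^sup>*\<close> (\<open>pointwise_split_unique\<close>), and
  existence because the differentials of the coordinates and of the components of the dual map span all
  forms on \<open>H\<close>, with coefficients given by Cramer's rule (\<open>dual_coefficients_exist\<close>, \<open>splitting_exists\<close>).
  That \<open>J\<^sup>*\<close> can be computed in any chart is the projective invariance of the dual map: its value is the
  complex tangent hyperplane, as a point of the dual projective space (\<open>dual_point_invariant\<close>).

  The passage between \<open>S\<close> and charts uses one device throughout. Near each of its points, a hypersurface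
  is the image of a smooth retraction \<open>\<pi>\<close> of a neighbourhood (\<open>hypersurface_retraction\<close>). Functions and forms
  on \<open>S\<close> are pulled back under \<open>\<pi>\<close> to objects on open sets, where calculus applies; pullback commutes with
  the exterior derivative, and the differential of \<open>\<pi>\<close> fixes tangent vectors of \<open>S\<close>.
\<close>

section \<open>Calculus of smooth maps\<close>

abbreviation fder :: "('a::real_normed_vector \<Rightarrow> 'b::real_normed_vector) \<Rightarrow> 'a \<Rightarrow> 'a \<Rightarrow> 'b" where
  "fder f x v \<equiv> frechet_derivative f (at x) v"

lemma has_derivative_cong_open:
  assumes "open U" "x \<in> U" "\<And>y. y \<in> U \<Longrightarrow> f y = g y"
  shows "(f has_derivative f') (at x) \<longleftrightarrow> (g has_derivative f') (at x)"
  using assms has_derivative_transform_within_open[of f f' x UNIV U g]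
    has_derivative_transform_within_open[of g f' x UNIV U f] by auto

lemma frechet_derivative_cong_open:
  assumes "open U" "x \<in> U" "\<And>y. y \<in> U \<Longrightarrow> f y = g y"
  shows "frechet_derivative f (at x) = frechet_derivative g (at x)"
  unfolding frechet_derivative_def using has_derivative_cong_open[OF assms] by simp

lemma fder_eq: "(f has_derivative f') (at x) \<Longrightarrow> fder f x = f'"
  using frechet_derivative_at by metis

lemma has_derivative_fder: "f differentiable (at x) \<Longrightarrow> (f has_derivative fder f x) (at x)"
  using frechet_derivative_works by blast

text \<open>
  Derivatives at a point of an open set only see the values on that set, so smoothness there can be
  checked after replacing a function by a formula that holds on the set.
\<close>
lemma Ck_on_cong:
  assumes "open U" "\<And>x. x \<in> U \<Longrightarrow> f x = g x" "Ck_on k U f"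
  shows "Ck_on k U g"
  using assms(2,3)
proof (induction k arbitrary: f g)
  case 0
  then show ?case using continuous_on_cong by force
next
  case (Suc k)
  have 1: "g differentiable (at x)" if "x \<in> U" for x
    using Suc.prems(2) that has_derivative_cong_open[of U x f g, OF assms(1) that Suc.prems(1)]
    by (fastforce simp: differentiable_def)
  have "Ck_on k U (\<lambda>x. fder g x v)" for v
    using Suc.IH[of "\<lambda>x. fder f x v" "\<lambda>x. fder g x v"] Suc.prems(2)
      frechet_derivative_cong_open[of U _ f g, OF assms(1) _ Suc.prems(1)] by simp
  then show ?case using 1 by simp
qed

lemma Ck_on_SucI:
  assumes "open U" "\<And>x. x \<in> U \<Longrightarrow> (f has_derivative f' x) (at x)"
    "\<And>v. Ck_on k U (\<lambda>x. f' x v)"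
  shows "Ck_on (Suc k) U f"
proof -
  have "Ck_on k U (\<lambda>x. fder f x v)" for v
    by (rule Ck_on_cong[OF assms(1) _ assms(3)[of v]]) (simp add: fder_eq[OF assms(2)])
  then show ?thesis using assms(2) by (auto simp: differentiable_def)
qed

lemma Ck_on_Suc_imp: "Ck_on (Suc k) U f \<Longrightarrow> Ck_on k U f"
proof (induction k arbitrary: f)
  case 0
  then show ?case
    by (auto intro!: continuous_at_imp_continuous_on differentiable_imp_continuous_within)
next
  case (Suc k)
  then show ?case by (metis Ck_on.simps(2))
qed

lemma Ck_on_subset: "Ck_on k U f \<Longrightarrow> V \<subseteq> U \<Longrightarrow> Ck_on k V f"
proof (induction k arbitrary: f)
  case 0
  then show ?case using continuous_on_subset by auto
next
  case (Suc k)
  then show ?case by auto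
qed

lemma Ck_on_has_derivative:
  "Ck_on (Suc k) U f \<Longrightarrow> x \<in> U \<Longrightarrow> (f has_derivative fder f x) (at x)"
  by (simp add: has_derivative_fder)

lemma Ck_on_const: "open U \<Longrightarrow> Ck_on k U (\<lambda>x. c)"
proof (induction k arbitrary: c)
  case (Suc k)
  show ?case by (rule Ck_on_SucI[OF Suc.prems has_derivative_const]) (use Suc in auto)
qed simp

lemma Ck_on_bounded_linear_compose:
  assumes "bounded_linear h" "open U"
  shows "Ck_on k U f \<Longrightarrow> Ck_on k U (\<lambda>x. h (f x))"
proof (induction k arbitrary: f)
  case 0
  then show ?case using bounded_linear.continuous_on[OF assms(1)] by simp
next
  case (Suc k)
  show ?case
    by (rule Ck_on_SucI[OF assms(2) bounded_linear.has_derivative[OF assms(1) Ck_on_has_derivative[OF Suc.prems]]])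
       (use Suc in auto)
qed

lemma Ck_on_bounded_linear:
  assumes "bounded_linear h" "open U"
  shows "Ck_on k U h"
proof (cases k)
  case 0
  then show ?thesis using assms bounded_linear.linear linear_continuous_on by auto
next
  case (Suc k')
  show ?thesis unfolding Suc
    by (rule Ck_on_SucI[OF assms(2) bounded_linear_imp_has_derivative[OF assms(1)]])
       (use Ck_on_const[OF assms(2)] in auto)
qed

lemma Ck_on_add:
  assumes "open U"
  shows "Ck_on k U f \<Longrightarrow> Ck_on k U g \<Longrightarrow> Ck_on k U (\<lambda>x. f x + g x)"
proof (induction k arbitrary: f g)
  case 0
  then show ?case by (auto intro: continuous_on_add)
next
  case (Suc k)
  show ?case
    by (rule Ck_on_SucI[OF assms has_derivative_add[OF Ck_on_has_derivative[OF Suc.prems(1)]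
              Ck_on_has_derivative[OF Suc.prems(2)]]])
       (use Suc in auto)
qed

lemma Ck_on_sum:
  assumes "open U" "\<And>i. i \<in> I \<Longrightarrow> Ck_on k U (f i)"
  shows "Ck_on k U (\<lambda>x. \<Sum>i\<in>I. f i x)"
  using assms(2)
  by (induction I rule: infinite_finite_induct)
     (auto intro: Ck_on_const Ck_on_add assms(1))

lemma Ck_on_bilinear:
  assumes "bounded_bilinear bil" "open U"
  shows "Ck_on k U f \<Longrightarrow> Ck_on k U g \<Longrightarrow> Ck_on k U (\<lambda>x. bil (f x) (g x))"
proof (induction k arbitrary: f g)
  case 0
  then show ?case using bounded_bilinear.continuous_on[OF assms(1)] by simp
next
  case (Suc k)
  have "Ck_on k U (\<lambda>x. bil (f x) (fder g x v) + bil (fder f x v) (g x))" for v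
    using Suc by (intro Ck_on_add[OF assms(2)] Suc.IH) (auto simp del: Ck_on.simps intro: Ck_on_Suc_imp, auto)
  then show ?case
    by (intro Ck_on_SucI[OF assms(2) bounded_bilinear.FDERIV[OF assms(1) Ck_on_has_derivative[OF Suc.prems(1)]
              Ck_on_has_derivative[OF Suc.prems(2)]]])
qed

lemma linear_basis_sum:
  fixes x :: "'a::euclidean_space"
  assumes "linear f"
  shows "f x = (\<Sum>b\<in>Basis. (x \<bullet> b) *\<^sub>R f b)"
  by (metis (no_types, lifting) assms euclidean_representation linear_sum linear_cmul sum.cong)

lemma fder_linear: "f differentiable (at x) \<Longrightarrow> linear (fder f x)"
  using has_derivative_fder has_derivative_linear by blast

text \<open>
  The chain rule expresses the derivative of a composition as a sum, over a basis, of products of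
  functions that are again compositions or derivatives. Each of these is one order less smooth, which
  is what an induction on the order needs.
\<close>
lemma Ck_on_compose:
  fixes f :: "'b::euclidean_space \<Rightarrow> 'c::real_normed_vector" and g :: "'a::euclidean_space \<Rightarrow> 'b"
  assumes "open U" "open V" "g ` U \<subseteq> V"
  shows "Ck_on k V f \<Longrightarrow> Ck_on k U g \<Longrightarrow> Ck_on k U (\<lambda>x. f (g x))"
proof (induction k arbitrary: f)
  case 0
  then show ?case using continuous_on_compose2[of V f U g] assms(3) by simp
next
  case (Suc k)
  have d: "((\<lambda>x. f (g x)) has_derivative (\<lambda>v. fder f (g x) (fder g x v))) (at x)" if "x \<in> U" for x
    using diff_chain_at[OF Ck_on_has_derivative[OF Suc.prems(2) that] Ck_on_has_derivative[OF Suc.prems(1), of "g x"]]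
      that assms(3) by (auto simp: o_def)
  have "Ck_on k U (\<lambda>x. \<Sum>b\<in>Basis. (fder g x v \<bullet> b) *\<^sub>R fder f (g x) b)" for v
    using Suc.prems
    by (intro Ck_on_sum[OF assms(1)] Ck_on_bilinear[OF bounded_bilinear_scaleR assms(1)]
        Ck_on_bounded_linear_compose[OF bounded_linear_inner_left assms(1)] Suc.IH Ck_on_Suc_imp[of k U g]) auto
  then have "Ck_on k U (\<lambda>x. fder f (g x) (fder g x v))" for v
    apply (rule Ck_on_cong[OF assms(1), rotated])
    apply (rule linear_basis_sum[symmetric])
    using Suc.prems(1) assms(3) by (auto intro!: fder_linear)
  then show ?case by (intro Ck_on_SucI[OF assms(1) d])
qed

lemma Ck_on_inverse:
  fixes f :: "'a::euclidean_space \<Rightarrow> 'b::real_normed_field"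
  assumes "open U" "\<And>x. x \<in> U \<Longrightarrow> f x \<noteq> 0"
  shows "Ck_on k U f \<Longrightarrow> Ck_on k U (\<lambda>x. inverse (f x))"
proof (induction k)
  case 0
  then show ?case using assms(2) by (auto intro!: continuous_on_inverse)
next
  case (Suc k)
  have d: "((\<lambda>x. inverse (f x)) has_derivative (\<lambda>v. - (inverse (f x) * fder f x v * inverse (f x)))) (at x)"
    if "x \<in> U" for x
    by (rule Deriv.has_derivative_inverse[OF assms(2)[OF that] Ck_on_has_derivative[OF Suc.prems that]])
  have "Ck_on k U (\<lambda>x. - (inverse (f x) * fder f x v * inverse (f x)))" for v
    using Suc
    by (intro Ck_on_bounded_linear_compose[OF bounded_linear_minus[OF bounded_linear_ident] assms(1)]
        Ck_on_bilinear[OF bounded_bilinear_mult assms(1)]) (auto simp del: Ck_on.simps intro: Ck_on_Suc_imp, auto)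
  then show ?case by (intro Ck_on_SucI[OF assms(1) d])
qed

named_theorems smooth_intros

lemma smooth_on_cong: "open U \<Longrightarrow> smooth_on U f \<Longrightarrow> (\<And>x. x \<in> U \<Longrightarrow> f x = g x) \<Longrightarrow> smooth_on U g"
  unfolding smooth_on_def using Ck_on_cong by blast

lemma smooth_on_subset: "smooth_on U f \<Longrightarrow> V \<subseteq> U \<Longrightarrow> smooth_on V f"
  unfolding smooth_on_def using Ck_on_subset by blast

lemma smooth_on_differentiable: "smooth_on U f \<Longrightarrow> x \<in> U \<Longrightarrow> f differentiable (at x)"
  unfolding smooth_on_def by (metis Ck_on.simps(2))

lemma smooth_on_has_derivative: "smooth_on U f \<Longrightarrow> x \<in> U \<Longrightarrow> (f has_derivative fder f x) (at x)"
  using smooth_on_differentiable has_derivative_fder by blast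

lemma smooth_on_continuous_on: "smooth_on U f \<Longrightarrow> continuous_on U f"
  unfolding smooth_on_def by (metis Ck_on.simps(1))

lemma smooth_on_linear_fder: "smooth_on U f \<Longrightarrow> x \<in> U \<Longrightarrow> linear (fder f x)"
  using smooth_on_differentiable fder_linear by blast

lemma smooth_on_fder [smooth_intros]: "smooth_on U f \<Longrightarrow> smooth_on U (\<lambda>x. fder f x v)"
  unfolding smooth_on_def by (metis Ck_on.simps(2))

text \<open>
  A function is smooth once its derivative is; this is how primitives are seen to be smooth.
\<close>
lemma smooth_onI:
  assumes "open U" "\<And>x. x \<in> U \<Longrightarrow> (f has_derivative f' x) (at x)" "\<And>v. smooth_on U (\<lambda>x. f' x v)"
  shows "smooth_on U f"
  unfolding smooth_on_def using Ck_on_SucI[OF assms(1,2)] assms(3)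
  unfolding smooth_on_def using Ck_on_Suc_imp by blast

lemma smooth_on_const [smooth_intros]: "open U \<Longrightarrow> smooth_on U (\<lambda>x. c)"
  unfolding smooth_on_def using Ck_on_const by blast

lemma smooth_on_bounded_linear: "bounded_linear h \<Longrightarrow> open U \<Longrightarrow> smooth_on U h"
  unfolding smooth_on_def using Ck_on_bounded_linear by blast

lemma smooth_on_ident [smooth_intros]: "open U \<Longrightarrow> smooth_on U (\<lambda>x. x)"
  by (rule smooth_on_bounded_linear[OF bounded_linear_ident])

lemma smooth_on_bounded_linear_compose:
  "bounded_linear h \<Longrightarrow> open U \<Longrightarrow> smooth_on U f \<Longrightarrow> smooth_on U (\<lambda>x. h (f x))"
  unfolding smooth_on_def using Ck_on_bounded_linear_compose by blast

lemma smooth_on_bilinear: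
  "bounded_bilinear bil \<Longrightarrow> open U \<Longrightarrow> smooth_on U f \<Longrightarrow> smooth_on U g \<Longrightarrow> smooth_on U (\<lambda>x. bil (f x) (g x))"
  unfolding smooth_on_def using Ck_on_bilinear by blast

lemma smooth_on_compose:
  fixes f :: "'b::euclidean_space \<Rightarrow> 'c::real_normed_vector" and g :: "'a::euclidean_space \<Rightarrow> 'b"
  assumes "open U" "open V" "\<And>x. x \<in> U \<Longrightarrow> g x \<in> V" "smooth_on V f" "smooth_on U g"
  shows "smooth_on U (\<lambda>x. f (g x))"
  unfolding smooth_on_def
proof
  fix k
  show "Ck_on k U (\<lambda>x. f (g x))"
    by (rule Ck_on_compose[OF assms(1,2)]) (use assms in \<open>auto simp: smooth_on_def\<close>)
qed

lemma smooth_on_add [smooth_intros]: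
  "open U \<Longrightarrow> smooth_on U f \<Longrightarrow> smooth_on U g \<Longrightarrow> smooth_on U (\<lambda>x. f x + g x)"
  unfolding smooth_on_def using Ck_on_add by blast

lemma smooth_on_minus [smooth_intros]: "open U \<Longrightarrow> smooth_on U f \<Longrightarrow> smooth_on U (\<lambda>x. - f x)"
  by (rule smooth_on_bounded_linear_compose[OF bounded_linear_minus[OF bounded_linear_ident]])

lemma smooth_on_diff [smooth_intros]:
  "open U \<Longrightarrow> smooth_on U f \<Longrightarrow> smooth_on U g \<Longrightarrow> smooth_on U (\<lambda>x. f x - g x)"
  using smooth_on_add[of U f "\<lambda>x. - g x"] smooth_on_minus[of U g] by simp

lemma smooth_on_sum [smooth_intros]:
  "open U \<Longrightarrow> (\<And>i. i \<in> I \<Longrightarrow> smooth_on U (f i)) \<Longrightarrow> smooth_on U (\<lambda>x. \<Sum>i\<in>I. f i x)"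
  unfolding smooth_on_def using Ck_on_sum[of U I _ f] by blast

lemma smooth_on_scaleR [smooth_intros]:
  "open U \<Longrightarrow> smooth_on U f \<Longrightarrow> smooth_on U g \<Longrightarrow> smooth_on U (\<lambda>x. f x *\<^sub>R g x)"
  by (rule smooth_on_bilinear[OF bounded_bilinear_scaleR])

lemma smooth_on_mult [smooth_intros]:
  fixes f :: "'a::euclidean_space \<Rightarrow> 'b::real_normed_algebra"
  shows "open U \<Longrightarrow> smooth_on U f \<Longrightarrow> smooth_on U g \<Longrightarrow> smooth_on U (\<lambda>x. f x * g x)"
  by (rule smooth_on_bilinear[OF bounded_bilinear_mult])

lemma smooth_on_inner [smooth_intros]:
  fixes f :: "'a::euclidean_space \<Rightarrow> 'b::real_inner"
  shows "open U \<Longrightarrow> smooth_on U f \<Longrightarrow> smooth_on U g \<Longrightarrow> smooth_on U (\<lambda>x. f x \<bullet> g x)"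
  by (rule smooth_on_bilinear[OF bounded_bilinear_inner])

lemma smooth_on_prod [smooth_intros]:
  fixes f :: "'i \<Rightarrow> 'a::euclidean_space \<Rightarrow> 'b::real_normed_field"
  assumes "open U" "\<And>i. i \<in> I \<Longrightarrow> smooth_on U (f i)"
  shows "smooth_on U (\<lambda>x. \<Prod>i\<in>I. f i x)"
  using assms(2)
  by (induction I rule: infinite_finite_induct)
     (auto intro: smooth_on_const smooth_on_mult assms(1))

lemma smooth_on_inverse [smooth_intros]:
  fixes f :: "'a::euclidean_space \<Rightarrow> 'b::real_normed_field"
  shows "open U \<Longrightarrow> smooth_on U f \<Longrightarrow> (\<And>x. x \<in> U \<Longrightarrow> f x \<noteq> 0) \<Longrightarrow> smooth_on U (\<lambda>x. inverse (f x))"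
  unfolding smooth_on_def using Ck_on_inverse[of U f] by blast

lemma smooth_on_divide [smooth_intros]:
  fixes f :: "'a::euclidean_space \<Rightarrow> 'b::real_normed_field"
  shows "open U \<Longrightarrow> smooth_on U f \<Longrightarrow> smooth_on U g \<Longrightarrow> (\<And>x. x \<in> U \<Longrightarrow> g x \<noteq> 0) \<Longrightarrow> smooth_on U (\<lambda>x. f x / g x)"
  unfolding divide_inverse by (intro smooth_intros)

lemma smooth_on_of_real [smooth_intros]:
  fixes f :: "'a::euclidean_space \<Rightarrow> real"
  shows "open U \<Longrightarrow> smooth_on U f \<Longrightarrow> smooth_on U (\<lambda>x. complex_of_real (f x))"
  by (rule smooth_on_bounded_linear_compose[OF bounded_linear_of_real])

lemma smooth_on_vec_nth [smooth_intros]: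
  fixes f :: "'a::euclidean_space \<Rightarrow> 'b::real_normed_vector ^ 'n"
  shows "open U \<Longrightarrow> smooth_on U f \<Longrightarrow> smooth_on U (\<lambda>x. f x $ i)"
  by (rule smooth_on_bounded_linear_compose[OF bounded_linear_vec_nth])

lemma bounded_linear_axis: "bounded_linear (\<lambda>x. axis i x :: 'b::euclidean_space ^ 'n)"
proof -
  have "linear (\<lambda>x. axis i x :: 'b::euclidean_space ^ 'n)"
    by (rule linearI) (auto simp: axis_def vec_eq_iff)
  then show ?thesis using linear_conv_bounded_linear by blast
qed

lemma smooth_on_vec_lambda [smooth_intros]:
  fixes f :: "'n::finite \<Rightarrow> 'a::euclidean_space \<Rightarrow> 'b::euclidean_space"
  assumes "open U" "\<And>i. smooth_on U (f i)"
  shows "smooth_on U (\<lambda>x. \<chi> i. f i x)"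
proof -
  have "smooth_on U (\<lambda>x. \<Sum>i\<in>UNIV. axis i (f i x))"
    by (intro smooth_on_sum smooth_on_bounded_linear_compose[OF bounded_linear_axis] assms)
  moreover have "(\<Sum>i\<in>UNIV. axis i (f i x)) = (\<chi> i. f i x)" for x
    by (auto simp: vec_eq_iff axis_def if_distrib[of "\<lambda>v. v $ _"] if_distrib cong: if_cong)
  ultimately show ?thesis by simp
qed

text \<open>
  Smoothness of \<open>a x v\<close> for each fixed \<open>v\<close> is the working notion for families of linear maps. It is
  enough because such a family is determined by its values on a finite basis.
\<close>
lemma smooth_on_linear_family:
  fixes a :: "'a::euclidean_space \<Rightarrow> 'b::euclidean_space \<Rightarrow> 'c::real_normed_vector"
  assumes "open U" "\<And>x. x \<in> U \<Longrightarrow> linear (a x)" "\<And>v. smooth_on U (\<lambda>x. a x v)" "smooth_on U h"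
  shows "smooth_on U (\<lambda>x. a x (h x))"
proof -
  have "smooth_on U (\<lambda>x. \<Sum>b\<in>Basis. (h x \<bullet> b) *\<^sub>R a x b)"
    by (intro smooth_intros assms)
  then show ?thesis
    by (rule smooth_on_cong[OF assms(1)]) (use linear_basis_sum assms(2) in metis)
qed

lemma smooth_on_fder_at [smooth_intros]:
  fixes f :: "'b::euclidean_space \<Rightarrow> 'c::real_normed_vector" and g :: "'a::euclidean_space \<Rightarrow> 'b"
  assumes "open U" "open V" "\<And>x. x \<in> U \<Longrightarrow> g x \<in> V" "smooth_on V f" "smooth_on U g" "smooth_on U h"
  shows "smooth_on U (\<lambda>x. fder f (g x) (h x))"
proof (rule smooth_on_linear_family[OF assms(1) _ _ assms(6)])
  show "linear (fder f (g x))" if "x \<in> U" for x using assms that smooth_on_linear_fder by blast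
  show "smooth_on U (\<lambda>x. fder f (g x) v)" for v
    by (rule smooth_on_compose[OF assms(1-3) smooth_on_fder[OF assms(4)] assms(5)])
qed

lemma smooth_on_blinfun_apply [smooth_intros]:
  "open U \<Longrightarrow> smooth_on U f \<Longrightarrow> smooth_on U g \<Longrightarrow> smooth_on U (\<lambda>x. blinfun_apply (f x) (g x))"
  by (rule smooth_on_bilinear[OF bounded_bilinear_blinfun_apply])

lemma linear_bounded_linear:
  fixes f :: "'a::euclidean_space \<Rightarrow> 'b::real_normed_vector"
  shows "linear f \<Longrightarrow> bounded_linear f"
  using linear_conv_bounded_linear by blast

lemma smooth_on_Blinfun:
  fixes a :: "'a::euclidean_space \<Rightarrow> 'b::euclidean_space \<Rightarrow> 'c::real_normed_vector"
  assumes "open U" "\<And>x. x \<in> U \<Longrightarrow> linear (a x)" "\<And>v. smooth_on U (\<lambda>x. a x v)"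
  shows "smooth_on U (\<lambda>x. Blinfun (a x))"
proof -
  have "smooth_on U (\<lambda>x. \<Sum>b\<in>Basis. blinfun_scaleR_left (a x b) o\<^sub>L blinfun_inner_left b)"
    by (intro smooth_on_sum assms smooth_on_bounded_linear_compose[OF bounded_linear_blinfun_scaleR_left]
        smooth_on_bounded_linear_compose[OF bounded_bilinear.bounded_linear_left[OF bounded_bilinear_blinfun_compose]])
  moreover have "(\<Sum>b\<in>Basis. blinfun_scaleR_left (a x b) o\<^sub>L blinfun_inner_left b) = Blinfun (a x)" if "x \<in> U" for x
  proof (rule blinfun_eqI)
    fix v
    have "blinfun_apply (\<Sum>b\<in>Basis. blinfun_scaleR_left (a x b) o\<^sub>L blinfun_inner_left b) v
        = (\<Sum>b\<in>Basis. (v \<bullet> b) *\<^sub>R a x b)"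
      by (simp add: blinfun.sum_left inner_commute)
    also have "\<dots> = a x v" by (rule linear_basis_sum[OF assms(2)[OF that], symmetric])
    also have "\<dots> = blinfun_apply (Blinfun (a x)) v"
      using linear_bounded_linear[OF assms(2)[OF that]] by (simp only: bounded_linear_Blinfun_apply)
    finally show "blinfun_apply (\<Sum>b\<in>Basis. blinfun_scaleR_left (a x b) o\<^sub>L blinfun_inner_left b) v
        = blinfun_apply (Blinfun (a x)) v" .
  qed
  ultimately show ?thesis by (rule smooth_on_cong[OF assms(1)])
qed

lemma fder_compose:
  assumes "f differentiable (at (g x))" "g differentiable (at x)"
  shows "fder (\<lambda>x. f (g x)) x v = fder f (g x) (fder g x v)"
  using diff_chain_at[OF has_derivative_fder[OF assms(2)] has_derivative_fder[OF assms(1)]]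
  by (simp add: o_def fder_eq)

lemma fder_bounded_linear_compose:
  assumes "bounded_linear h" "f differentiable (at x)"
  shows "fder (\<lambda>x. h (f x)) x v = h (fder f x v)"
  using bounded_linear.has_derivative[OF assms(1) has_derivative_fder[OF assms(2)]]
  by (simp add: fder_eq)

lemma fder_bilinear:
  assumes "bounded_bilinear bil" "f differentiable (at x)" "g differentiable (at x)"
  shows "fder (\<lambda>x. bil (f x) (g x)) x v = bil (f x) (fder g x v) + bil (fder f x v) (g x)"
  using bounded_bilinear.FDERIV[OF assms(1) has_derivative_fder[OF assms(2)] has_derivative_fder[OF assms(3)]]
  by (simp add: fder_eq)

lemmas fder_mult = fder_bilinear[OF bounded_bilinear_mult]

lemma fder_add:
  assumes "f differentiable (at x)" "g differentiable (at x)"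
  shows "fder (\<lambda>x. f x + g x) x v = fder f x v + fder g x v"
  using has_derivative_add[OF has_derivative_fder[OF assms(1)] has_derivative_fder[OF assms(2)]]
  by (simp add: fder_eq)

lemma fder_diff:
  assumes "f differentiable (at x)" "g differentiable (at x)"
  shows "fder (\<lambda>x. f x - g x) x v = fder f x v - fder g x v"
  using has_derivative_diff[OF has_derivative_fder[OF assms(1)] has_derivative_fder[OF assms(2)]]
  by (simp add: fder_eq)

lemma fder_const [simp]: "fder (\<lambda>x. c) x v = 0"
  by (simp add: fder_eq[OF has_derivative_const])

lemma fder_ident [simp]: "fder (\<lambda>x. x) x v = v"
  by (simp add: fder_eq[OF has_derivative_ident])

section \<open>Symmetry of second derivatives\<close>

lemma DERIV_along_line:
  fixes f :: "'a::euclidean_space \<Rightarrow> real"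
  assumes "f differentiable (at (c + s *\<^sub>R X))"
  shows "((\<lambda>s. f (c + s *\<^sub>R X)) has_real_derivative fder f (c + s *\<^sub>R X) X) (at s)"
proof -
  have "((\<lambda>s. c + s *\<^sub>R X) has_derivative (\<lambda>t. t *\<^sub>R X)) (at s)"
    by (auto intro!: derivative_eq_intros)
  from diff_chain_at[OF this has_derivative_fder[OF assms]]
  have "((\<lambda>s. f (c + s *\<^sub>R X)) has_derivative (\<lambda>t. t * fder f (c + s *\<^sub>R X) X)) (at s)"
    using linear_cmul[OF fder_linear[OF assms]] by (simp add: o_def)
  then show ?thesis by (simp add: has_field_derivative_def mult.commute[of _ "fder f _ X"])
qed

text \<open>
  The second difference over a parallelogram is a mixed second derivative at some intermediate point.
  The left-hand side is symmetric in \<open>X\<close> and \<open>Y\<close> while the right-hand side singles out one order of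
  differentiation, so that both orders can be compared.
\<close>
lemma double_mean_value:
  fixes f :: "'a::euclidean_space \<Rightarrow> real"
  assumes "smooth_on U f" "h > 0" "\<And>s t. 0 \<le> s \<Longrightarrow> s \<le> h \<Longrightarrow> 0 \<le> t \<Longrightarrow> t \<le> h \<Longrightarrow> x + s *\<^sub>R X + t *\<^sub>R Y \<in> U"
  shows "\<exists>s t. 0 \<le> s \<and> s \<le> h \<and> 0 \<le> t \<and> t \<le> h \<and>
    f (x + h *\<^sub>R X + h *\<^sub>R Y) - f (x + h *\<^sub>R X) - f (x + h *\<^sub>R Y) + f x
      = h\<^sup>2 * fder (\<lambda>y. fder f y X) (x + s *\<^sub>R X + t *\<^sub>R Y) Y"
proof -
  have inU: "x + t *\<^sub>R Y + s *\<^sub>R X \<in> U" if "0 \<le> s" "s \<le> h" "0 \<le> t" "t \<le> h" for s t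
    using assms(3)[OF that] by (simp add: algebra_simps)
  have d: "((\<lambda>s. f (x + t *\<^sub>R Y + s *\<^sub>R X)) has_real_derivative fder f (x + t *\<^sub>R Y + s *\<^sub>R X) X) (at s)"
    if "0 \<le> s" "s \<le> h" "0 \<le> t" "t \<le> h" for s t
    by (rule DERIV_along_line[OF smooth_on_differentiable[OF assms(1) inU[OF that]]])
  have dd: "((\<lambda>s. f (x + h *\<^sub>R Y + s *\<^sub>R X) - f (x + 0 *\<^sub>R Y + s *\<^sub>R X)) has_real_derivative
      fder f (x + h *\<^sub>R Y + s *\<^sub>R X) X - fder f (x + 0 *\<^sub>R Y + s *\<^sub>R X) X) (at s)"
    if "0 \<le> s" "s \<le> h" for s
    using that assms(2) by (intro DERIV_diff d) auto
  obtain s where s: "0 < s" "s < h"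
    "f (x + h *\<^sub>R Y + h *\<^sub>R X) - f (x + 0 *\<^sub>R Y + h *\<^sub>R X) - (f (x + h *\<^sub>R Y + 0 *\<^sub>R X) - f (x + 0 *\<^sub>R Y + 0 *\<^sub>R X)) =
      (h - 0) * (fder f (x + h *\<^sub>R Y + s *\<^sub>R X) X - fder f (x + 0 *\<^sub>R Y + s *\<^sub>R X) X)"
    using MVT2[OF assms(2) dd] by blast
  have d2: "((\<lambda>t. fder f (x + s *\<^sub>R X + t *\<^sub>R Y) X) has_real_derivative
      fder (\<lambda>y. fder f y X) (x + s *\<^sub>R X + t *\<^sub>R Y) Y) (at t)" if "0 \<le> t" "t \<le> h" for t
    by (rule DERIV_along_line[OF smooth_on_differentiable[OF smooth_on_fder[OF assms(1)]]])
       (use assms(3)[of s t] s that in auto)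
  obtain t where t: "0 < t" "t < h"
    "fder f (x + s *\<^sub>R X + h *\<^sub>R Y) X - fder f (x + s *\<^sub>R X + 0 *\<^sub>R Y) X =
      (h - 0) * fder (\<lambda>y. fder f y X) (x + s *\<^sub>R X + t *\<^sub>R Y) Y"
    using MVT2[OF assms(2), OF d2] by auto
  show ?thesis
    using s t by (intro exI[of _ s] exI[of _ t]) (simp add: algebra_simps power2_eq_square)
qed

lemma second_derivative_symmetric_real:
  fixes f :: "'a::euclidean_space \<Rightarrow> real"
  assumes "open U" "smooth_on U f" "x \<in> U"
  shows "fder (\<lambda>y. fder f y X) x Y = fder (\<lambda>y. fder f y Y) x X"
proof (rule ccontr)
  define g where "g = (\<lambda>X Y y. fder (\<lambda>y. fder f y X) y Y)"
  assume "\<not> ?thesis"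
  then have ne: "g X Y x \<noteq> g Y X x" by (simp add: g_def)
  define e where "e = \<bar>g X Y x - g Y X x\<bar> / 2"
  have e: "e > 0" using ne by (simp add: e_def)
  have c: "isCont (g X Y) x" for X Y
    unfolding g_def using smooth_on_continuous_on[OF smooth_on_fder[OF smooth_on_fder[OF assms(2)]]]
      assms(1,3) continuous_on_eq_continuous_at by blast
  obtain r1 where r1: "r1 > 0" "\<And>y. dist y x < r1 \<Longrightarrow> dist (g X Y y) (g X Y x) < e"
    using c[of X Y] e unfolding continuous_at_eps_delta by (metis dist_commute)
  obtain r2 where r2: "r2 > 0" "\<And>y. dist y x < r2 \<Longrightarrow> dist (g Y X y) (g Y X x) < e"
    using c[of Y X] e unfolding continuous_at_eps_delta by (metis dist_commute)
  obtain r3 where r3: "r3 > 0" "ball x r3 \<subseteq> U" using assms open_contains_ball by blast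
  define r where "r = Min {r1, r2, r3}"
  have r: "r > 0" "r \<le> r1" "r \<le> r2" "r \<le> r3" using r1 r2 r3 by (auto simp: r_def)
  define h where "h = r / (norm X + norm Y + 1)"
  have den: "norm X + norm Y + 1 > 0" by (smt (verit) norm_ge_zero)
  have h: "h > 0" using r den by (simp add: h_def)
  have near: "dist (x + s *\<^sub>R X + t *\<^sub>R Y) x < r" if "0 \<le> s" "s \<le> h" "0 \<le> t" "t \<le> h" for s t
  proof -
    have "dist (x + s *\<^sub>R X + t *\<^sub>R Y) x = norm (s *\<^sub>R X + t *\<^sub>R Y)" by (simp add: dist_norm)
    also have "\<dots> \<le> s * norm X + t * norm Y" using norm_triangle_ineq[of "s *\<^sub>R X" "t *\<^sub>R Y"] that by simp
    also have "\<dots> \<le> h * norm X + h * norm Y" using that by (intro add_mono mult_right_mono) auto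
    also have "\<dots> < h * (norm X + norm Y + 1)" using h by (simp add: algebra_simps)
    also have "\<dots> = r" using den by (simp add: h_def)
    finally show ?thesis .
  qed
  have inU: "x + s *\<^sub>R X + t *\<^sub>R Y \<in> U" if "0 \<le> s" "s \<le> h" "0 \<le> t" "t \<le> h" for s t
    using near[OF that] r r3 by (auto simp: dist_commute)
  obtain s t where st: "0 \<le> s" "s \<le> h" "0 \<le> t" "t \<le> h"
    "f (x + h *\<^sub>R X + h *\<^sub>R Y) - f (x + h *\<^sub>R X) - f (x + h *\<^sub>R Y) + f x = h\<^sup>2 * g X Y (x + s *\<^sub>R X + t *\<^sub>R Y)"
    using double_mean_value[OF assms(2) h, of x X Y] inU unfolding g_def by blast
  have inU': "x + t *\<^sub>R Y + s *\<^sub>R X \<in> U" if "0 \<le> t" "t \<le> h" "0 \<le> s" "s \<le> h" for s t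
    using inU[of s t] that by (simp add: algebra_simps)
  obtain t' s' where st': "0 \<le> s'" "s' \<le> h" "0 \<le> t'" "t' \<le> h"
    "f (x + h *\<^sub>R Y + h *\<^sub>R X) - f (x + h *\<^sub>R Y) - f (x + h *\<^sub>R X) + f x = h\<^sup>2 * g Y X (x + t' *\<^sub>R Y + s' *\<^sub>R X)"
    using double_mean_value[OF assms(2) h, of x Y X] inU' unfolding g_def by blast
  have "h\<^sup>2 * g X Y (x + s *\<^sub>R X + t *\<^sub>R Y) = h\<^sup>2 * g Y X (x + s' *\<^sub>R X + t' *\<^sub>R Y)"
    using st(5) st'(5) by (simp add: algebra_simps)
  then have "g X Y (x + s *\<^sub>R X + t *\<^sub>R Y) = g Y X (x + s' *\<^sub>R X + t' *\<^sub>R Y)" using h by simp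
  moreover have "dist (g X Y (x + s *\<^sub>R X + t *\<^sub>R Y)) (g X Y x) < e"
    using r1 near[OF st(1-4)] r by auto
  moreover have "dist (g Y X (x + s' *\<^sub>R X + t' *\<^sub>R Y)) (g Y X x) < e"
    using r2 near[OF st'(1-4)] r by auto
  ultimately have "\<bar>g X Y x - g Y X x\<bar> < e + e" unfolding dist_real_def by linarith
  then show False by (simp add: e_def)
qed

lemma second_derivative_symmetric:
  fixes f :: "'a::euclidean_space \<Rightarrow> 'b::euclidean_space"
  assumes "open U" "smooth_on U f" "x \<in> U"
  shows "fder (\<lambda>y. fder f y X) x Y = fder (\<lambda>y. fder f y Y) x X"
proof (rule euclidean_eqI)
  fix b :: 'b assume "b \<in> Basis"
  have bl: "bounded_linear (\<lambda>y. y \<bullet> b)" by (rule bounded_linear_inner_left)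
  have s: "smooth_on U (\<lambda>y. f y \<bullet> b)"
    by (rule smooth_on_bounded_linear_compose[OF bl assms(1,2)])
  have *: "fder (\<lambda>y. fder (\<lambda>y. f y \<bullet> b) y X) x Y = fder (\<lambda>y. fder f y X) x Y \<bullet> b" for X Y
  proof -
    have "fder (\<lambda>y. fder (\<lambda>y. f y \<bullet> b) y X) x Y = fder (\<lambda>y. fder f y X \<bullet> b) x Y"
      using frechet_derivative_cong_open[OF assms(1,3), of "\<lambda>y. fder (\<lambda>y. f y \<bullet> b) y X" "\<lambda>y. fder f y X \<bullet> b"]
        fder_bounded_linear_compose[OF bl] smooth_on_differentiable[OF assms(2)] by metis
    also have "\<dots> = fder (\<lambda>y. fder f y X) x Y \<bullet> b"
      using fder_bounded_linear_compose[OF bl] smooth_on_differentiable[OF smooth_on_fder[OF assms(2)] assms(3)] by metis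
    finally show ?thesis .
  qed
  show "fder (\<lambda>y. fder f y X) x Y \<bullet> b = fder (\<lambda>y. fder f y Y) x X \<bullet> b"
    using second_derivative_symmetric_real[OF assms(1) s assms(3), of X Y] by (simp add: *)
qed

section \<open>Differential 1-forms on open sets\<close>

definition smooth_form :: "'a::euclidean_space set \<Rightarrow> ('a \<Rightarrow> 'a \<Rightarrow> 'b::euclidean_space) \<Rightarrow> bool" where
  "smooth_form U a \<longleftrightarrow> (\<forall>z\<in>U. linear (a z)) \<and> (\<forall>v. smooth_on U (\<lambda>z. a z v))"

text \<open>
  The exterior derivative with constant vectors \<open>X\<close> and \<open>Y\<close> inserted; no Lie bracket appears because
  constant vector fields commute.
\<close>
definition dform :: "('a::euclidean_space \<Rightarrow> 'a \<Rightarrow> 'b::euclidean_space) \<Rightarrow> 'a \<Rightarrow> 'a \<Rightarrow> 'a \<Rightarrow> 'b" where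
  "dform a z X Y = fder (\<lambda>z. a z Y) z X - fder (\<lambda>z. a z X) z Y"

lemma dform_cong:
  assumes "open U" "z \<in> U" "\<And>y v. y \<in> U \<Longrightarrow> a y v = b y v"
  shows "dform a z X Y = dform b z X Y"
  unfolding dform_def
  using frechet_derivative_cong_open[OF assms(1,2), of "\<lambda>y. a y X" "\<lambda>y. b y X"]
    frechet_derivative_cong_open[OF assms(1,2), of "\<lambda>y. a y Y" "\<lambda>y. b y Y"] assms(3) by simp

lemma smooth_form_subset: "smooth_form U a \<Longrightarrow> V \<subseteq> U \<Longrightarrow> smooth_form V a"
  unfolding smooth_form_def using smooth_on_subset by blast

lemma smooth_form_fder: "smooth_on U f \<Longrightarrow> smooth_form U (\<lambda>z. fder f z)"
  unfolding smooth_form_def using smooth_on_linear_fder smooth_on_fder by blast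

lemma dform_fder:
  assumes "open U" "z \<in> U" "smooth_on U f"
  shows "dform (\<lambda>z. fder f z) z X Y = 0"
  unfolding dform_def using second_derivative_symmetric[OF assms(1,3,2)] by simp

lemma smooth_form_blinfun:
  assumes "open U" "smooth_on U a"
  shows "smooth_form U (\<lambda>z. blinfun_apply (a z))"
  unfolding smooth_form_def
  using assms by (auto intro!: smooth_on_blinfun_apply smooth_on_const
      simp: bounded_linear.linear[OF blinfun.bounded_linear_right])

lemma smooth_on_Blinfun_form:
  assumes "open U" "smooth_form U a"
  shows "smooth_on U (\<lambda>z. Blinfun (a z))" "\<And>z. z \<in> U \<Longrightarrow> blinfun_apply (Blinfun (a z)) = a z"
  using assms smooth_on_Blinfun[of U a] linear_bounded_linear bounded_linear_Blinfun_apply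
  unfolding smooth_form_def by blast+

lemma fder_blinfun_apply:
  assumes "a differentiable (at z)"
  shows "blinfun_apply (fder a z X) Y = fder (\<lambda>z. blinfun_apply (a z) Y) z X"
  using fder_bounded_linear_compose[OF blinfun.bounded_linear_left assms] by simp

lemma fder_apply_family:
  assumes "open U" "z \<in> U" "smooth_form U a" "h differentiable (at z)"
  shows "(\<lambda>z. a z (h z)) differentiable (at z)"
    "fder (\<lambda>z. a z (h z)) z X = a z (fder h z X) + fder (\<lambda>y. a y (h z)) z X"
proof -
  note B = smooth_on_Blinfun_form[OF assms(1,3)]
  have Bd: "(\<lambda>z. Blinfun (a z)) differentiable (at z)"
    by (rule smooth_on_differentiable[OF B(1) assms(2)])
  have eq: "frechet_derivative (\<lambda>z. a z (h z)) (at z) = fder (\<lambda>z. blinfun_apply (Blinfun (a z)) (h z)) z"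
    by (rule frechet_derivative_cong_open[OF assms(1,2)]) (simp add: B)
  have eq2: "frechet_derivative (\<lambda>y. a y (h z)) (at z) = fder (\<lambda>y. blinfun_apply (Blinfun (a y)) (h z)) z"
    by (rule frechet_derivative_cong_open[OF assms(1,2)]) (simp add: B)
  show "fder (\<lambda>z. a z (h z)) z X = a z (fder h z X) + fder (\<lambda>y. a y (h z)) z X"
    unfolding eq eq2 fder_bilinear[OF bounded_bilinear_blinfun_apply Bd assms(4)]
    by (simp add: B assms(2) fder_blinfun_apply[OF Bd])
  have "(\<lambda>z. blinfun_apply (Blinfun (a z)) (h z)) differentiable (at z)"
    using bounded_bilinear.FDERIV[OF bounded_bilinear_blinfun_apply has_derivative_fder[OF Bd] has_derivative_fder[OF assms(4)]]
    by (auto simp: differentiable_def)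
  then show "(\<lambda>z. a z (h z)) differentiable (at z)"
    unfolding differentiable_def
    using has_derivative_cong_open[OF assms(1,2), of "\<lambda>z. a z (h z)" "\<lambda>z. blinfun_apply (Blinfun (a z)) (h z)"]
    by (simp add: B)
qed

definition pullback :: "('a::euclidean_space \<Rightarrow> 'b::euclidean_space) \<Rightarrow> ('b \<Rightarrow> 'b \<Rightarrow> 'c::euclidean_space) \<Rightarrow> 'a \<Rightarrow> 'a \<Rightarrow> 'c" where
  "pullback g a z X = a (g z) (fder g z X)"

lemma smooth_form_pullback:
  assumes "open U" "open V" "\<And>z. z \<in> U \<Longrightarrow> g z \<in> V" "smooth_on U g" "smooth_form V a"
  shows "smooth_form U (pullback g a)"
proof -
  have l: "linear (a (g z))" if "z \<in> U" for z using assms that by (auto simp: smooth_form_def)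
  have 1: "linear (pullback g a z)" if "z \<in> U" for z
    using linear_compose[OF smooth_on_linear_fder[OF assms(4) that] l[OF that]]
    by (simp add: pullback_def[abs_def] o_def)
  have 2: "smooth_on U (\<lambda>z. pullback g a z v)" for v
    unfolding pullback_def
    by (rule smooth_on_linear_family[OF assms(1) l _ smooth_on_fder[OF assms(4)]])
       (use assms in \<open>auto simp: smooth_form_def intro: smooth_on_compose[OF assms(1-3)]\<close>)
  show ?thesis using 1 2 by (simp add: smooth_form_def)
qed

text \<open>
  Differentiating \<open>a (g z) (Dg z Y)\<close> along \<open>X\<close> gives the expected term and a term with the second
  derivative of \<open>g\<close>. The latter is symmetric in \<open>X\<close> and \<open>Y\<close> and cancels.
\<close>
lemma dform_pullback:
  fixes g :: "'a::euclidean_space \<Rightarrow> 'b::euclidean_space"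
  assumes "open U" "open V" "\<And>z. z \<in> U \<Longrightarrow> g z \<in> V" "smooth_on U g" "smooth_form V a" "z \<in> U"
  shows "dform (pullback g a) z X Y = dform a (g z) (fder g z X) (fder g z Y)"
proof -
  note B = smooth_on_Blinfun_form[OF assms(2,5)]
  have gd: "g differentiable (at z)" by (rule smooth_on_differentiable[OF assms(4,6)])
  have Bd: "(\<lambda>z. Blinfun (a z)) differentiable (at (g z))"
    by (rule smooth_on_differentiable[OF B(1) assms(3)[OF assms(6)]])
  have Bgd: "(\<lambda>z. Blinfun (a (g z))) differentiable (at z)"
    by (rule smooth_on_differentiable[OF smooth_on_compose[OF assms(1-3) B(1) assms(4)] assms(6)])
  have *: "fder (\<lambda>z. pullback g a z Y) z X = a (g z) (fder (\<lambda>z. fder g z Y) z X) + fder (\<lambda>w. a w (fder g z Y)) (g z) (fder g z X)"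
    for X Y
  proof -
    have hd: "(\<lambda>z. fder g z Y) differentiable (at z)"
      by (rule smooth_on_differentiable[OF smooth_on_fder[OF assms(4)] assms(6)])
    have "frechet_derivative (\<lambda>z. pullback g a z Y) (at z) = fder (\<lambda>z. blinfun_apply (Blinfun (a (g z))) (fder g z Y)) z"
      by (rule frechet_derivative_cong_open[OF assms(1,6)]) (simp add: pullback_def B assms(3))
    then have "fder (\<lambda>z. pullback g a z Y) z X =
      blinfun_apply (Blinfun (a (g z))) (fder (\<lambda>z. fder g z Y) z X) +
      blinfun_apply (fder (\<lambda>z. Blinfun (a (g z))) z X) (fder g z Y)"
      using fder_bilinear[OF bounded_bilinear_blinfun_apply Bgd hd] by simp
    also have "fder (\<lambda>z. Blinfun (a (g z))) z X = fder (\<lambda>z. Blinfun (a z)) (g z) (fder g z X)"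
      by (rule fder_compose[OF Bd gd])
    also have "blinfun_apply (fder (\<lambda>z. Blinfun (a z)) (g z) (fder g z X)) (fder g z Y) =
      fder (\<lambda>w. blinfun_apply (Blinfun (a w)) (fder g z Y)) (g z) (fder g z X)"
      by (rule fder_blinfun_apply[OF Bd])
    also have "frechet_derivative (\<lambda>w. blinfun_apply (Blinfun (a w)) (fder g z Y)) (at (g z)) =
      fder (\<lambda>w. a w (fder g z Y)) (g z)"
      by (rule frechet_derivative_cong_open[OF assms(2) assms(3)[OF assms(6)]]) (simp add: B)
    also have "blinfun_apply (Blinfun (a (g z))) (fder (\<lambda>z. fder g z Y) z X) = a (g z) (fder (\<lambda>z. fder g z Y) z X)"
      by (simp add: B assms(3,6))
    finally show ?thesis .
  qed
  show ?thesis
    unfolding dform_def * using second_derivative_symmetric[OF assms(1,4,6), of X Y] by simp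
qed

section \<open>The Poincare lemma\<close>

text \<open>
  The Poincare lemma for 1-forms. The primitive is the integral of the form over the segment from the
  centre. Its derivative is computed under the integral sign; closedness turns the integrand into the
  derivative of \<open>t a(z\<^sub>t)(X)\<close> with respect to \<open>t\<close>, where \<open>z\<^sub>t\<close> runs through the segment.
\<close>
lemma poincare_ball:
  fixes a :: "'a::euclidean_space \<Rightarrow> 'a \<Rightarrow> 'b::euclidean_space"
  assumes "smooth_form (ball z0 r) a" "\<And>z X Y. z \<in> ball z0 r \<Longrightarrow> dform a z X Y = 0"
  obtains F where "smooth_on (ball z0 r) F" "\<And>z X. z \<in> ball z0 r \<Longrightarrow> fder F z X = a z X"
proof -
  let ?B = "ball z0 r"
  define p where "p = (\<lambda>(z::'a, t::real). z0 + t *\<^sub>R (z - z0))"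
  define W where "W = {w. fst w \<in> ?B \<and> p w \<in> ?B}"
  have pc: "continuous_on UNIV p" unfolding p_def case_prod_beta by (intro continuous_intros)
  have "W = fst -` ?B \<inter> p -` ?B" by (auto simp: W_def)
  then have W: "open W"
    using open_vimage[OF _ pc] open_vimage_fst[of ?B] by auto
  have inW: "(z, t) \<in> W" if "z \<in> ?B" "0 \<le> t" "t \<le> 1" for z t
  proof -
    have "dist z0 (p (z, t)) = t * dist z0 z" using that by (simp add: p_def dist_norm norm_minus_commute)
    also have "\<dots> \<le> dist z0 z" using that mult_left_le_one_le[of "dist z0 z" t] by simp
    finally show ?thesis using that by (simp add: W_def)
  qed
  have pW: "p w \<in> ?B" if "w \<in> W" for w using that by (simp add: W_def)
  have sfst: "smooth_on W (\<lambda>w. fst w - z0)"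
    by (intro smooth_intros W smooth_on_bounded_linear[OF bounded_linear_fst])
  have sp: "smooth_on W p" unfolding p_def case_prod_beta
    by (intro smooth_intros W smooth_on_bounded_linear[OF bounded_linear_fst] smooth_on_bounded_linear[OF bounded_linear_snd])
  define G where "G = (\<lambda>z t. a (p (z, t)) (z - z0))"
  \<comment> \<open>the derivative of the integrand with respect to the end point of the segment\<close>
  define L where "L = (\<lambda>w X. a (p w) X + snd w *\<^sub>R fder (\<lambda>y. a y (fst w - z0)) (p w) X)"
  have alin: "linear (a z)" if "z \<in> ?B" for z using assms(1) that by (simp add: smooth_form_def)
  have asm: "smooth_on ?B (\<lambda>z. a z v)" for v using assms(1) by (simp add: smooth_form_def)
  have Llin: "linear (L w)" if "w \<in> W" for w
    unfolding L_def
    by (intro linear_compose_add linear_compose_scale_right alin pW that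
        smooth_on_linear_fder[OF asm pW[OF that]])
  have closed: "fder (\<lambda>y. a y h) z X = fder (\<lambda>y. a y X) z h" if "z \<in> ?B" for z X h
    using assms(2)[OF that, of X h] by (simp add: dform_def)
  have Lsm: "smooth_on W (\<lambda>w. L w X)" for X
  proof -
    have "smooth_on W (\<lambda>w. a (p w) X + snd w *\<^sub>R fder (\<lambda>y. a y X) (p w) (fst w - z0))"
      by (intro smooth_on_add W smooth_on_compose[OF W _ pW asm sp] smooth_on_scaleR
          smooth_on_bounded_linear[OF bounded_linear_snd]
          smooth_on_fder_at[OF W _ pW asm sp sfst]) auto
    then show ?thesis
      by (rule smooth_on_cong[OF W]) (simp add: L_def closed[OF pW])
  qed
  have Bl: "blinfun_apply (Blinfun (L w)) = L w" if "w \<in> W" for w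
    by (rule bounded_linear_Blinfun_apply[OF linear_bounded_linear[OF Llin[OF that]]])
  define F where "F = (\<lambda>z. integral (cbox 0 1) (G z))"
  have Gd: "((\<lambda>z. G z t) has_derivative blinfun_apply (Blinfun (L (z, t)))) (at z within ?B)"
    if z: "z \<in> ?B" and t: "t \<in> cbox 0 1" for z t
  proof -
    have w: "(z, t) \<in> W" using inW z t by auto
    have B: "blinfun_apply (Blinfun (L (z, t))) = L (z, t)" by (rule Bl[OF w])
    have pd: "((\<lambda>z. p (z, t)) has_derivative (\<lambda>X. t *\<^sub>R X)) (at z)"
      unfolding p_def by (auto intro!: derivative_eq_intros)
    have pd': "(\<lambda>z. p (z, t)) differentiable (at z)" "fder (\<lambda>z. p (z, t)) z = (\<lambda>X. t *\<^sub>R X)"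
      using pd fder_eq[OF pd] by (auto simp: differentiable_def)
    have oP: "open {z. p (z, t) \<in> ?B}"
    proof -
      have "continuous_on UNIV (\<lambda>z. p (z, t))" unfolding p_def by (auto intro!: continuous_intros)
      from open_vimage[OF _ this, of ?B] show ?thesis by (simp add: vimage_def)
    qed
    have sfa: "smooth_form {z. p (z, t) \<in> ?B} (\<lambda>z. a (p (z, t)))"
      unfolding smooth_form_def
    proof (intro conjI ballI allI)
      show "linear (a (p (y, t)))" if "y \<in> {z. p (z, t) \<in> ?B}" for y using that alin by simp
      have "smooth_on {z. p (z, t) \<in> ?B} (\<lambda>z. p (z, t))"
        unfolding p_def case_prod_conv by (intro smooth_intros oP[unfolded p_def case_prod_conv])
      then show "smooth_on {z. p (z, t) \<in> ?B} (\<lambda>z. a (p (z, t)) v)" for v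
        by (intro smooth_on_compose[OF oP open_ball _ asm]) auto
    qed
    have zin: "z \<in> {z. p (z, t) \<in> ?B}" using w by (simp add: W_def)
    have hd: "(\<lambda>z. z - z0) differentiable (at z)" by (intro derivative_intros)
    have hd2: "fder (\<lambda>z. z - z0) z X = X" for X
      by (rule fun_cong[OF fder_eq]) (auto intro!: derivative_eq_intros)
    note ap = fder_apply_family[OF oP zin sfa hd]
    have "fder (\<lambda>z. G z t) z X = L (z, t) X" for X
    proof -
      have "fder (\<lambda>y. a (p (y, t)) (z - z0)) z X = fder (\<lambda>y. a y (z - z0)) (p (z, t)) (t *\<^sub>R X)"
        using fder_compose[of "\<lambda>y. a y (z - z0)" "\<lambda>y. p (y, t)" z X] pd'
          smooth_on_differentiable[OF asm] zin by simp
      also have "\<dots> = t *\<^sub>R fder (\<lambda>y. a y (z - z0)) (p (z, t)) X"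
        using linear_cmul[OF smooth_on_linear_fder[OF asm]] zin by blast
      finally show ?thesis unfolding G_def ap(2) hd2 by (simp add: L_def)
    qed
    then have "frechet_derivative (\<lambda>z. G z t) (at z) = L (z, t)" by auto
    moreover have "((\<lambda>z. G z t) has_derivative fder (\<lambda>z. G z t) z) (at z)"
      using has_derivative_fder[OF ap(1)] unfolding G_def by simp
    ultimately show ?thesis using B by (simp add: has_derivative_at_withinI)
  qed
  have cG: "continuous_on (cbox 0 1) (G z)" if "z \<in> ?B" for z
  proof -
    have "smooth_on W (\<lambda>w. a (p w) (fst w - z0))"
      by (rule smooth_on_linear_family[OF W alin[OF pW] smooth_on_compose[OF W open_ball pW asm sp] sfst])
    moreover have "continuous_on (cbox 0 1) (\<lambda>t::real. (z, t))" by (intro continuous_intros)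
    moreover have "(\<lambda>t. (z, t)) ` cbox 0 1 \<subseteq> W" using inW[OF that] by auto
    ultimately show ?thesis
      using continuous_on_compose2[OF smooth_on_continuous_on, of W "\<lambda>w. a (p w) (fst w - z0)" "cbox 0 1" "\<lambda>t. (z, t)"]
      unfolding G_def by simp
  qed
  have cL: "continuous_on (?B \<times> cbox 0 1) (\<lambda>(z, t). Blinfun (L (z, t)))"
  proof -
    have "?B \<times> cbox 0 1 \<subseteq> W" by (auto simp del: mem_ball intro: inW)
    from continuous_on_subset[OF smooth_on_continuous_on[OF smooth_on_Blinfun[OF W Llin Lsm]] this]
    show ?thesis by (simp add: case_prod_beta)
  qed
  have Fd: "(F has_derivative a z) (at z)" if z: "z \<in> ?B" for z
  proof -
    have "(F has_derivative blinfun_apply (integral (cbox 0 1) (\<lambda>t. Blinfun (L (z, t))))) (at z within ?B)"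
      unfolding F_def
      by (rule leibniz_rule[OF Gd _ cL z convex_ball]) (use integrable_continuous[OF cG] in auto)
    moreover have "blinfun_apply (integral (cbox 0 1) (\<lambda>t. Blinfun (L (z, t)))) X = a z X" for X
    proof -
      have ci: "continuous_on (cbox 0 1) (\<lambda>t. Blinfun (L (z, t)))"
      proof -
        have "continuous_on (cbox 0 1) (\<lambda>t::real. (z, t))" by (intro continuous_intros)
        moreover have "(\<lambda>t. (z, t)) ` cbox 0 1 \<subseteq> ?B \<times> cbox 0 1" using z by blast
        ultimately show ?thesis using continuous_on_compose2[OF cL] by fastforce
      qed
      have "blinfun_apply (integral (cbox 0 1) (\<lambda>t. Blinfun (L (z, t)))) X
          = integral (cbox 0 1) (\<lambda>t. blinfun_apply (Blinfun (L (z, t))) X)"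
        using blinfun_apply_integral[OF integrable_continuous[OF ci]] by metis
      also have "\<dots> = integral (cbox 0 1) (\<lambda>t. L (z, t) X)"
        by (rule integral_cong) (use Bl inW[OF z] in auto)
      also have "\<dots> = 1 *\<^sub>R a (p (z, 1)) X - 0 *\<^sub>R a (p (z, 0)) X"
      proof (rule integral_unique, unfold cbox_interval, rule fundamental_theorem_of_calculus)
        fix t :: real assume t: "t \<in> {0..1}"
        then have w: "(z, t) \<in> W" using inW z by auto
        have pd: "((\<lambda>t. p (z, t)) has_derivative (\<lambda>s. s *\<^sub>R (z - z0))) (at t)"
          unfolding p_def by (auto intro!: derivative_eq_intros)
        have ad: "((\<lambda>y. a y X) has_derivative fder (\<lambda>y. a y X) (p (z, t))) (at (p (z, t)))"
          by (rule smooth_on_has_derivative[OF asm pW[OF w]])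
        from diff_chain_at[OF pd ad]
        have "((\<lambda>t. a (p (z, t)) X) has_derivative (\<lambda>s. s *\<^sub>R fder (\<lambda>y. a y X) (p (z, t)) (z - z0))) (at t)"
          using linear_cmul[OF smooth_on_linear_fder[OF asm pW[OF w]]] by (simp add: o_def)
        then have v: "((\<lambda>t. a (p (z, t)) X) has_vector_derivative fder (\<lambda>y. a y X) (p (z, t)) (z - z0)) (at t)"
          by (simp add: has_vector_derivative_def)
        have "((\<lambda>t. t *\<^sub>R a (p (z, t)) X) has_vector_derivative
          (t *\<^sub>R fder (\<lambda>y. a y X) (p (z, t)) (z - z0) + 1 *\<^sub>R a (p (z, t)) X)) (at t)"
          by (rule has_vector_derivative_scaleR[OF _ v]) (auto intro!: derivative_eq_intros)
        then show "((\<lambda>t. t *\<^sub>R a (p (z, t)) X) has_vector_derivative L (z, t) X) (at t within {0..1})"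
          unfolding L_def using closed[OF pW[OF w]] by (simp add: has_vector_derivative_at_within add.commute)
      qed simp
      also have "\<dots> = a z X" by (simp add: p_def)
      finally show ?thesis .
    qed
    moreover have "at z within ?B = at z" by (rule at_within_open[OF z open_ball])
    moreover have "blinfun_apply (integral (cbox 0 1) (\<lambda>t. Blinfun (L (z, t)))) = a z"
      using calculation(2) by (rule ext)
    ultimately show ?thesis by simp
  qed
  show thesis
  proof (rule that[of F])
    show "smooth_on ?B F" by (rule smooth_onI[OF open_ball Fd asm])
    show "fder F z X = a z X" if "z \<in> ?B" for z X using fder_eq[OF Fd[OF that]] by simp
  qed
qed

section \<open>Retractions onto hypersurfaces\<close>

text \<open>
  A neighbourhood of a point of a hypersurface retracts smoothly onto it. The differential of the
  retraction at points of the hypersurface is a projection onto the tangent space, which is why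
  restricting to the hypersurface and pulling back under the retraction lose no information about
  tangent vectors. This replaces local parametrisations: all computations stay in the ambient space.
\<close>
lemma hypersurface_retraction:
  fixes \<rho> :: "'a::euclidean_space \<Rightarrow> real"
  assumes U: "open U" and s: "smooth_on U \<rho>" and z0: "z0 \<in> U" "\<rho> z0 = 0" "fder \<rho> z0 N0 \<noteq> 0"
  obtains V \<pi> where "open V" "z0 \<in> V" "V \<subseteq> U" "smooth_on V \<pi>"
    "\<And>z. z \<in> V \<Longrightarrow> \<pi> z \<in> U" "\<And>z. z \<in> V \<Longrightarrow> \<rho> (\<pi> z) = 0"
    "\<And>z. z \<in> V \<Longrightarrow> \<rho> z = 0 \<Longrightarrow> \<pi> z = z"
    "\<And>z X. z \<in> V \<Longrightarrow> \<rho> z = 0 \<Longrightarrow> fder \<rho> z X = 0 \<Longrightarrow> fder \<pi> z X = X"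
proof -
  define l where "l = fder \<rho> z0"
  have l: "linear l" unfolding l_def by (rule smooth_on_linear_fder[OF s z0(1)])
  have bl: "bounded_linear l" by (rule linear_bounded_linear[OF l])
  define N where "N = (1 / l N0) *\<^sub>R N0"
  have lN: "l N = 1" using z0(3) linear_cmul[OF l] by (simp add: N_def l_def)
  have lR: "linear (fder \<rho> z)" if "z \<in> U" for z by (rule smooth_on_linear_fder[OF s that])
  \<comment> \<open>coordinates that straighten the hypersurface: \<open>\<rho>\<close> becomes the linear function \<open>l\<close>\<close>
  define \<Phi> where "\<Phi> = (\<lambda>z. z - l z *\<^sub>R N + \<rho> z *\<^sub>R N)"
  define d where "d = (\<lambda>z X. X - l X *\<^sub>R N + fder \<rho> z X *\<^sub>R N)"
  have dlin: "linear (d z)" if "z \<in> U" for z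
    by (rule linearI) (simp_all add: d_def linear_add[OF l] linear_cmul[OF l] linear_add[OF lR[OF that]]
        linear_cmul[OF lR[OF that]] algebra_simps)
  have dB: "blinfun_apply (Blinfun (d z)) = d z" if "z \<in> U" for z
    by (rule bounded_linear_Blinfun_apply[OF linear_bounded_linear[OF dlin[OF that]]])
  have dsm: "smooth_on U (\<lambda>z. Blinfun (d z))"
    by (rule smooth_on_Blinfun[OF U dlin]) (auto simp: d_def intro!: smooth_intros U s)
  have \<Phi>d: "(\<Phi> has_derivative blinfun_apply (Blinfun (d z))) (at z)" if "z \<in> U" for z
    unfolding dB[OF that] unfolding \<Phi>_def d_def
    by (intro has_derivative_add has_derivative_diff has_derivative_ident has_derivative_scaleR_left
        bounded_linear_imp_has_derivative[OF bl] smooth_on_has_derivative[OF s that])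
  have idb: "id_blinfun o\<^sub>L Blinfun (d z0) = id_blinfun"
    by (rule blinfun_eqI) (simp add: dB[OF z0(1)], simp add: d_def l_def)
  obtain U' V \<Psi> g' where I: "open U'" "U' \<subseteq> U" "z0 \<in> U'" "open V" "\<Phi> z0 \<in> V" "homeomorphism U' V \<Phi> \<Psi>"
    and gd: "\<And>y. y \<in> V \<Longrightarrow> (\<Psi> has_derivative (g' y)) (at y)"
    and g': "\<And>y. y \<in> V \<Longrightarrow> g' y = inv (blinfun_apply (Blinfun (d (\<Psi> y))))"
    and gb: "\<And>y. y \<in> V \<Longrightarrow> bij (blinfun_apply (Blinfun (d (\<Psi> y))))"
    using inverse_function_theorem[OF U \<Phi>d smooth_on_continuous_on[OF dsm] z0(1) idb] by blast
  have \<Psi>U: "\<Psi> y \<in> U'" "\<Psi> y \<in> U" "\<Phi> (\<Psi> y) = y" if "y \<in> V" for y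
    using I(2,6) that by (auto simp: homeomorphism_def)
  have \<Psi>\<Phi>: "\<Psi> (\<Phi> z) = z" if "z \<in> U'" for z using I(6) that by (auto simp: homeomorphism_def)
  have nz: "fder \<rho> (\<Psi> y) N \<noteq> 0" if "y \<in> V" for y
  proof
    assume "fder \<rho> (\<Psi> y) N = 0"
    then have "d (\<Psi> y) N = d (\<Psi> y) 0" using lN linear_0[OF dlin[OF \<Psi>U(2)[OF that]]] by (simp add: d_def)
    then have "N = 0" using gb[OF that] dB[OF \<Psi>U(2)[OF that]] by (auto simp: bij_def dest: injD)
    then show False using lN linear_0[OF l] by simp
  qed
  \<comment> \<open>the inverse of a rank-one perturbation of the identity is explicit, which gives smoothness of \<open>\<Psi>\<close> inductively\<close>
  define e where "e = (\<lambda>y Y. Y - ((fder \<rho> (\<Psi> y) Y - l Y) * inverse (fder \<rho> (\<Psi> y) N)) *\<^sub>R N)"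
  have g'e: "g' y = e y" if y: "y \<in> V" for y
  proof
    fix Y
    note lin = lR[OF \<Psi>U(2)[OF y]]
    define k where "k = (fder \<rho> (\<Psi> y) Y - l Y) * inverse (fder \<rho> (\<Psi> y) N)"
    have k: "k * fder \<rho> (\<Psi> y) N = fder \<rho> (\<Psi> y) Y - l Y" using nz[OF y] by (simp add: k_def)
    have "d (\<Psi> y) (e y Y) = Y - k *\<^sub>R N - (l Y - k) *\<^sub>R N + (fder \<rho> (\<Psi> y) Y - k * fder \<rho> (\<Psi> y) N) *\<^sub>R N"
      unfolding d_def e_def k_def[symmetric]
      using lN by (simp add: linear_diff[OF lin] linear_cmul[OF lin] linear_diff[OF l] linear_cmul[OF l])
    also have "\<dots> = Y" unfolding k by (simp add: algebra_simps)
    finally have "d (\<Psi> y) (e y Y) = Y" .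
    then show "g' y Y = e y Y"
      using gb[OF y] g'[OF y] dB[OF \<Psi>U(2)[OF y]] by (metis bij_def inv_f_eq)
  qed
  have "Ck_on k V \<Psi>" for k
  proof (induction k)
    case 0
    then show ?case using I(6) by (simp add: homeomorphism_def)
  next
    case (Suc k)
    have im: "\<Psi> ` V \<subseteq> U" using \<Psi>U(2) by auto
    have c: "Ck_on k V (\<lambda>y. fder \<rho> (\<Psi> y) Y)" for Y
      by (rule Ck_on_compose[OF I(4) U im _ Suc.IH])
         (use smooth_on_fder[OF s] in \<open>simp add: smooth_on_def\<close>)
    have "Ck_on k V (\<lambda>y. Y + - (((fder \<rho> (\<Psi> y) Y + - l Y) * inverse (fder \<rho> (\<Psi> y) N)) *\<^sub>R N))" for Y
      by (intro Ck_on_add Ck_on_const Ck_on_bounded_linear_compose[OF bounded_linear_minus[OF bounded_linear_ident]]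
          Ck_on_bilinear[OF bounded_bilinear_scaleR] Ck_on_bilinear[OF bounded_bilinear_mult] I(4) c Ck_on_inverse nz)
    then have "Ck_on k V (\<lambda>y. g' y Y)" for Y
      by (rule Ck_on_cong[OF I(4), rotated]) (simp add: g'e e_def)
    then show ?case by (intro Ck_on_SucI[OF I(4) gd])
  qed
  then have \<Psi>s: "smooth_on V \<Psi>" by (simp add: smooth_on_def)
  have l\<Phi>: "l (\<Phi> z) = \<rho> z" for z
    using lN by (simp add: \<Phi>_def linear_add[OF l] linear_diff[OF l] linear_cmul[OF l])
  define q where "q = (\<lambda>z. z - l z *\<^sub>R N)"
  have lq: "l (q z) = 0" for z using lN by (simp add: q_def linear_diff[OF l] linear_cmul[OF l])
  have qbl: "bounded_linear q"
    unfolding q_def by (intro bounded_linear_sub bounded_linear_ident bounded_linear_scaleR_const bl)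
  define V' where "V' = U' \<inter> q -` V"
  have V'o: "open V'" unfolding V'_def
    using I(1,4) open_vimage[OF _ linear_continuous_on[OF qbl]] by blast
  have q\<Phi>: "\<rho> z = 0 \<Longrightarrow> q z = \<Phi> z" for z by (simp add: q_def \<Phi>_def)
  show thesis
  proof (rule that[of V' "\<lambda>z. \<Psi> (q z)"])
    show "open V'" by (rule V'o)
    show "z0 \<in> V'" using I(3,5) q\<Phi>[OF z0(2)] by (simp add: V'_def)
    show "V' \<subseteq> U" using I(2) by (auto simp: V'_def)
    show "smooth_on V' (\<lambda>z. \<Psi> (q z))"
      by (rule smooth_on_compose[OF V'o I(4) _ \<Psi>s smooth_on_bounded_linear[OF qbl V'o]]) (simp add: V'_def)
    show "\<Psi> (q z) \<in> U" if "z \<in> V'" for z using \<Psi>U that by (simp add: V'_def)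
    show "\<rho> (\<Psi> (q z)) = 0" if "z \<in> V'" for z
      using l\<Phi>[of "\<Psi> (q z)"] \<Psi>U(3)[of "q z"] that lq by (simp add: V'_def)
    show *: "\<Psi> (q z) = z" if "z \<in> V'" "\<rho> z = 0" for z
      using q\<Phi>[OF that(2)] \<Psi>\<Phi> that(1) by (simp add: V'_def)
    show "fder (\<lambda>z. \<Psi> (q z)) z X = X" if z: "z \<in> V'" "\<rho> z = 0" and X: "fder \<rho> z X = 0" for z X
    proof -
      have qV: "q z \<in> V" using z by (simp add: V'_def)
      have "fder (\<lambda>z. \<Psi> (q z)) z X = fder \<Psi> (q z) (fder q z X)"
        by (rule fder_compose) (use gd[OF qV] bounded_linear_imp_differentiable[OF qbl] in \<open>auto simp: differentiable_def\<close>)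
      also have "fder q z X = q X" using fder_eq[OF bounded_linear_imp_has_derivative[OF qbl]] by metis
      also have "fder \<Psi> (q z) (q X) = e (q z) (q X)" using fder_eq[OF gd[OF qV]] g'e[OF qV] by simp
      also have "\<dots> = X"
        using nz[OF qV] X lq[of X] *[OF z] lR[of z] z I(2)
        unfolding e_def by (auto simp: V'_def q_def linear_diff linear_cmul subset_iff)
      finally show ?thesis .
    qed
  qed
qed

section \<open>Changes of projective charts\<close>

text \<open>
  The homogeneous coordinate vector \<open>(1, z)\<close>; its derivative in the direction \<open>X\<close> is the vector \<open>(0, X)\<close>,
  which is \<open>homog0 X\<close>.
\<close>
definition homog :: "complex^('n::finite) \<Rightarrow> complex^('n option)" where
  "homog z = (\<chi> k. case k of None \<Rightarrow> 1 | Some j \<Rightarrow> z $ j)"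

definition homog0 :: "complex^('n::finite) \<Rightarrow> complex^('n option)" where
  "homog0 z = (\<chi> k. case k of None \<Rightarrow> 0 | Some j \<Rightarrow> z $ j)"

lemma homog_nth [simp]: "homog z $ None = 1" "homog z $ Some j = z $ j"
  and homog0_nth [simp]: "homog0 z $ None = 0" "homog0 z $ Some j = z $ j"
  by (simp_all add: homog_def homog0_def)

lemma chart_homog: "chart A z = abs_cproj (A *v homog z)"
  and dchart_homog: "dchart A z X = abs_cproj_tangent (A *v homog z, A *v homog0 X)"
  by (simp_all add: chart_def dchart_def homog_def homog0_def)

lemma vec_option_eq_iff:
  fixes v w :: "'a ^ ('n::finite option)"
  shows "v = w \<longleftrightarrow> v $ None = w $ None \<and> (\<forall>j. v $ Some j = w $ Some j)"
  unfolding vec_eq_iff by (metis option.exhaust)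

lemma homog_nonzero [simp]: "homog z \<noteq> 0"
  by (simp add: vec_option_eq_iff)

lemma homog_inject [simp]: "homog z = homog w \<longleftrightarrow> z = w"
  by (simp add: vec_option_eq_iff vec_eq_iff)

lemma homog0_inject [simp]: "homog0 z = homog0 w \<longleftrightarrow> z = w"
  by (simp add: vec_option_eq_iff vec_eq_iff)

lemma homog0_scale: "homog0 (c *s X) = c *s homog0 X"
  by (simp add: vec_option_eq_iff)

lemma homog0_add: "homog0 (X + Y) = homog0 X + homog0 Y"
  by (simp add: vec_option_eq_iff)

lemma homog0_zero [simp]: "homog0 0 = 0"
  by (simp add: vec_option_eq_iff)

lemma homog_affine: "homog z = axis None 1 + homog0 z"
  by (simp add: vec_option_eq_iff axis_def)

lemma invertible_mult_eq_iff:
  fixes A :: "'a::field^'n^'n"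
  assumes "invertible A"
  shows "A *v v = A *v w \<longleftrightarrow> v = w"
  using inj_matrix_vector_mult[OF assms] by (auto dest: injD)

lemma invertible_mult_eq_0_iff:
  fixes A :: "'a::field^'n^'n"
  assumes "invertible A"
  shows "A *v v = 0 \<longleftrightarrow> v = 0"
  using invertible_mult_eq_iff[OF assms, of v 0] by simp

lemma abs_cproj_eq_iff:
  assumes "v \<noteq> 0" "w \<noteq> 0"
  shows "abs_cproj v = abs_cproj w \<longleftrightarrow> (\<exists>c. c \<noteq> 0 \<and> w = c *s v)"
proof -
  have "proj_rel v v" "proj_rel w w" using assms unfolding proj_rel_def by (metis vector_smult_lid zero_neq_one)+
  then have "abs_cproj v = abs_cproj w \<longleftrightarrow> proj_rel v w"
    using Quotient3_rel[OF Quotient3_cproj, of v w] by blast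
  then show ?thesis using assms by (simp add: proj_rel_def)
qed

lemma tangent_rel_refl: "v \<noteq> 0 \<Longrightarrow> tangent_rel (v, x) (v, x)"
  unfolding tangent_rel_def by (intro conjI exI[of _ 1] exI[of _ 0]) simp_all

lemma abs_cproj_tangent_eq_iff:
  assumes "v \<noteq> 0" "w \<noteq> 0"
  shows "abs_cproj_tangent (v, x) = abs_cproj_tangent (w, y) \<longleftrightarrow>
    (\<exists>c m. c \<noteq> 0 \<and> w = c *s v \<and> y = c *s x + m *s v)"
proof -
  have "abs_cproj_tangent (v, x) = abs_cproj_tangent (w, y) \<longleftrightarrow> tangent_rel (v, x) (w, y)"
    using Quotient3_rel[OF Quotient3_cproj_tangent, of "(v, x)" "(w, y)"]
      tangent_rel_refl[OF assms(1), of x] tangent_rel_refl[OF assms(2), of y] by blast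
  then show ?thesis using assms by (simp add: tangent_rel_def)
qed

lemma chart_eq_iff:
  assumes "invertible A" "invertible B"
  shows "chart A z = chart B y \<longleftrightarrow> (\<exists>c. c \<noteq> 0 \<and> B *v homog y = c *s (A *v homog z))"
  unfolding chart_homog by (rule abs_cproj_eq_iff) (simp_all add: invertible_mult_eq_0_iff assms)

lemma dchart_eq_iff:
  assumes "invertible A" "invertible B"
  shows "dchart A z X = dchart B y Y \<longleftrightarrow> (\<exists>c m. c \<noteq> 0 \<and> B *v homog y = c *s (A *v homog z) \<and>
    B *v homog0 Y = c *s (A *v homog0 X) + m *s (A *v homog z))"
  unfolding dchart_homog by (rule abs_cproj_tangent_eq_iff) (simp_all add: invertible_mult_eq_0_iff assms)

lemma dchart_base:
  assumes "invertible A" "invertible B" "dchart A z X = dchart B y Y"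
  shows "chart A z = chart B y"
  using assms(3) unfolding chart_eq_iff[OF assms(1,2)] dchart_eq_iff[OF assms(1,2)] by blast

lemma chart_inject:
  assumes "invertible A"
  shows "chart A z = chart A y \<longleftrightarrow> z = y"
proof
  assume "chart A z = chart A y"
  then obtain c where "A *v homog y = A *v (c *s homog z)"
    unfolding chart_eq_iff[OF assms assms] by (auto simp: vector_scalar_commute)
  then have *: "homog y = c *s homog z" using invertible_mult_eq_iff[OF assms] by blast
  from arg_cong[OF this, of "\<lambda>v. v $ None"] have "c = 1" by simp
  then show "z = y" using * by simp
qed simp

lemma dchart_inject:
  assumes "invertible A"
  shows "dchart A z X = dchart A y Y \<longleftrightarrow> z = y \<and> X = Y"
proof
  assume "dchart A z X = dchart A y Y"
  then obtain c m where "A *v homog y = A *v (c *s homog z)"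
    and "A *v homog0 Y = A *v (c *s homog0 X + m *s homog z)"
    unfolding dchart_eq_iff[OF assms assms] by (auto simp: vector_scalar_commute matrix_vector_right_distrib)
  then have *: "homog y = c *s homog z" "homog0 Y = c *s homog0 X + m *s homog z"
    using invertible_mult_eq_iff[OF assms] by blast+
  from arg_cong[OF *(1), of "\<lambda>v. v $ None"] arg_cong[OF *(2), of "\<lambda>v. v $ None"]
  have "c = 1" "m = 0" by simp_all
  then show "z = y \<and> X = Y" using * by simp
qed simp

lemma tangent_J_dchart:
  assumes "invertible A"
  shows "tangent_J (dchart A z X) = dchart A z (\<i> *s X)"
proof -
  have "tangent_rel (A *v homog z, A *v homog0 X) (A *v homog z, A *v homog0 X)"
    using assms by (intro tangent_rel_refl) (simp add: invertible_mult_eq_0_iff)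
  from tangent_J.abs_eq[OF this] show ?thesis
    by (simp add: dchart_homog homog0_scale vector_scalar_commute)
qed

text \<open>
  A projective automorphism in affine coordinates.
\<close>
definition frac_lin :: "complex^('n option)^('n option) \<Rightarrow> complex^('n::finite) \<Rightarrow> complex^'n" where
  "frac_lin C z = (\<chi> j. (C *v homog z) $ Some j / (C *v homog z) $ None)"

lemma frac_lin_homog:
  assumes "(C *v homog z) $ None \<noteq> 0"
  shows "(C *v homog z) $ None *s homog (frac_lin C z) = C *v homog z"
  using assms by (simp add: vec_option_eq_iff frac_lin_def)

lemma linear_matrix_homog0: "linear (\<lambda>X. (C *v homog0 X) $ k)"
proof (rule linearI)
  fix c :: real and x y :: "complex^'a"
  show "(C *v homog0 (x + y)) $ k = (C *v homog0 x) $ k + (C *v homog0 y) $ k"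
    by (simp add: homog0_add matrix_vector_right_distrib)
  have "homog0 (c *\<^sub>R x) = complex_of_real c *s homog0 x"
    by (simp add: vec_option_eq_iff scaleR_conv_of_real[symmetric])
  then show "(C *v homog0 (c *\<^sub>R x)) $ k = c *\<^sub>R (C *v homog0 x) $ k"
    by (simp add: vector_scalar_commute scaleR_conv_of_real)
qed

lemma matrix_homog_nth:
  "(C *v homog z) $ k = (C *v axis None 1) $ k + (C *v homog0 z) $ k"
  by (simp add: homog_affine matrix_vector_right_distrib)

lemma has_derivative_matrix_homog:
  "((\<lambda>z. (C *v homog z) $ k) has_derivative (\<lambda>X. (C *v homog0 X) $ k)) (at z)"
proof -
  have "((\<lambda>z. (C *v axis None 1) $ k + (C *v homog0 z) $ k) has_derivative (\<lambda>X. 0 + (C *v homog0 X) $ k)) (at z)"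
    by (intro has_derivative_add has_derivative_const bounded_linear_imp_has_derivative
        linear_bounded_linear linear_matrix_homog0)
  then show ?thesis unfolding matrix_homog_nth by simp
qed

lemma smooth_on_matrix_homog:
  assumes "open U"
  shows "smooth_on U (\<lambda>z. (C *v homog z) $ k)"
  unfolding matrix_homog_nth
  by (intro smooth_intros assms smooth_on_bounded_linear linear_bounded_linear linear_matrix_homog0)

lemma open_frac_lin_domain: "open {z. (C *v homog z) $ None \<noteq> 0}"
proof -
  have "continuous_on UNIV (\<lambda>z. (C *v homog z) $ None)"
    by (rule smooth_on_continuous_on[OF smooth_on_matrix_homog[OF open_UNIV]])
  from open_vimage[OF _ this, of "- {0}"] show ?thesis by (simp add: vimage_def open_Compl)
qed

lemma smooth_on_frac_lin: "smooth_on {z. (C *v homog z) $ None \<noteq> 0} (frac_lin C)"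
  unfolding frac_lin_def[abs_def]
  by (intro smooth_intros smooth_on_matrix_homog open_frac_lin_domain) simp

text \<open>
  Differentiating \<open>C (1, z) = c(z) (1, frac_lin C z)\<close> by the product rule avoids the quotient rule and is
  already in the form in which tangent vectors of projective space are identified.
\<close>
lemma homog0_fder_frac_lin:
  assumes "(C *v homog z) $ None \<noteq> 0"
  shows "C *v homog0 X = (C *v homog0 X) $ None *s homog (frac_lin C z) +
    (C *v homog z) $ None *s homog0 (fder (frac_lin C) z X)"
proof -
  let ?V = "{z. (C *v homog z) $ None \<noteq> 0}"
  have z: "z \<in> ?V" using assms by simp
  note dif = smooth_on_differentiable[OF smooth_on_frac_lin z]
  have comp: "fder (frac_lin C) z X $ j = fder (\<lambda>z. frac_lin C z $ j) z X" for j
    using fder_bounded_linear_compose[OF bounded_linear_vec_nth dif] by metis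
  have difj: "(\<lambda>z. frac_lin C z $ j) differentiable (at z)" for j
    by (rule smooth_on_differentiable[OF smooth_on_vec_nth[OF open_frac_lin_domain smooth_on_frac_lin] z])
  have nd: "(\<lambda>z. (C *v homog z) $ k) differentiable (at z)"
    "fder (\<lambda>z. (C *v homog z) $ k) z = (\<lambda>X. (C *v homog0 X) $ k)" for k
    using has_derivative_matrix_homog fder_eq[OF has_derivative_matrix_homog] by (auto simp: differentiable_def)
  have "(C *v homog0 X) $ Some j = (C *v homog z) $ None * fder (frac_lin C) z X $ j +
      (C *v homog0 X) $ None * frac_lin C z $ j" for j
  proof -
    have "frechet_derivative (\<lambda>z. (C *v homog z) $ Some j) (at z) =
      frechet_derivative (\<lambda>z. (C *v homog z) $ None * frac_lin C z $ j) (at z)"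
      by (rule frechet_derivative_cong_open[OF open_frac_lin_domain z]) (simp add: frac_lin_def)
    then have "(C *v homog0 X) $ Some j = fder (\<lambda>z. (C *v homog z) $ None * frac_lin C z $ j) z X"
      using nd(2)[of "Some j"] by metis
    also have "\<dots> = (C *v homog z) $ None * fder (frac_lin C) z X $ j +
      (C *v homog0 X) $ None * frac_lin C z $ j"
      by (subst fder_mult[OF nd(1) difj]) (simp add: nd comp)
    finally show ?thesis .
  qed
  then show ?thesis by (simp add: vec_option_eq_iff algebra_simps)
qed

text \<open>
  A change of chart is a smooth map whose differential is the identity of the tangent spaces of
  projective space. Everything that is defined in charts is compared between charts through it.
\<close>
lemma chart_transition:
  fixes A B :: "complex^('n::finite option)^('n option)"
  assumes "invertible A" "invertible B" "chart A z0 = chart B y0"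
  obtains V \<tau> where "open V" "z0 \<in> V" "smooth_on V \<tau>" "\<tau> z0 = y0"
    "\<And>z. z \<in> V \<Longrightarrow> chart B (\<tau> z) = chart A z"
    "\<And>z X. z \<in> V \<Longrightarrow> dchart B (\<tau> z) (fder \<tau> z X) = dchart A z X"
proof -
  obtain B' where B': "B ** B' = mat 1" using assms(2) by (auto simp: invertible_def)
  define C where "C = B' ** A"
  have BC: "B *v (C *v v) = A *v v" for v
    by (simp add: C_def matrix_vector_mul_assoc matrix_mul_assoc B')
  let ?V = "{z. (C *v homog z) $ None \<noteq> 0}"
  obtain c where c: "c \<noteq> 0" "B *v homog y0 = c *s (A *v homog z0)"
    using assms(3) unfolding chart_eq_iff[OF assms(1,2)] by blast
  have "B *v homog y0 = B *v (c *s (C *v homog z0))"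
    using c(2) by (simp add: BC vector_scalar_commute)
  then have y0: "homog y0 = c *s (C *v homog z0)" using invertible_mult_eq_iff[OF assms(2)] by blast
  from arg_cong[OF this, of "\<lambda>v. v $ None"] have cN: "c * (C *v homog z0) $ None = 1" by simp
  have base: "B *v homog (frac_lin C z) = (1 / (C *v homog z) $ None) *s (A *v homog z)" if "z \<in> ?V" for z
  proof -
    have "homog (frac_lin C z) = (1 / (C *v homog z) $ None) *s (C *v homog z)"
      using arg_cong[OF frac_lin_homog[of C z], of "\<lambda>v. (1 / (C *v homog z) $ None) *s v"] that
      by (simp add: vector_smult_assoc)
    then show ?thesis by (simp add: vector_scalar_commute BC)
  qed
  show thesis
  proof (rule that[of ?V "frac_lin C"])
    show "open ?V" by (rule open_frac_lin_domain)
    show "smooth_on ?V (frac_lin C)" by (rule smooth_on_frac_lin)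
    show "z0 \<in> ?V" using cN by auto
    show "frac_lin C z0 = y0"
    proof -
      have "(C *v homog z0) $ None = 1 / c" using cN c(1) by (simp add: field_simps)
      moreover have "y0 $ j = c * (C *v homog z0) $ Some j" for j
        using arg_cong[OF y0, of "\<lambda>v. v $ Some j"] by simp
      ultimately show ?thesis by (simp add: frac_lin_def vec_eq_iff)
    qed
    show "chart B (frac_lin C z) = chart A z" if "z \<in> ?V" for z
    proof -
      have "chart A z = chart B (frac_lin C z)"
        unfolding chart_eq_iff[OF assms(1,2)]
        using base[OF that] that by (intro exI[of _ "1 / (C *v homog z) $ None"]) simp
      then show ?thesis by simp
    qed
    show "dchart B (frac_lin C z) (fder (frac_lin C) z X) = dchart A z X" if z: "z \<in> ?V" for z X
    proof -
      let ?c = "(C *v homog z) $ None" and ?m = "(C *v homog0 X) $ None"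
      have c0: "?c \<noteq> 0" using z by simp
      have "homog0 (fder (frac_lin C) z X) = (1 / ?c) *s (C *v homog0 X) + (- ?m / ?c) *s homog (frac_lin C z)"
        using c0 arg_cong[OF homog0_fder_frac_lin[OF c0, of X], of "\<lambda>v. (1 / ?c) *s v"]
        by (simp add: vector_smult_assoc vector_add_ldistrib)
      then have "B *v homog0 (fder (frac_lin C) z X) = (1 / ?c) *s (A *v homog0 X) + (- ?m / ?c) *s (B *v homog (frac_lin C z))"
        by (simp only: matrix_vector_right_distrib vector_scalar_commute BC)
      also have "\<dots> = (1 / ?c) *s (A *v homog0 X) + (- ?m / ?c / ?c) *s (A *v homog z)"
        by (simp add: base[OF z] vector_smult_assoc)
      finally have "dchart A z X = dchart B (frac_lin C z) (fder (frac_lin C) z X)"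
        unfolding dchart_eq_iff[OF assms(1,2)] using base[OF z] c0
        by (intro exI[of _ "1 / ?c"] exI[of _ "- ?m / ?c / ?c"]) simp
      then show ?thesis by simp
    qed
  qed
qed

section \<open>Tangent spaces, functions and forms of a real hypersurface\<close>

text \<open>
  The complex structure of projective space is the standard one in every chart, so transition maps are
  holomorphic; only the linear algebra of the identification is needed to see this.
\<close>
lemma transition_complex_linear:
  assumes "invertible A" "invertible B" "\<And>X. dchart B y (T X) = dchart A z X"
  shows "T (\<i> *s X) = \<i> *s T X"
  using tangent_J_dchart[OF assms(1), of z X] tangent_J_dchart[OF assms(2), of y "T X"]
    dchart_inject[OF assms(2)] assms(3) by metis

lemma open_Int_preimage:
  assumes "open V" "open W" "smooth_on V g"
  shows "open {z \<in> V. g z \<in> W}"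
proof -
  have "{z \<in> V. g z \<in> W} = V \<inter> g -` W" by auto
  then show ?thesis
    using continuous_open_preimage[OF smooth_on_continuous_on[OF assms(3)] assms(1,2)] by simp
qed

lemma defining_functionD:
  assumes "defining_function M U \<rho>"
  shows "open U" "smooth_on U \<rho>" "\<And>z. z \<in> U \<Longrightarrow> z \<in> M \<longleftrightarrow> \<rho> z = 0"
    "\<And>z. z \<in> U \<Longrightarrow> z \<in> M \<Longrightarrow> \<exists>N. fder \<rho> z N \<noteq> 0"
  using assms unfolding defining_function_def by (blast, blast, blast, fastforce)

lemma defining_function_subset:
  assumes "defining_function M U \<rho>" "open V" "V \<subseteq> U"
  shows "defining_function M V \<rho>"
  using assms smooth_on_subset[of U \<rho> V] unfolding defining_function_def by blast

lemma defining_function_retraction: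
  assumes "defining_function M U \<rho>" "z0 \<in> U" "z0 \<in> M" "open W" "z0 \<in> W"
  obtains V \<pi> where "open V" "z0 \<in> V" "V \<subseteq> U \<inter> W" "smooth_on V \<pi>"
    "\<And>z. z \<in> V \<Longrightarrow> \<pi> z \<in> U \<inter> W \<inter> M" "\<And>z. z \<in> V \<Longrightarrow> z \<in> M \<Longrightarrow> \<pi> z = z"
    "\<And>z X. z \<in> V \<Longrightarrow> z \<in> M \<Longrightarrow> fder \<rho> z X = 0 \<Longrightarrow> fder \<pi> z X = X"
    "\<And>z X. z \<in> V \<Longrightarrow> fder \<rho> (\<pi> z) (fder \<pi> z X) = 0"
proof -
  have o: "open (U \<inter> W)" using assms defining_functionD(1) by blast
  note d = defining_function_subset[OF assms(1) o Int_lower1]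
  note D = defining_functionD[OF d]
  have z0: "z0 \<in> U \<inter> W" using assms by blast
  obtain N where N: "fder \<rho> z0 N \<noteq> 0" using D(4)[OF z0 assms(3)] by blast
  have r0: "\<rho> z0 = 0" using D(3)[OF z0] assms(3) by simp
  obtain V \<pi> where V: "open V" "z0 \<in> V" "V \<subseteq> U \<inter> W" "smooth_on V \<pi>"
    "\<And>z. z \<in> V \<Longrightarrow> \<pi> z \<in> U \<inter> W" "\<And>z. z \<in> V \<Longrightarrow> \<rho> (\<pi> z) = 0"
    "\<And>z. z \<in> V \<Longrightarrow> \<rho> z = 0 \<Longrightarrow> \<pi> z = z"
    "\<And>z X. z \<in> V \<Longrightarrow> \<rho> z = 0 \<Longrightarrow> fder \<rho> z X = 0 \<Longrightarrow> fder \<pi> z X = X"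
    using hypersurface_retraction[OF D(1,2) z0 r0 N] by blast
  have M: "z \<in> M \<longleftrightarrow> \<rho> z = 0" if "z \<in> V" for z using D(3) V(3) that by blast
  show thesis
  proof (rule that[OF V(1-4)])
    show "\<pi> z \<in> U \<inter> W \<inter> M" if "z \<in> V" for z using V(5,6)[OF that] D(3) by blast
    show "\<pi> z = z" if "z \<in> V" "z \<in> M" for z using V(7) M that by blast
    show "fder \<pi> z X = X" if "z \<in> V" "z \<in> M" "fder \<rho> z X = 0" for z X using V(8) M that by blast
    show "fder \<rho> (\<pi> z) (fder \<pi> z X) = 0" if z: "z \<in> V" for z X
    proof -
      have "fder (\<lambda>z. \<rho> (\<pi> z)) z X = fder \<rho> (\<pi> z) (fder \<pi> z X)"
        by (rule fder_compose[OF smooth_on_differentiable[OF D(2) V(5)[OF z]] smooth_on_differentiable[OF V(4) z]])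
      moreover have "frechet_derivative (\<lambda>z. \<rho> (\<pi> z)) (at z) = fder (\<lambda>z. 0) z"
        by (rule frechet_derivative_cong_open[OF V(1) z V(6)])
      ultimately show ?thesis by simp
    qed
  qed
qed

text \<open>
  Composition with the retraction makes the two functions equal on an open set and does not change
  derivatives in tangent directions.
\<close>
lemma tangent_derivative_unique:
  fixes F G :: "complex^('n::finite) \<Rightarrow> 'b::real_normed_vector"
  assumes "defining_function M U \<rho>" "z \<in> U" "z \<in> M" "fder \<rho> z X = 0" "open W" "z \<in> W"
    "F differentiable (at z)" "G differentiable (at z)" "\<And>y. y \<in> W \<Longrightarrow> y \<in> M \<Longrightarrow> F y = G y"
  shows "fder F z X = fder G z X"
proof -
  obtain V \<pi> where V: "open V" "z \<in> V" "V \<subseteq> U \<inter> W" "smooth_on V \<pi>"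
    "\<And>z. z \<in> V \<Longrightarrow> \<pi> z \<in> U \<inter> W \<inter> M" "\<And>z. z \<in> V \<Longrightarrow> z \<in> M \<Longrightarrow> \<pi> z = z"
    "\<And>z X. z \<in> V \<Longrightarrow> z \<in> M \<Longrightarrow> fder \<rho> z X = 0 \<Longrightarrow> fder \<pi> z X = X"
    using defining_function_retraction[OF assms(1-3,5,6)] by metis
  have \<pi>z: "\<pi> z = z" "fder \<pi> z X = X" using V(2,6,7) assms(3,4) by auto
  have pd: "\<pi> differentiable (at z)" by (rule smooth_on_differentiable[OF V(4,2)])
  have c: "fder (\<lambda>y. F (\<pi> y)) z X = fder F z X" if "F differentiable (at z)" for F :: "complex^'n \<Rightarrow> 'b"
    using fder_compose[of F \<pi> z X] that pd \<pi>z by simp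
  have "frechet_derivative (\<lambda>y. F (\<pi> y)) (at z) = fder (\<lambda>y. G (\<pi> y)) z"
    by (rule frechet_derivative_cong_open[OF V(1,2)]) (use V(5) assms(9) in blast)
  then show ?thesis using c assms(7,8) by metis
qed

text \<open>
  Being a hypersurface is required in some chart around each point; pulling back the defining function
  under the transition map gives it in every chart.
\<close>
lemma hypersurface_defining_function:
  assumes "real_hypersurface S" "invertible A" "chart A z \<in> S"
  obtains U \<rho> where "z \<in> U" "defining_function (chart A -` S) U \<rho>"
proof -
  obtain B y V \<sigma> where B: "invertible B" "chart B y = chart A z" "y \<in> V" "defining_function (chart B -` S) V \<sigma>"
    using assms(1,3) unfolding real_hypersurface_def by metis
  note D = defining_functionD[OF B(4)]
  obtain W \<tau> where W: "open W" "z \<in> W" "smooth_on W \<tau>" "\<tau> z = y"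
    "\<And>z. z \<in> W \<Longrightarrow> chart B (\<tau> z) = chart A z"
    "\<And>z X. z \<in> W \<Longrightarrow> dchart B (\<tau> z) (fder \<tau> z X) = dchart A z X"
    using chart_transition[OF assms(2) B(1) B(2)[symmetric]] by blast
  let ?U = "{z \<in> W. \<tau> z \<in> V}"
  have oU: "open ?U" by (rule open_Int_preimage[OF W(1) D(1) W(3)])
  have sm: "smooth_on ?U (\<lambda>z. \<sigma> (\<tau> z))"
    by (rule smooth_on_compose[OF oU D(1) _ D(2) smooth_on_subset[OF W(3)]]) auto
  have "fder (\<lambda>z. \<sigma> (\<tau> z)) z \<noteq> (\<lambda>_. 0)" if "z \<in> chart A -` S \<inter> ?U" for z
  proof -
    have zW: "z \<in> W" "\<tau> z \<in> V" "\<tau> z \<in> chart B -` S" using that W(5) by auto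
    have lin: "linear (fder \<tau> z)" by (rule smooth_on_linear_fder[OF W(3) zW(1)])
    have "inj (fder \<tau> z)"
      using W(6)[OF zW(1)] dchart_inject[OF assms(2)] by (metis injI)
    then have "surj (fder \<tau> z)" using linear_injective_imp_surjective[OF lin] by blast
    moreover obtain N where "fder \<sigma> (\<tau> z) N \<noteq> 0" using D(4)[OF zW(2,3)] by blast
    ultimately obtain X where "fder \<sigma> (\<tau> z) (fder \<tau> z X) \<noteq> 0" by (metis surjD)
    then have "fder (\<lambda>z. \<sigma> (\<tau> z)) z X \<noteq> 0"
      using fder_compose[OF smooth_on_differentiable[OF D(2) zW(2)] smooth_on_differentiable[OF W(3) zW(1)]] by simp
    then show ?thesis by metis
  qed
  moreover have "chart A -` S \<inter> ?U = {z \<in> ?U. \<sigma> (\<tau> z) = 0}"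
    using D(3) W(5) by fastforce
  ultimately have "defining_function (chart A -` S) ?U (\<lambda>z. \<sigma> (\<tau> z))"
    unfolding defining_function_def using oU sm by blast
  then show thesis using that[of ?U] W(2,4) B(3) by blast
qed

text \<open>
  The tangent space is defined as a union over all charts and defining functions. It suffices that any
  two of them agree: a defining function for one chart, read in another, vanishes on the hypersurface.
\<close>
lemma T_space_iff:
  assumes "invertible A" "z \<in> U" "defining_function (chart A -` S) U \<rho>" "chart A z \<in> S"
  shows "dchart A z X \<in> T_space S (chart A z) \<longleftrightarrow> fder \<rho> z X = 0"
proof
  assume "fder \<rho> z X = 0"
  then show "dchart A z X \<in> T_space S (chart A z)" unfolding T_space_def using assms by blast
next
  assume "dchart A z X \<in> T_space S (chart A z)"
  then obtain B y Y V \<sigma> where B: "dchart A z X = dchart B y Y" "invertible B" "chart B y = chart A z"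
    "y \<in> V" "defining_function (chart B -` S) V \<sigma>" "fder \<sigma> y Y = 0"
    unfolding T_space_def by blast
  note D = defining_functionD[OF assms(3)]
  obtain W \<tau> where W: "open W" "y \<in> W" "smooth_on W \<tau>" "\<tau> y = z"
    "\<And>z. z \<in> W \<Longrightarrow> chart A (\<tau> z) = chart B z"
    "\<And>z X. z \<in> W \<Longrightarrow> dchart A (\<tau> z) (fder \<tau> z X) = dchart B z X"
    using chart_transition[OF B(2) assms(1) B(3)] by blast
  let ?W = "{y \<in> W. \<tau> y \<in> U}"
  have oW: "open ?W" by (rule open_Int_preimage[OF W(1) D(1) W(3)])
  have yM: "y \<in> chart B -` S" "y \<in> ?W" using B(3) assms(2,4) W(2,4) by auto
  have d1: "\<rho> differentiable (at (\<tau> y))" "\<tau> differentiable (at y)"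
    using smooth_on_differentiable[OF D(2) assms(2)] smooth_on_differentiable[OF W(3,2)] W(4) by simp_all
  have d2: "(\<lambda>y. \<rho> (\<tau> y)) differentiable (at y)"
    using differentiable_chain_at[OF d1(2,1)] by (simp add: o_def)
  have v: "\<rho> (\<tau> x) = 0" if "x \<in> ?W" "x \<in> chart B -` S" for x
    using D(3)[of "\<tau> x"] W(5)[of x] that by auto
  have "fder (\<lambda>y. \<rho> (\<tau> y)) y Y = fder (\<lambda>y. 0) y Y"
    by (rule tangent_derivative_unique[OF B(5,4) yM(1) B(6) oW yM(2) d2 _ v]) simp_all
  then have "fder \<rho> z (fder \<tau> y Y) = 0" using fder_compose[OF d1, of Y] W(4) by simp
  moreover have "fder \<tau> y Y = X"
    using W(6)[OF W(2), of Y] W(4) B(1) dchart_inject[OF assms(1)] by metis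
  ultimately show "fder \<rho> z X = 0" by simp
qed

lemma i_smult_i_smult: "\<i> *s (\<i> *s X) = - (X :: complex^'n)"
  by (simp add: vec_eq_iff mult.assoc[symmetric])

lemma T_space_E:
  assumes "\<xi> \<in> T_space S p" "invertible A" "chart A z = p"
  obtains X where "\<xi> = dchart A z X"
proof -
  obtain B y Y where B: "\<xi> = dchart B y Y" "invertible B" "chart B y = p"
    using assms(1) unfolding T_space_def by blast
  obtain W \<tau> where W: "y \<in> W" "\<tau> y = z"
    "\<And>z X. z \<in> W \<Longrightarrow> dchart A (\<tau> z) (fder \<tau> z X) = dchart B z X"
    using chart_transition[OF B(2) assms(2), of y z] B(3) assms(3) by metis
  then show thesis using that[of "fder \<tau> y Y"] B(1) W(3)[OF W(1), of Y] by simp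
qed

lemma H_space_iff:
  assumes "invertible A" "z \<in> U" "defining_function (chart A -` S) U \<rho>" "chart A z \<in> S"
  shows "dchart A z X \<in> H_space S (chart A z) \<longleftrightarrow> fder \<rho> z X = 0 \<and> fder \<rho> z (\<i> *s X) = 0"
proof -
  note T = T_space_iff[OF assms]
  have lin: "linear (fder \<rho> z)" using smooth_on_linear_fder assms(2) defining_functionD(2)[OF assms(3)] by blast
  have "dchart A z X \<in> tangent_J ` T_space S (chart A z) \<longleftrightarrow> fder \<rho> z (\<i> *s X) = 0"
  proof
    assume "dchart A z X \<in> tangent_J ` T_space S (chart A z)"
    then obtain \<xi> where xi: "\<xi> \<in> T_space S (chart A z)" "dchart A z X = tangent_J \<xi>" by blast
    obtain Y where Y: "\<xi> = dchart A z Y" using T_space_E[OF xi(1) assms(1) refl] .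
    then have "X = \<i> *s Y" using xi(2) tangent_J_dchart[OF assms(1)] dchart_inject[OF assms(1)] by metis
    then have "\<i> *s X = - Y" by (simp add: i_smult_i_smult)
    then show "fder \<rho> z (\<i> *s X) = 0" using xi(1) Y T linear_neg[OF lin] by simp
  next
    assume *: "fder \<rho> z (\<i> *s X) = 0"
    have "fder \<rho> z (- (\<i> *s X)) = 0" using * linear_neg[OF lin] by simp
    then have "dchart A z (- (\<i> *s X)) \<in> T_space S (chart A z)" using T by simp
    moreover have "tangent_J (dchart A z (- (\<i> *s X))) = dchart A z X"
    proof -
      have "\<i> *s (- (\<i> *s X)) = X" by (simp add: vec_eq_iff mult.assoc[symmetric])
      then show ?thesis using tangent_J_dchart[OF assms(1)] by simp
    qed
    ultimately show "dchart A z X \<in> tangent_J ` T_space S (chart A z)" by (metis imageI)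
  qed
  then show ?thesis unfolding H_space_def using T by simp
qed

lemma H_space_subset_T_space: "\<xi> \<in> H_space S p \<Longrightarrow> \<xi> \<in> T_space S p"
  by (simp add: H_space_def)

lemma local_extension_transition:
  assumes "local_extension S u B V G" "invertible A" "y \<in> V" "chart A z = chart B y"
  obtains W \<tau> where "open W" "z \<in> W" "smooth_on W \<tau>" "\<tau> z = y"
    "local_extension S u A W (\<lambda>z. G (\<tau> z))"
    "\<And>X. dchart B y (fder \<tau> z X) = dchart A z X"
    "\<And>X. fder (\<lambda>z. G (\<tau> z)) z X = fder G y (fder \<tau> z X)"
proof -
  note B = assms(1)[unfolded local_extension_def]
  then have iB: "invertible B" and oV: "open V" and G: "smooth_on V G" by auto
  obtain W \<tau> where W: "open W" "z \<in> W" "smooth_on W \<tau>" "\<tau> z = y"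
    "\<And>z. z \<in> W \<Longrightarrow> chart B (\<tau> z) = chart A z"
    "\<And>z X. z \<in> W \<Longrightarrow> dchart B (\<tau> z) (fder \<tau> z X) = dchart A z X"
    using chart_transition[OF assms(2) iB assms(4)] by blast
  let ?W = "{z \<in> W. \<tau> z \<in> V}"
  have oW: "open ?W" by (rule open_Int_preimage[OF W(1) oV W(3)])
  have sW: "smooth_on ?W \<tau>" by (rule smooth_on_subset[OF W(3)]) auto
  show thesis
  proof (rule that[OF oW _ sW W(4)])
    show "z \<in> ?W" using W assms(3) by auto
    show "local_extension S u A ?W (\<lambda>z. G (\<tau> z))"
      unfolding local_extension_def
      using oW assms(2) smooth_on_compose[OF oW oV _ G sW] B W(5) by auto
    show "dchart B y (fder \<tau> z X) = dchart A z X" for X using W(6)[OF W(2)] W(4) by simp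
    show "fder (\<lambda>z. G (\<tau> z)) z X = fder G y (fder \<tau> z X)" for X
      using fder_compose[of G \<tau> z X] smooth_on_differentiable[OF G assms(3)] smooth_on_differentiable[OF W(3,2)] W(4)
      by simp
  qed
qed

lemma smooth_fun_local_extension:
  assumes "smooth_fun S u" "invertible A" "chart A z \<in> S"
  obtains W F where "z \<in> W" "local_extension S u A W F"
proof -
  obtain B y V G where "chart B y = chart A z" "y \<in> V" "local_extension S u B V G"
    using assms(1,3) unfolding smooth_fun_def by metis
  then show thesis using local_extension_transition[OF _ assms(2)] that by metis
qed

text \<open>
  The transition map moves any other extension to the given chart, where the two have the same
  derivatives in tangent directions.
\<close>
lemma differential_eq:
  assumes "real_hypersurface S" "local_extension S u A U F" "z \<in> U" "chart A z \<in> S"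
    "dchart A z X \<in> T_space S (chart A z)"
  shows "differential S u (dchart A z X) = fder F z X"
  unfolding differential_def
proof (rule the_equality)
  show "\<exists>A' z' X' U F'. dchart A z X = dchart A' z' X' \<and> z' \<in> U \<and> local_extension S u A' U F' \<and>
     fder F z X = fder F' z' X'" using assms by blast
next
  fix c assume "\<exists>A' z' X' U F. dchart A z X = dchart A' z' X' \<and> z' \<in> U \<and> local_extension S u A' U F \<and>
     c = fder F z' X'"
  then obtain B y Y V G where B: "dchart A z X = dchart B y Y" "y \<in> V" "local_extension S u B V G" "c = fder G y Y"
    by blast
  have inv: "invertible A" "invertible B" "open U" "smooth_on U F"
    using assms(2) B(3) unfolding local_extension_def by auto
  obtain W \<tau> where W: "open W" "z \<in> W" "local_extension S u A W (\<lambda>z. G (\<tau> z))"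
    "\<And>X. dchart B y (fder \<tau> z X) = dchart A z X"
    "\<And>X. fder (\<lambda>z. G (\<tau> z)) z X = fder G y (fder \<tau> z X)"
    using local_extension_transition[OF B(3) inv(1) B(2) dchart_base[OF inv(1,2) B(1)]] by metis
  have Y: "fder \<tau> z X = Y" using W(4) B(1) dchart_inject[OF inv(2)] by metis
  obtain U' \<rho> where U': "z \<in> U'" "defining_function (chart A -` S) U' \<rho>"
    using hypersurface_defining_function[OF assms(1) inv(1) assms(4)] .
  have X: "fder \<rho> z X = 0" using T_space_iff[OF inv(1) U' assms(4)] assms(5) by simp
  have sW: "smooth_on W (\<lambda>z. G (\<tau> z))" using W(3) by (simp add: local_extension_def)
  have "fder F z X = fder (\<lambda>z. G (\<tau> z)) z X"
    by (rule tangent_derivative_unique[OF U'(2,1) _ X open_Int[OF inv(3) W(1)]])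
       (use assms(2,3,4) W(2,3) smooth_on_differentiable[OF inv(4)] smooth_on_differentiable[OF sW]
         in \<open>auto simp: local_extension_def\<close>)
  then show "c = fder F z X" using W(5) Y B(4) by simp
qed

text \<open>
  The same as \<open>local_form_extension\<close>, with forms as functions of two arguments instead of functions
  into a space of bounded linear maps.
\<close>
definition local_form :: "'n::finite cproj set \<Rightarrow> ('n cproj \<Rightarrow> 'n cproj_tangent set) \<Rightarrow> ('n cproj_tangent \<Rightarrow> complex) \<Rightarrow>
    complex^('n option)^('n option) \<Rightarrow> (complex^'n) set \<Rightarrow> (complex^'n \<Rightarrow> complex^'n \<Rightarrow> complex) \<Rightarrow> bool" where
  "local_form S E \<alpha> A U a \<longleftrightarrow> invertible A \<and> open U \<and> smooth_form U a \<and>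
     (\<forall>z\<in>U. chart A z \<in> S \<longrightarrow> (\<forall>X. dchart A z X \<in> E (chart A z) \<longrightarrow> a z X = \<alpha> (dchart A z X)))"

lemma local_form_of_extension:
  "local_form_extension S E \<alpha> A U a \<Longrightarrow> local_form S E \<alpha> A U (\<lambda>z. blinfun_apply (a z))"
  unfolding local_form_extension_def local_form_def using smooth_form_blinfun by blast

lemma local_form_to_extension:
  "local_form S E \<alpha> A U a \<Longrightarrow> local_form_extension S E \<alpha> A U (\<lambda>z. Blinfun (a z))"
  unfolding local_form_extension_def local_form_def using smooth_on_Blinfun_form by metis

lemma local_form_subset:
  "local_form S E \<alpha> A U a \<Longrightarrow> open V \<Longrightarrow> V \<subseteq> U \<Longrightarrow> local_form S E \<alpha> A V a"
  unfolding local_form_def using smooth_form_subset by blast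

lemma local_form_transition:
  assumes "local_form S E \<alpha> B V b" "invertible A" "y \<in> V" "chart A z = chart B y"
  obtains W \<tau> where "open W" "z \<in> W" "smooth_on W \<tau>" "\<tau> z = y" "\<And>z. z \<in> W \<Longrightarrow> \<tau> z \<in> V"
    "local_form S E \<alpha> A W (pullback \<tau> b)"
    "\<And>X. dchart B y (fder \<tau> z X) = dchart A z X"
proof -
  note B = assms(1)[unfolded local_form_def]
  then have iB: "invertible B" and oV: "open V" and b: "smooth_form V b" by auto
  obtain W \<tau> where W: "open W" "z \<in> W" "smooth_on W \<tau>" "\<tau> z = y"
    "\<And>z. z \<in> W \<Longrightarrow> chart B (\<tau> z) = chart A z"
    "\<And>z X. z \<in> W \<Longrightarrow> dchart B (\<tau> z) (fder \<tau> z X) = dchart A z X"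
    using chart_transition[OF assms(2) iB assms(4)] by blast
  let ?W = "{z \<in> W. \<tau> z \<in> V}"
  have oW: "open ?W" by (rule open_Int_preimage[OF W(1) oV W(3)])
  have sW: "smooth_on ?W \<tau>" by (rule smooth_on_subset[OF W(3)]) auto
  show thesis
  proof (rule that[OF oW _ sW W(4)])
    show "z \<in> ?W" using W assms(3) by auto
    show "local_form S E \<alpha> A ?W (pullback \<tau> b)"
      unfolding local_form_def
      using oW assms(2) smooth_form_pullback[OF oW oV _ sW b] B W(5,6) by (auto simp: pullback_def)
    show "dchart B y (fder \<tau> z X) = dchart A z X" for X using W(6)[OF W(2)] W(4) by simp
  qed auto
qed

lemma smooth_covectors_local_form:
  assumes "smooth_covectors S E \<alpha>" "invertible A" "chart A z \<in> S"
  obtains W a where "z \<in> W" "local_form S E \<alpha> A W a"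
proof -
  obtain B y V b where B: "chart B y = chart A z" "y \<in> V" "local_form_extension S E \<alpha> B V b"
    using assms(1,3) unfolding smooth_covectors_def by metis
  show thesis
    using local_form_transition[OF local_form_of_extension[OF B(3)] assms(2) B(2) B(1)[symmetric]] that by metis
qed

lemma smooth_covectorsI:
  assumes "\<And>p. p \<in> S \<Longrightarrow> \<exists>A z U a. chart A z = p \<and> z \<in> U \<and> local_form S E \<alpha> A U a"
  shows "smooth_covectors S E \<alpha>"
  unfolding smooth_covectors_def using assms local_form_to_extension by metis

text \<open>
  As for functions: after pulling back under the retraction the two forms coincide on an open set, and
  pullback commutes with the exterior derivative.
\<close>
lemma tangent_dform_unique:
  assumes "defining_function M U \<rho>" "z \<in> U" "z \<in> M" "fder \<rho> z X = 0" "fder \<rho> z Y = 0" "open W" "z \<in> W"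
    "smooth_form W a" "smooth_form W b"
    "\<And>y X. y \<in> W \<Longrightarrow> y \<in> U \<Longrightarrow> y \<in> M \<Longrightarrow> fder \<rho> y X = 0 \<Longrightarrow> a y X = b y X"
  shows "dform a z X Y = dform b z X Y"
proof -
  obtain V \<pi> where V: "open V" "z \<in> V" "V \<subseteq> U \<inter> W" "smooth_on V \<pi>"
    "\<And>z. z \<in> V \<Longrightarrow> \<pi> z \<in> U \<inter> W \<inter> M" "\<And>z. z \<in> V \<Longrightarrow> z \<in> M \<Longrightarrow> \<pi> z = z"
    "\<And>z X. z \<in> V \<Longrightarrow> z \<in> M \<Longrightarrow> fder \<rho> z X = 0 \<Longrightarrow> fder \<pi> z X = X"
    "\<And>z X. z \<in> V \<Longrightarrow> fder \<rho> (\<pi> z) (fder \<pi> z X) = 0"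
    using defining_function_retraction[OF assms(1-3,6,7)] by metis
  have \<pi>: "\<pi> z = z" "fder \<pi> z X = X" "fder \<pi> z Y = Y" using V(2,6,7) assms(3-5) by auto
  have \<pi>W: "\<pi> y \<in> W" if "y \<in> V" for y using V(5)[OF that] by blast
  have "dform a z X Y = dform (pullback \<pi> a) z X Y"
    using dform_pullback[OF V(1) assms(6) \<pi>W V(4) assms(8) V(2)] \<pi> by simp
  also have "\<dots> = dform (pullback \<pi> b) z X Y"
    by (rule dform_cong[OF V(1,2)]) (use V(5,8) assms(10) in \<open>auto simp: pullback_def\<close>)
  also have "\<dots> = dform b z X Y"
    using dform_pullback[OF V(1) assms(6) \<pi>W V(4) assms(9) V(2)] \<pi> by simp
  finally show ?thesis .
qed

text \<open>
  Again any other extension can be moved to the given chart, now by pullback under the transition map,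
  and the two extensions agree on tangent vectors there.
\<close>
lemma ext_deriv_eq:
  assumes "real_hypersurface S" "local_form S (T_space S) \<alpha> A U a" "z \<in> U" "chart A z \<in> S"
    "dchart A z X \<in> T_space S (chart A z)" "dchart A z Y \<in> T_space S (chart A z)"
  shows "ext_deriv S \<alpha> (dchart A z X) (dchart A z Y) = dform a z X Y"
  unfolding ext_deriv_def
proof (rule the_equality)
  note A = assms(2)[unfolded local_form_def]
  have d: "blinfun_apply (fder a z X) Y - blinfun_apply (fder a z Y) X = dform (\<lambda>z. blinfun_apply (a z)) z X Y"
    if "smooth_on U a" "z \<in> U" for a :: "complex^'a \<Rightarrow> (complex^'a) \<Rightarrow>\<^sub>L complex" and U z X Y
    unfolding dform_def using fder_blinfun_apply[OF smooth_on_differentiable[OF that]] by simp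
  have eq: "dform (\<lambda>z. blinfun_apply (Blinfun (a z))) z X Y = dform a z X Y"
    by (rule dform_cong[of U]) (use A assms(3) smooth_on_Blinfun_form(2)[of U a] in auto)
  show "\<exists>A' z' X' Y' U a'. dchart A z X = dchart A' z' X' \<and> dchart A z Y = dchart A' z' Y' \<and> z' \<in> U \<and>
     local_form_extension S (T_space S) \<alpha> A' U a' \<and>
     dform a z X Y = blinfun_apply (fder a' z' X') Y' - blinfun_apply (fder a' z' Y') X'"
    using local_form_to_extension[OF assms(2)] assms(3) eq
      d[of U "\<lambda>z. Blinfun (a z)" z X Y] smooth_on_Blinfun_form(1)[of U a] A
    by (intro exI[of _ A] exI[of _ z] exI[of _ X] exI[of _ Y] exI[of _ U] exI[of _ "\<lambda>z. Blinfun (a z)"]) auto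
  fix c assume "\<exists>A' z' X' Y' U a'. dchart A z X = dchart A' z' X' \<and> dchart A z Y = dchart A' z' Y' \<and> z' \<in> U \<and>
     local_form_extension S (T_space S) \<alpha> A' U a' \<and>
     c = blinfun_apply (fder a' z' X') Y' - blinfun_apply (fder a' z' Y') X'"
  then obtain B y X' Y' V b where B: "dchart A z X = dchart B y X'" "dchart A z Y = dchart B y Y'" "y \<in> V"
    "local_form_extension S (T_space S) \<alpha> B V b"
    "c = blinfun_apply (fder b y X') Y' - blinfun_apply (fder b y Y') X'" by blast
  let ?b = "\<lambda>z. blinfun_apply (b z)"
  have bl: "local_form S (T_space S) \<alpha> B V ?b" by (rule local_form_of_extension[OF B(4)])
  have inv: "invertible A" "invertible B" "open U" "open V" "smooth_form U a" "smooth_form V ?b" "smooth_on V b"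
    using A bl B(4) unfolding local_form_def local_form_extension_def by auto
  obtain W \<tau> where W: "open W" "z \<in> W" "smooth_on W \<tau>" "\<tau> z = y" "\<And>z. z \<in> W \<Longrightarrow> \<tau> z \<in> V"
    "local_form S (T_space S) \<alpha> A W (pullback \<tau> ?b)"
    "\<And>X. dchart B y (fder \<tau> z X) = dchart A z X"
    using local_form_transition[OF bl inv(1) B(3) dchart_base[OF inv(1,2) B(1)]] by metis
  have XY: "fder \<tau> z X = X'" "fder \<tau> z Y = Y'" using W(7) B(1,2) dchart_inject[OF inv(2)] by metis+
  obtain U' \<rho> where U': "z \<in> U'" "defining_function (chart A -` S) U' \<rho>"
    using hypersurface_defining_function[OF assms(1) inv(1) assms(4)] .
  note T = T_space_iff[OF inv(1) _ U'(2)]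
  have "dform a z X Y = dform (pullback \<tau> ?b) z X Y"
  proof (rule tangent_dform_unique[OF U'(2,1) _ _ _ open_Int[OF inv(3) W(1)]])
    show "z \<in> chart A -` S" using assms by simp
    show "fder \<rho> z X = 0" "fder \<rho> z Y = 0" using T U'(1) assms(4-6) by auto
    show "z \<in> U \<inter> W" using W assms by simp
    show "smooth_form (U \<inter> W) a" "smooth_form (U \<inter> W) (pullback \<tau> ?b)"
      using inv(5) W(6) smooth_form_subset[OF _ Int_lower1] smooth_form_subset[OF _ Int_lower2]
      unfolding local_form_def by blast+
    show "a y X = pullback \<tau> ?b y X" if "y \<in> U \<inter> W" "y \<in> U'" "y \<in> chart A -` S" "fder \<rho> y X = 0" for y X
    proof -
      have "dchart A y X \<in> T_space S (chart A y)" using T that by simp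
      then show ?thesis using A W(6) that unfolding local_form_def by simp
    qed
  qed
  also have "\<dots> = dform ?b y X' Y'"
    using dform_pullback[OF W(1) inv(4) W(5,3) inv(6) W(2)] XY W(4) by simp
  also have "\<dots> = c" using d[OF inv(7) B(3)] B(5) by simp
  finally show "c = dform a z X Y" by simp
qed

section \<open>Potentials on simply connected sets\<close>

text \<open>
  A family of local functions on \<open>S\<close>, two of which differ by a local constant where both are defined:
  what the local primitives of a closed form have in common. On a simply connected set there is a
  global function that differs from each of them by local constants. It is constructed by integration
  along paths.
\<close>
locale local_potentials =
  fixes S :: "'a::topological_space set" and P :: "('a set \<times> ('a \<Rightarrow> 'b::ab_group_add)) set"
  assumes open_dom: "(V, f) \<in> P \<Longrightarrow> open V"
    and cover: "p \<in> S \<Longrightarrow> \<exists>V f. (V, f) \<in> P \<and> p \<in> V"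
    and compat: "(V, f) \<in> P \<Longrightarrow> (V', f') \<in> P \<Longrightarrow> p \<in> S \<Longrightarrow> p \<in> V \<Longrightarrow> p \<in> V' \<Longrightarrow>
      \<exists>W. open W \<and> p \<in> W \<and> (\<forall>q\<in>S \<inter> W. f q - f' q = f p - f' p)"
begin

definition same_increments :: "'c::topological_space set \<Rightarrow> ('c \<Rightarrow> 'b) \<Rightarrow> ('c \<Rightarrow> 'b) \<Rightarrow> 'c \<Rightarrow> bool" where
  "same_increments K k g q \<longleftrightarrow> (\<exists>N. open N \<and> q \<in> N \<and> (\<forall>r\<in>K \<inter> N. k r - k q = g r - g q))"

text \<open>
  A lift of \<open>H\<close>: the values of \<open>k\<close> vary as those of the local potentials do along \<open>H\<close>. If the potentials
  are primitives of a 1-form and \<open>H\<close> is a path, the difference of the end values of \<open>k\<close> is the integral of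
  the form.
\<close>
definition potential_along :: "'c::topological_space set \<Rightarrow> ('c \<Rightarrow> 'a) \<Rightarrow> ('c \<Rightarrow> 'b) \<Rightarrow> bool" where
  "potential_along K H k \<longleftrightarrow> (\<forall>q\<in>K. \<forall>V f. (V, f) \<in> P \<and> H q \<in> V \<longrightarrow> same_increments K k (\<lambda>r. f (H r)) q)"

lemma potential_alongD:
  assumes "potential_along K H k" "q \<in> K" "(V, f) \<in> P" "H q \<in> V"
  obtains N where "open N" "q \<in> N" "\<And>r. r \<in> K \<Longrightarrow> r \<in> N \<Longrightarrow> k r - k q = f (H r) - f (H q)"
proof -
  have "same_increments K k (\<lambda>r. f (H r)) q" using assms unfolding potential_along_def by simp
  then show thesis using that unfolding same_increments_def by (metis IntI)
qed

text \<open>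
  Because of compatibility one local potential at each point is enough.
\<close>
lemma potential_alongI:
  assumes "continuous_on K H" "H ` K \<subseteq> S"
    and "\<And>q. q \<in> K \<Longrightarrow> \<exists>V f. (V, f) \<in> P \<and> H q \<in> V \<and> same_increments K k (\<lambda>r. f (H r)) q"
  shows "potential_along K H k"
  unfolding potential_along_def
proof (intro ballI allI impI)
  fix q V' f' assume q: "q \<in> K" and V': "(V', f') \<in> P \<and> H q \<in> V'"
  obtain V f where Vf: "(V, f) \<in> P \<and> H q \<in> V \<and> same_increments K k (\<lambda>r. f (H r)) q"
    using assms(3)[OF q] by (elim exE)
  then obtain N where V: "(V, f) \<in> P" "H q \<in> V" "open N" "q \<in> N"
    "\<forall>r\<in>K \<inter> N. k r - k q = f (H r) - f (H q)"
    unfolding same_increments_def by auto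
  have HqS: "H q \<in> S" using assms(2) q by blast
  obtain W where W0: "open W \<and> H q \<in> W \<and> (\<forall>p\<in>S \<inter> W. f p - f' p = f (H q) - f' (H q))"
    using compat[OF V(1) conjunct1[OF V'] HqS V(2) conjunct2[OF V']] by (elim exE)
  have W: "open W" "H q \<in> W" "\<And>p. p \<in> S \<Longrightarrow> p \<in> W \<Longrightarrow> f p - f' p = f (H q) - f' (H q)"
    using W0 by simp_all
  obtain O' where O': "open O'" "O' \<inter> K = H -` W \<inter> K"
    using assms(1) W(1) unfolding continuous_on_open_invariant by blast
  have "k r - k q = f' (H r) - f' (H q)" if "r \<in> K \<inter> (N \<inter> O')" for r
  proof -
    have "k r - k q = f (H r) - f (H q)" using V(5) that by blast
    moreover have "H r \<in> S" "H r \<in> W" using that O'(2) assms(2) by blast+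
    ultimately have "f (H r) = f (H q) - f' (H q) + f' (H r)" using W(3)[of "H r"] by (metis diff_add_cancel)
    then show ?thesis using \<open>k r - k q = _\<close> by simp
  qed
  moreover have "q \<in> N \<inter> O'" using V(4) O'(2) q W(2) by blast
  ultimately show "same_increments K k (\<lambda>r. f' (H r)) q"
    unfolding same_increments_def using V(3) O'(1) by (intro exI[of _ "N \<inter> O'"]) auto
qed

lemma potential_along_single:
  assumes "continuous_on K H" "H ` K \<subseteq> S \<inter> V" "(V, f) \<in> P"
  shows "potential_along K H (\<lambda>x. f (H x))"
proof (rule potential_alongI[OF assms(1)])
  have "same_increments K (\<lambda>x. f (H x)) (\<lambda>x. f (H x)) q" for q
    unfolding same_increments_def by (intro exI[of _ UNIV]) simp
  then show "\<exists>V f'. (V, f') \<in> P \<and> H q \<in> V \<and> same_increments K (\<lambda>x. f (H x)) (\<lambda>x. f' (H x)) q" if "q \<in> K" for q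
    using assms(2,3) that by (intro exI[of _ V] exI[of _ f]) auto
qed (use assms(2) in blast)

text \<open>
  Two lifts differ by a locally constant function.
\<close>
lemma potential_along_unique:
  assumes "connected K" "H ` K \<subseteq> S" "potential_along K H k" "potential_along K H k'" "q \<in> K" "r \<in> K"
  shows "k r - k q = k' r - k' q"
proof -
  have "(\<lambda>x. k x - k' x) constant_on K"
  proof (rule locally_constant_imp_constant[OF assms(1)])
    fix x assume x: "x \<in> K"
    obtain V f where V: "(V, f) \<in> P" "H x \<in> V" using cover assms(2) x by blast
    obtain N where N: "open N" "x \<in> N" "\<And>r. r \<in> K \<Longrightarrow> r \<in> N \<Longrightarrow> k r - k x = f (H r) - f (H x)"
      using potential_alongD[OF assms(3) x V] by blast
    obtain N' where N': "open N'" "x \<in> N'" "\<And>r. r \<in> K \<Longrightarrow> r \<in> N' \<Longrightarrow> k' r - k' x = f (H r) - f (H x)"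
      using potential_alongD[OF assms(4) x V] by blast
    have "k y - k' y = k x - k' x" if "y \<in> K \<inter> (N \<inter> N')" for y
    proof -
      have "k y - k x = k' y - k' x" using N(3)[of y] N'(3)[of y] that by simp
      then show ?thesis by (simp add: algebra_simps)
    qed
    moreover have "openin (top_of_set K) (K \<inter> (N \<inter> N'))" using N(1) N'(1) by (intro openin_open_Int open_Int)
    moreover have "x \<in> K \<inter> (N \<inter> N')" using N(2) N'(2) x by simp
    ultimately show "\<exists>T. openin (top_of_set K) T \<and> x \<in> T \<and> (\<forall>y\<in>T. k y - k' y = k x - k' x)"
      by (intro exI[of _ "K \<inter> (N \<inter> N')"] conjI ballI)
  qed
  then have "k r - k' r = k q - k' q" using assms(5,6) by (auto simp: constant_on_def)
  then show ?thesis by (simp add: algebra_simps)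
qed

lemma potential_along_compose:
  assumes "potential_along K H k" "continuous_on K' g" "g ` K' \<subseteq> K" "\<And>x. x \<in> K' \<Longrightarrow> H' x = H (g x)"
  shows "potential_along K' H' (\<lambda>x. k (g x))"
  unfolding potential_along_def
proof (intro ballI allI impI)
  fix q V f assume q: "q \<in> K'" and V: "(V, f) \<in> P \<and> H' q \<in> V"
  obtain N where N: "open N" "g q \<in> N" "\<And>r. r \<in> K \<Longrightarrow> r \<in> N \<Longrightarrow> k r - k (g q) = f (H r) - f (H (g q))"
    using potential_alongD[OF assms(1), of "g q" V f] q V assms(3,4) by (metis image_subset_iff)
  obtain O' where O': "open O'" "O' \<inter> K' = g -` N \<inter> K'"
    using assms(2) N(1) unfolding continuous_on_open_invariant by blast
  have "k (g r) - k (g q) = f (H' r) - f (H' q)" if "r \<in> K' \<inter> O'" for r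
    using N(3)[of "g r"] O'(2) that assms(3,4) q by auto
  then show "same_increments K' (\<lambda>x. k (g x)) (\<lambda>r. f (H' r)) q"
    unfolding same_increments_def using O' N(2) q by (intro exI[of _ O']) auto
qed

text \<open>
  Lifts over two closed pieces with connected intersection differ there by a constant; after adding it
  to one of them they fit together.
\<close>
lemma potential_along_glue:
  assumes "closed K1" "closed K2" "connected (K1 \<inter> K2)" "K1 \<inter> K2 \<noteq> {}" "H ` (K1 \<union> K2) \<subseteq> S"
    and k1: "potential_along K1 H k1" and k2: "potential_along K2 H k2"
  shows "\<exists>k. potential_along (K1 \<union> K2) H k"
proof -
  obtain m where m: "m \<in> K1 \<inter> K2" using assms(4) by blast
  define d where "d = k1 m - k2 m"
  have i1: "potential_along (K1 \<inter> K2) H k1"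
    using potential_along_compose[OF k1, of "K1 \<inter> K2" "\<lambda>x. x"] by auto
  have i2: "potential_along (K1 \<inter> K2) H k2"
    using potential_along_compose[OF k2, of "K1 \<inter> K2" "\<lambda>x. x"] by auto
  have eq: "k1 x = k2 x + d" if "x \<in> K1 \<inter> K2" for x
  proof -
    have "k1 x - k1 m = k2 x - k2 m"
      by (rule potential_along_unique[OF assms(3) _ i1 i2 m that]) (use assms(5) in blast)
    then show ?thesis by (simp add: d_def algebra_simps)
  qed
  define k where "k = (\<lambda>x. if x \<in> K1 then k1 x else k2 x + d)"
  have kk: "x \<in> K1 \<Longrightarrow> k x = k1 x" "x \<in> K2 \<Longrightarrow> k x = k2 x + d" for x using eq by (auto simp: k_def)
  have "potential_along (K1 \<union> K2) H k"
    unfolding potential_along_def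
  proof (intro ballI allI impI)
    fix q V f assume q: "q \<in> K1 \<union> K2" and V: "(V, f) \<in> P \<and> H q \<in> V"
    obtain N1 where N1: "open N1" "q \<in> N1" "\<And>r. r \<in> K1 \<Longrightarrow> r \<in> N1 \<Longrightarrow> k r - k q = f (H r) - f (H q)"
    proof (cases "q \<in> K1")
      case True
      then show ?thesis using potential_alongD[OF k1, of q V f] V kk(1) that by metis
    next
      case False
      \<comment> \<open>away from \<open>K1\<close> the condition is void near \<open>q\<close>\<close>
      then show ?thesis using assms(1) that[of "- K1"] by auto
    qed
    obtain N2 where N2: "open N2" "q \<in> N2" "\<And>r. r \<in> K2 \<Longrightarrow> r \<in> N2 \<Longrightarrow> k r - k q = f (H r) - f (H q)"
    proof (cases "q \<in> K2")
      case True
      then obtain N where "open N" "q \<in> N" "\<And>r. r \<in> K2 \<Longrightarrow> r \<in> N \<Longrightarrow> k2 r - k2 q = f (H r) - f (H q)"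
        using potential_alongD[OF k2, of q V f] V by metis
      then show ?thesis using True kk(2) that[of N] by simp
    next
      case False
      then show ?thesis using assms(2) that[of "- K2"] by auto
    qed
    show "same_increments (K1 \<union> K2) k (\<lambda>r. f (H r)) q"
      unfolding same_increments_def using N1 N2 by (intro exI[of _ "N1 \<inter> N2"]) auto
  qed
  then show ?thesis by blast
qed

text \<open>
  Lifts exist over the whole square. Bisection in one direction gives lifts over thin strips, starting
  from small rectangles that lie in the domain of a single potential; bisection in the other direction
  then glues the strips.
\<close>
lemma potential_along_square:
  fixes H :: "real \<times> real \<Rightarrow> 'a"
  assumes cont: "continuous_on ({0..1} \<times> {0..1}) H" and im: "H ` ({0..1} \<times> {0..1}) \<subseteq> S"
  obtains k where "potential_along ({0..1} \<times> {0..1}) H k"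
proof -
  have strip: "\<exists>\<delta>>0. \<forall>a b. a \<le> t \<and> t \<le> b \<and> b - a < \<delta> \<and> 0 \<le> a \<and> b \<le> 1 \<longrightarrow>
      (\<exists>k. potential_along ({a..b} \<times> {0..1}) H k)" if t: "0 \<le> t" "t \<le> 1" for t
  proof -
    define Q where "Q = (\<lambda>c d. 0 \<le> c \<and> d \<le> 1 \<longrightarrow> (\<exists>\<delta>>0. \<forall>a b. a \<le> t \<and> t \<le> b \<and> b - a < \<delta> \<and> 0 \<le> a \<and> b \<le> 1 \<longrightarrow>
      (\<exists>k. potential_along ({a..b} \<times> {c..d}) H k)))"
    have "(0::real) \<le> 1" by simp
    then have "Q 0 1"
    proof (induction rule: Bolzano)
      case (trans c d e)
      show ?case unfolding Q_def
      proof
        assume ce: "0 \<le> c \<and> e \<le> 1"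
        obtain \<delta>1 where d1: "\<delta>1 > 0" "\<And>a b. a \<le> t \<and> t \<le> b \<and> b - a < \<delta>1 \<and> 0 \<le> a \<and> b \<le> 1 \<Longrightarrow>
          \<exists>k. potential_along ({a..b} \<times> {c..d}) H k" using trans(1,4) ce unfolding Q_def by auto
        obtain \<delta>2 where d2: "\<delta>2 > 0" "\<And>a b. a \<le> t \<and> t \<le> b \<and> b - a < \<delta>2 \<and> 0 \<le> a \<and> b \<le> 1 \<Longrightarrow>
          \<exists>k. potential_along ({a..b} \<times> {d..e}) H k" using trans(2,3) ce unfolding Q_def by auto
        have "\<exists>k. potential_along ({a..b} \<times> {c..e}) H k"
          if ab: "a \<le> t \<and> t \<le> b \<and> b - a < min \<delta>1 \<delta>2 \<and> 0 \<le> a \<and> b \<le> 1" for a b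
        proof -
          obtain k1 k2 where k: "potential_along ({a..b} \<times> {c..d}) H k1" "potential_along ({a..b} \<times> {d..e}) H k2"
            using d1(2)[of a b] d2(2)[of a b] ab by auto
          have u: "{a..b} \<times> {c..d} \<union> {a..b} \<times> {d..e} = {a..b} \<times> {c..e}" using trans(3,4) by auto
          have i: "{a..b} \<times> {c..d} \<inter> {a..b} \<times> {d..e} = {a..b} \<times> {d}" using trans(3,4) by auto
          have im': "H ` ({a..b} \<times> {c..e}) \<subseteq> S" using im ab ce by force
          have cn: "connected ({a..b} \<times> {d})" by (intro connected_Times) auto
          have cl: "closed ({a..b} \<times> {c..d})" "closed ({a..b} \<times> {d..e})" by (intro closed_Times closed_atLeastAtMost)+
          show ?thesis
            using potential_along_glue[OF cl _ _ _ k] cn im' ab unfolding u i by auto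
        qed
        then show "\<exists>\<delta>>0. \<forall>a b. a \<le> t \<and> t \<le> b \<and> b - a < \<delta> \<and> 0 \<le> a \<and> b \<le> 1 \<longrightarrow>
          (\<exists>k. potential_along ({a..b} \<times> {c..e}) H k)"
          using d1(1) d2(1) by (intro exI[of _ "min \<delta>1 \<delta>2"]) auto
      qed
    next
      case (local x)
      have tx: "(t, x) \<in> {0..1} \<times> {0..1}" using t local by simp
      obtain V f where V: "(V, f) \<in> P" "H (t, x) \<in> V" using cover im tx by blast
      obtain O' where O': "open O'" "O' \<inter> ({0..1} \<times> {0..1}) = H -` V \<inter> ({0..1} \<times> {0..1})"
        using cont open_dom[OF V(1)] unfolding continuous_on_open_invariant by blast
      have "(t, x) \<in> O'" using O'(2) V(2) tx by blast
      then obtain e where e: "e > 0" "ball (t, x) e \<subseteq> O'" using O'(1) open_contains_ball by blast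
      have "\<exists>k. potential_along ({a..b} \<times> {c..d}) H k"
        if ab: "a \<le> t \<and> t \<le> b \<and> b - a < e / 2 \<and> 0 \<le> a \<and> b \<le> 1" and cd: "c \<le> x \<and> x \<le> d \<and> d - c < e / 2" "0 \<le> c \<and> d \<le> 1"
        for a b c d
      proof -
        have sub: "{a..b} \<times> {c..d} \<subseteq> {0..1} \<times> {0..1}" using ab cd by auto
        have "{a..b} \<times> {c..d} \<subseteq> ball (t, x) e"
        proof clarify
          fix s y assume sy: "s \<in> {a..b}" "y \<in> {c..d}"
          then have "a \<le> s" "s \<le> b" "c \<le> y" "y \<le> d" by auto
          then have "\<bar>t - s\<bar> < e / 2" "\<bar>x - y\<bar> < e / 2" using ab cd by linarith+
          then have "dist (t, x) (s, y) < e"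
            using sqrt_sum_squares_le_sum_abs[of "t - s" "x - y"] by (simp add: dist_Pair_Pair dist_real_def)
          then show "(s, y) \<in> ball (t, x) e" by simp
        qed
        then have "H ` ({a..b} \<times> {c..d}) \<subseteq> S \<inter> V" using e(2) O'(2) sub im by blast
        from potential_along_single[OF continuous_on_subset[OF cont sub] this V(1)] show ?thesis by blast
      qed
      note sq = this
      show ?case
      proof (rule exI[of _ "e / 2"], intro conjI allI impI)
        show "e / 2 > 0" using e(1) by simp
        fix c d assume cd: "c \<le> x \<and> x \<le> d \<and> d - c < e / 2"
        show "Q c d" unfolding Q_def
          using e(1) sq cd by (intro impI exI[of _ "e / 2"]) simp
      qed
    qed
    then show ?thesis by (simp add: Q_def)
  qed
  define R where "R = (\<lambda>a b. 0 \<le> a \<and> b \<le> 1 \<longrightarrow> (\<exists>k. potential_along ({a..b} \<times> {0..1}) H k))"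
  have "(0::real) \<le> 1" by simp
  then have "R 0 1"
  proof (induction rule: Bolzano)
    case (trans a b c)
    show ?case unfolding R_def
    proof
      assume ac: "0 \<le> a \<and> c \<le> 1"
      obtain k1 k2 where k: "potential_along ({a..b} \<times> {0..1}) H k1" "potential_along ({b..c} \<times> {0..1}) H k2"
        using trans ac unfolding R_def by auto
      have u: "{a..b} \<times> {0..1} \<union> {b..c} \<times> {0..1} = {a..c} \<times> {0..1::real}" using trans(3,4) by auto
      have i: "{a..b} \<times> {0..1} \<inter> {b..c} \<times> {0..1} = {b} \<times> {0..1::real}" using trans(3,4) by auto
      have im': "H ` ({a..c} \<times> {0..1}) \<subseteq> S" using im ac by force
      have cn: "connected ({b} \<times> {0..1::real})" by (intro connected_Times) auto
      have cl: "closed ({a..b} \<times> {0..1::real})" "closed ({b..c} \<times> {0..1::real})" by (intro closed_Times closed_atLeastAtMost)+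
      show "\<exists>k. potential_along ({a..c} \<times> {0..1}) H k"
        using potential_along_glue[OF cl _ _ _ k] cn im' unfolding u i by auto
    qed
  next
    case (local x)
    then show ?case using strip[of x] unfolding R_def by metis
  qed
  then show thesis using that by (auto simp: R_def)
qed

lemma potential_along_path:
  assumes "path \<gamma>" "path_image \<gamma> \<subseteq> S"
  obtains k where "potential_along {0..1} \<gamma> k"
proof -
  have "continuous_on ({0..1} \<times> {0..1::real}) (\<lambda>w. \<gamma> (fst w))"
    by (rule continuous_on_compose2[of "{0..1}" \<gamma>]) (use assms(1) in \<open>auto simp: path_def intro: continuous_intros\<close>)
  moreover have "(\<lambda>w. \<gamma> (fst w)) ` ({0..1} \<times> {0..1::real}) \<subseteq> S"
    using assms(2) by (auto simp: path_image_def)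
  ultimately obtain k where k: "potential_along ({0..1} \<times> {0..1::real}) (\<lambda>w. \<gamma> (fst w)) k"
    using potential_along_square by blast
  have "continuous_on {0..1} (\<lambda>s::real. (s, 0::real))" by (intro continuous_intros)
  moreover have "(\<lambda>s::real. (s, 0::real)) ` {0..1} \<subseteq> {0..1} \<times> {0..1}" by auto
  ultimately have "potential_along {0..1} \<gamma> (\<lambda>s. k (s, 0))" by (rule potential_along_compose[OF k]) simp
  then show thesis by (rule that)
qed

text \<open>
  Over the square of a contraction through loops, the restrictions of the lift to the two opposite
  sides traced by the base point vary in the same way. Hence the increment around the loop does not
  change during the contraction, and it vanishes for the constant loop.
\<close>
lemma potential_along_null_homotopic_loop:
  assumes "homotopic_loops S \<gamma> (\<lambda>_. c)" "potential_along {0..1} \<gamma> k"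
  shows "k 1 = k 0"
proof -
  obtain h where h: "continuous_on ({0..1::real} \<times> {0..1::real}) h" "h ` ({0..1} \<times> {0..1}) \<subseteq> S"
    "\<And>x. x \<in> {0..1} \<Longrightarrow> h (0, x) = \<gamma> x" "\<And>x. x \<in> {0..1} \<Longrightarrow> h (1, x) = c"
    "\<And>t. t \<in> {0..1} \<Longrightarrow> h (t, 1) = h (t, 0)"
  proof -
    obtain h where h: "continuous_on ({0..1::real} \<times> {0..1::real}) h" "h \<in> ({0..1} \<times> {0..1}) \<rightarrow> S"
      "\<forall>x \<in> {0..1}. h (0, x) = \<gamma> x" "\<forall>x \<in> {0..1}. h (1, x) = c"
      "\<forall>t \<in> {0..1}. pathfinish (h \<circ> Pair t) = pathstart (h \<circ> Pair t)"
      using assms(1) unfolding homotopic_loops by blast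
    have "h ` ({0..1} \<times> {0..1}) \<subseteq> S" using h(2) by blast
    moreover have "h (t, 1) = h (t, 0)" if "t \<in> {0..1}" for t
      using h(5) that by (simp add: pathfinish_def pathstart_def)
    ultimately show ?thesis using that[of h] h by blast
  qed
  obtain K where K: "potential_along ({0..1} \<times> {0..1}) h K" using potential_along_square[OF h(1,2)] .
  have c1: "continuous_on {0..1} (\<lambda>t::real. (t, y::real))" "continuous_on {0..1} (\<lambda>t::real. (y, t))" for y
    by (intro continuous_intros)+
  have K0: "potential_along {0..1} (\<lambda>t. h (t, 0)) (\<lambda>t. K (t, 0))"
    by (rule potential_along_compose[OF K c1(1)]) auto
  have K1: "potential_along {0..1} (\<lambda>t. h (t, 0)) (\<lambda>t. K (t, 1))"
    by (rule potential_along_compose[OF K c1(1)]) (auto simp: h(5))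
  have K\<gamma>: "potential_along {0..1} \<gamma> (\<lambda>x. K (0, x))"
    by (rule potential_along_compose[OF K c1(2)]) (auto simp: h(3))
  have Kc: "potential_along {0..1} (\<lambda>_::real. c) (\<lambda>x. K (1, x))"
    by (rule potential_along_compose[OF K c1(2)]) (auto simp: h(4))
  have cS: "c \<in> S" using h(2) h(4)[of 0] by force
  have \<gamma>S: "\<gamma> ` {0..1} \<subseteq> S"
  proof clarify
    fix x :: real assume "x \<in> {0..1}"
    moreover from this have "h (0, x) \<in> S" using h(2) by (auto simp: image_subset_iff)
    ultimately show "\<gamma> x \<in> S" using h(3)[of x] by simp
  qed
  obtain V f where V: "(V, f) \<in> P" "c \<in> V" using cover cS by blast
  have Kc': "potential_along {0..1} (\<lambda>_::real. c) (\<lambda>_. f c)"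
    by (rule potential_along_single[OF _ _ V(1)]) (use cS V in auto)
  have con: "connected {0..1::real}" by simp
  have "K (1, 0) - K (0, 0) = K (1, 1) - K (0, 1)"
    by (rule potential_along_unique[OF con _ K0 K1]) (use h(2) in auto)
  moreover have "K (1, 1) - K (1, 0) = f c - f c"
    by (rule potential_along_unique[OF con _ Kc Kc']) (use cS in auto)
  moreover have "k 1 - k 0 = K (0, 1) - K (0, 0)"
    by (rule potential_along_unique[OF con \<gamma>S assms(2) K\<gamma>]) auto
  ultimately show ?thesis by (simp add: algebra_simps)
qed

text \<open>
  The global potential is the increment of a lift along any path from a base point. It depends only on
  the end point since the increment around loops is zero. Local path connectedness is needed to compare
  it with a local potential near the end point.
\<close>
theorem simply_connected_global_potential:
  assumes "simply_connected S"
    and lpc: "\<And>p V. p \<in> S \<Longrightarrow> open V \<Longrightarrow> p \<in> V \<Longrightarrow> \<exists>W. open W \<and> p \<in> W \<and> (\<forall>q\<in>S \<inter> W. \<exists>\<delta>. path \<delta> \<and>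
        path_image \<delta> \<subseteq> S \<inter> V \<and> pathstart \<delta> = p \<and> pathfinish \<delta> = q)"
  obtains h where "\<And>V f p. (V, f) \<in> P \<Longrightarrow> p \<in> S \<Longrightarrow> p \<in> V \<Longrightarrow>
    \<exists>W. open W \<and> p \<in> W \<and> (\<forall>q\<in>S \<inter> W. h q - h p = f q - f p)"
proof (cases "S = {}")
  case True
  then show thesis using that by blast
next
  case False
  then obtain p0 where p0: "p0 \<in> S" by blast
  define G where "G = (\<lambda>q \<gamma> k. path \<gamma> \<and> path_image \<gamma> \<subseteq> S \<and> pathstart \<gamma> = p0 \<and> pathfinish \<gamma> = q \<and> potential_along {0..1} \<gamma> k)"
  define h where "h = (\<lambda>q. SOME c. \<exists>\<gamma> k. G q \<gamma> k \<and> c = k 1 - k 0)"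
  have ex: "\<exists>\<gamma> k. G q \<gamma> k" if "q \<in> S" for q
  proof -
    have "homotopic_loops S (\<lambda>_. p0) (\<lambda>_. q)"
      by (rule assms(1)[unfolded simply_connected_def, rule_format])
         (use p0 that in \<open>auto simp: path_def pathstart_def pathfinish_def path_image_def\<close>)
    then obtain H where H: "continuous_on ({0..1::real} \<times> {0..1::real}) H" "H \<in> ({0..1} \<times> {0..1}) \<rightarrow> S"
      "\<forall>x \<in> {0..1}. H (0, x) = p0" "\<forall>x \<in> {0..1}. H (1, x) = q"
      unfolding homotopic_loops by blast
    let ?\<gamma> = "\<lambda>t::real. H (t, 0)"
    have "continuous_on {0..1} (\<lambda>t::real. (t, 0::real))" by (intro continuous_intros)
    then have "path ?\<gamma>" unfolding path_def by (rule continuous_on_compose2[OF H(1)]) auto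
    moreover have im: "path_image ?\<gamma> \<subseteq> S" using H(2) unfolding path_image_def by auto
    moreover have "pathstart ?\<gamma> = p0" "pathfinish ?\<gamma> = q" using H(3,4) by (auto simp: pathstart_def pathfinish_def)
    moreover obtain k where "potential_along {0..1} ?\<gamma> k"
      using potential_along_path[OF calculation(1) im] .
    ultimately show ?thesis unfolding G_def by blast
  qed
  have halves: "potential_along {0..1} \<gamma> (\<lambda>x. k (x / 2))" "potential_along {0..1} \<delta> (\<lambda>x. k (x / 2 + 1 / 2))"
    if k: "potential_along {0..1} (\<gamma> +++ \<delta>) k" and gd: "pathfinish \<gamma> = pathstart \<delta>" for \<gamma> \<delta> k
  proof -
    show "potential_along {0..1} \<gamma> (\<lambda>x. k (x / 2))"
      by (rule potential_along_compose[OF k]) (auto intro!: continuous_intros simp: joinpaths_def)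
    show "potential_along {0..1} \<delta> (\<lambda>x. k (x / 2 + 1 / 2))"
      by (rule potential_along_compose[OF k])
         (use gd in \<open>auto intro!: continuous_intros simp: joinpaths_def pathfinish_def pathstart_def\<close>)
  qed
  have con: "connected {0..1::real}" by simp
  have uniq: "k 1 - k 0 = k' 1 - k' 0" if g: "G q \<gamma> k" and g': "G q \<gamma>' k'" for q \<gamma> k \<gamma>' k'
  proof -
    define L where "L = \<gamma> +++ reversepath \<gamma>'"
    have L: "path L" "path_image L \<subseteq> S" "pathfinish L = pathstart L"
      using g g' unfolding G_def L_def by (simp_all add: path_image_join)
    have "homotopic_loops S L (\<lambda>_. p0)"
      by (rule assms(1)[unfolded simply_connected_def, rule_format])
         (use L p0 in \<open>auto simp: path_def pathstart_def pathfinish_def path_image_def\<close>)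
    moreover obtain m where m: "potential_along {0..1} L m" using potential_along_path[OF L(1,2)] .
    ultimately have m01: "m 1 = m 0" by (rule potential_along_null_homotopic_loop)
    have j: "pathfinish \<gamma> = pathstart (reversepath \<gamma>')" using g g' by (simp add: G_def)
    note hv = halves[OF m[unfolded L_def] j]
    have r: "potential_along {0..1} \<gamma>' (\<lambda>x. m ((1 - x) / 2 + 1 / 2))"
      by (rule potential_along_compose[OF hv(2)]) (auto intro!: continuous_intros simp: reversepath_def)
    have "k 1 - k 0 = m (1 / 2) - m (0 / 2)"
      by (rule potential_along_unique[OF con _ _ hv(1)]) (use g in \<open>auto simp: G_def path_image_def\<close>)
    moreover have "k' 1 - k' 0 = m ((1 - 1) / 2 + 1 / 2) - m ((1 - 0) / 2 + 1 / 2)"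
      by (rule potential_along_unique[OF con _ _ r]) (use g' in \<open>auto simp: G_def path_image_def\<close>)
    ultimately show ?thesis using m01 by simp
  qed
  have h: "h q = k 1 - k 0" if "G q \<gamma> k" for q \<gamma> k
    unfolding h_def by (rule some_equality) (use that uniq in blast)+
  show thesis
  proof (rule that[of h])
    fix V f p assume V: "(V, f) \<in> P" "p \<in> S" "p \<in> V"
    obtain W where W0: "open W \<and> p \<in> W \<and> (\<forall>q\<in>S \<inter> W. \<exists>\<delta>. path \<delta> \<and>
        path_image \<delta> \<subseteq> S \<inter> V \<and> pathstart \<delta> = p \<and> pathfinish \<delta> = q)"
      using lpc[OF V(2) open_dom[OF V(1)] V(3)] by (elim exE)
    note W = W0[THEN conjunct1] W0[THEN conjunct2, THEN conjunct1]
      W0[THEN conjunct2, THEN conjunct2, rule_format, OF IntI]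
    have "h q - h p = f q - f p" if q: "q \<in> S" "q \<in> W" for q
    proof -
      obtain \<gamma> k where g: "G p \<gamma> k" using ex[OF V(2)] by blast
      obtain \<delta> where d: "path \<delta>" "path_image \<delta> \<subseteq> S \<inter> V" "pathstart \<delta> = p" "pathfinish \<delta> = q"
        using W(3)[OF q] by blast
      have j: "pathfinish \<gamma> = pathstart \<delta>" using g d by (simp add: G_def)
      have L: "path (\<gamma> +++ \<delta>)" "path_image (\<gamma> +++ \<delta>) \<subseteq> S" "pathstart (\<gamma> +++ \<delta>) = p0" "pathfinish (\<gamma> +++ \<delta>) = q"
          using g d unfolding G_def by (simp_all add: path_image_join)
      obtain m where m: "potential_along {0..1} (\<gamma> +++ \<delta>) m" using potential_along_path[OF L(1,2)] .
      note hv = halves[OF m j]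
      have sd: "potential_along {0..1} \<delta> (\<lambda>x. f (\<delta> x))"
        by (rule potential_along_single[OF _ _ V(1)]) (use d in \<open>auto simp: path_def path_image_def\<close>)
      have "h q = m 1 - m 0" by (rule h[of q "\<gamma> +++ \<delta>"]) (use L m in \<open>simp add: G_def\<close>)
      moreover have "h p = m (1 / 2) - m (0 / 2)"
        using h[of p \<gamma> "\<lambda>x. m (x / 2)"] g hv by (simp add: G_def)
      moreover have "m (1 / 2 + 1 / 2) - m (0 / 2 + 1 / 2) = f (\<delta> 1) - f (\<delta> 0)"
        by (rule potential_along_unique[OF con _ hv(2) sd]) (use d in \<open>auto simp: path_image_def\<close>)
      ultimately show ?thesis using d by (simp add: pathstart_def pathfinish_def)
    qed
    then show "\<exists>W. open W \<and> p \<in> W \<and> (\<forall>q\<in>S \<inter> W. h q - h p = f q - f p)" using W(1,2) by blast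
  qed
qed

end

section \<open>Exactness of closed forms\<close>

lemma open_chart_preimage:
  assumes "invertible A" "open V"
  shows "open (chart A -` V)"
proof -
  have o: "open {v. v \<noteq> 0 \<and> abs_cproj v \<in> V}" using assms(2) by (simp add: open_cproj_def)
  have "continuous_on UNIV (\<lambda>z. A *v homog z)"
  proof -
    have "continuous_on UNIV (\<lambda>z. \<chi> k. (A *v homog z) $ k)"
      by (intro continuous_on_vec_lambda smooth_on_continuous_on[OF smooth_on_matrix_homog[OF open_UNIV]])
    then show ?thesis by simp
  qed
  from open_vimage[OF o this] show ?thesis
    using assms(1) by (simp add: vimage_def chart_homog invertible_mult_eq_0_iff)
qed

lemma open_chart_image:
  assumes "invertible A" "open U"
  shows "open (chart A ` U)"
proof -
  obtain A' where A': "A ** A' = mat 1" "A' ** A = mat 1" using assms(1) by (auto simp: invertible_def)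
  have AA': "A *v (A' *v v) = v" "A' *v (A *v v) = v" for v
    using A' by (simp_all add: matrix_vector_mul_assoc)
  let ?W = "{v. (A' *v v) $ None \<noteq> 0}"
  have lin: "continuous_on UNIV (\<lambda>v. (A' *v v) $ k)" for k
  proof -
    have "(\<lambda>v. (A' *v v) $ k) = (\<lambda>v. \<Sum>j\<in>UNIV. A' $ k $ j * v $ j)" by (simp add: matrix_vector_mult_def)
    then show ?thesis by (simp add: continuous_intros)
  qed
  have oW: "open ?W" using open_vimage[OF _ lin, of "- {0}" None] by (simp add: vimage_def open_Compl)
  define g where "g = (\<lambda>v. \<chi> j. (A' *v v) $ Some j / (A' *v v) $ None)"
  have "continuous_on ?W g" unfolding g_def
    by (intro continuous_on_vec_lambda continuous_on_divide continuous_on_subset[OF lin]) auto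
  then have o: "open (?W \<inter> g -` U)" using continuous_open_preimage oW assms(2) by blast
  have "{v. v \<noteq> 0 \<and> abs_cproj v \<in> chart A ` U} = ?W \<inter> g -` U"
  proof (intro equalityI subsetI)
    fix v assume "v \<in> {v. v \<noteq> 0 \<and> abs_cproj v \<in> chart A ` U}"
    then obtain z where z: "v \<noteq> 0" "z \<in> U" "abs_cproj (A *v homog z) = abs_cproj v" by (auto simp: chart_homog)
    then obtain c where c: "c \<noteq> 0" "v = c *s (A *v homog z)"
      using abs_cproj_eq_iff[of "A *v homog z" v] assms(1) by (auto simp: invertible_mult_eq_0_iff)
    then have "A' *v v = c *s homog z" by (simp add: vector_scalar_commute[symmetric] AA')
    then have "(A' *v v) $ None = c" "g v = z" using c(1) by (simp_all add: g_def vec_eq_iff)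
    then show "v \<in> ?W \<inter> g -` U" using c z by simp
  next
    fix v assume v: "v \<in> ?W \<inter> g -` U"
    have "A' *v v = (A' *v v) $ None *s homog (g v)" using v by (simp add: vec_option_eq_iff g_def)
    then have "v = (A' *v v) $ None *s (A *v homog (g v))"
      by (metis AA'(1) vector_scalar_commute)
    moreover have "v \<noteq> 0" using v by auto
    ultimately have "abs_cproj (A *v homog (g v)) = abs_cproj v"
      using abs_cproj_eq_iff[of "A *v homog (g v)" v] v assms(1) by (auto simp: invertible_mult_eq_0_iff)
    then show "v \<in> {v. v \<noteq> 0 \<and> abs_cproj v \<in> chart A ` U}" using \<open>v \<noteq> 0\<close> v by (force simp: chart_homog)
  qed
  then show ?thesis using o by (simp add: open_cproj_def)
qed

definition local_primitive ::
  "'n::finite cproj set \<Rightarrow> ('n cproj_tangent \<Rightarrow> complex) \<Rightarrow> complex^('n option)^('n option) \<Rightarrow> (complex^'n) set \<Rightarrow> (complex^'n \<Rightarrow> complex) \<Rightarrow> bool" where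
  "local_primitive S \<alpha> A U F \<longleftrightarrow> invertible A \<and> open U \<and> smooth_on U F \<and>
    (\<forall>y\<in>U. chart A y \<in> S \<longrightarrow> (\<forall>X. dchart A y X \<in> T_space S (chart A y) \<longrightarrow> fder F y X = \<alpha> (dchart A y X)))"

text \<open>
  Pulled back under the retraction, both primitives have the same derivative on a ball.
\<close>
lemma local_primitives_differ_by_constant:
  assumes S: "real_hypersurface S" and A: "local_primitive S \<alpha> A U F" and B: "local_primitive S \<alpha> B V G"
    and z: "z \<in> U" "y \<in> V" "chart A z = chart B y" "chart A z \<in> S"
  obtains W where "open W" "z \<in> W" "W \<subseteq> U"
    "\<And>x w. x \<in> W \<Longrightarrow> chart A x \<in> S \<Longrightarrow> w \<in> V \<Longrightarrow> chart B w = chart A x \<Longrightarrow> F x - G w = F z - G y"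
proof -
  note a = A[unfolded local_primitive_def] and b = B[unfolded local_primitive_def]
  have iA: "invertible A" and iB: "invertible B" and oU: "open U" and oV: "open V"
    and F: "smooth_on U F" and G: "smooth_on V G" using a b by auto
  obtain T \<tau> where T: "open T" "z \<in> T" "smooth_on T \<tau>" "\<tau> z = y"
    "\<And>z. z \<in> T \<Longrightarrow> chart B (\<tau> z) = chart A z"
    "\<And>z X. z \<in> T \<Longrightarrow> dchart B (\<tau> z) (fder \<tau> z X) = dchart A z X"
    using chart_transition[OF iA iB z(3)] by blast
  let ?T = "{x \<in> T. \<tau> x \<in> V} \<inter> U"
  have oT: "open ?T" using open_Int_preimage[OF T(1) oV T(3)] oU by blast
  have zT: "z \<in> ?T" using T z by simp
  obtain U0 \<rho> where U0: "z \<in> U0" "defining_function (chart A -` S) U0 \<rho>"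
    using hypersurface_defining_function[OF S iA z(4)] .
  have zM: "z \<in> chart A -` S" using z by simp
  obtain N \<pi> where N: "open N" "z \<in> N" "N \<subseteq> U0 \<inter> ?T" "smooth_on N \<pi>"
    "\<And>z. z \<in> N \<Longrightarrow> \<pi> z \<in> U0 \<inter> ?T \<inter> chart A -` S" "\<And>z. z \<in> N \<Longrightarrow> z \<in> chart A -` S \<Longrightarrow> \<pi> z = z"
    "\<And>z X. z \<in> N \<Longrightarrow> z \<in> chart A -` S \<Longrightarrow> fder \<rho> z X = 0 \<Longrightarrow> fder \<pi> z X = X"
    "\<And>z X. z \<in> N \<Longrightarrow> fder \<rho> (\<pi> z) (fder \<pi> z X) = 0"
    using defining_function_retraction[OF U0(2,1) zM oT zT] by blast
  obtain e where e: "e > 0" "ball z e \<subseteq> N" using N(1,2) open_contains_ball by blast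
  define D where "D = (\<lambda>x. F (\<pi> x) - G (\<tau> (\<pi> x)))"
  have "(D has_derivative (\<lambda>h. 0)) (at x within ball z e)" if x: "x \<in> ball z e" for x
  proof -
    have xN: "x \<in> N" using e x by blast
    have px: "\<pi> x \<in> U0" "\<pi> x \<in> T" "\<tau> (\<pi> x) \<in> V" "\<pi> x \<in> U" "chart A (\<pi> x) \<in> S" using N(5)[OF xN] by auto
    have d\<pi>: "\<pi> differentiable (at x)" by (rule smooth_on_differentiable[OF N(4) xN])
    have dF: "F differentiable (at (\<pi> x))" by (rule smooth_on_differentiable[OF F px(4)])
    have d\<tau>: "\<tau> differentiable (at (\<pi> x))" by (rule smooth_on_differentiable[OF T(3) px(2)])
    have dG: "G differentiable (at (\<tau> (\<pi> x)))" by (rule smooth_on_differentiable[OF G px(3)])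
    have d\<tau>\<pi>: "(\<lambda>x. \<tau> (\<pi> x)) differentiable (at x)" using differentiable_chain_at[OF d\<pi> d\<tau>] by (simp add: o_def)
    have dF\<pi>: "(\<lambda>x. F (\<pi> x)) differentiable (at x)" using differentiable_chain_at[OF d\<pi> dF] by (simp add: o_def)
    have dG\<pi>: "(\<lambda>x. G (\<tau> (\<pi> x))) differentiable (at x)" using differentiable_chain_at[OF d\<tau>\<pi> dG] by (simp add: o_def)
    have dD: "D differentiable (at x)" unfolding D_def using dF\<pi> dG\<pi> by (rule differentiable_diff)
    have "fder D x h = 0" for h
    proof -
      let ?h = "fder \<pi> x h"
      have tan: "dchart A (\<pi> x) ?h \<in> T_space S (chart A (\<pi> x))"
        using T_space_iff[OF iA px(1) U0(2) px(5)] N(8)[OF xN] by simp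
      have eq: "dchart B (\<tau> (\<pi> x)) (fder \<tau> (\<pi> x) ?h) = dchart A (\<pi> x) ?h" by (rule T(6)[OF px(2)])
      have 1: "fder F (\<pi> x) ?h = \<alpha> (dchart A (\<pi> x) ?h)" using a px(4,5) tan by blast
      have "chart B (\<tau> (\<pi> x)) \<in> S" using T(5)[OF px(2)] px(5) by simp
      moreover have "dchart B (\<tau> (\<pi> x)) (fder \<tau> (\<pi> x) ?h) \<in> T_space S (chart B (\<tau> (\<pi> x)))"
        using tan eq T(5)[OF px(2)] by simp
      ultimately have 2: "fder G (\<tau> (\<pi> x)) (fder \<tau> (\<pi> x) ?h) = \<alpha> (dchart A (\<pi> x) ?h)"
        using b px(3) eq by metis
      have "fder D x h = fder F (\<pi> x) ?h - fder G (\<tau> (\<pi> x)) (fder (\<lambda>x. \<tau> (\<pi> x)) x h)"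
        unfolding D_def fder_diff[OF dF\<pi> dG\<pi>] using fder_compose[OF dF d\<pi>] fder_compose[OF dG d\<tau>\<pi>] by simp
      also have "\<dots> = 0" using fder_compose[OF d\<tau> d\<pi>] 1 2 by simp
      finally show ?thesis .
    qed
    then have "fder D x = (\<lambda>h. 0)" by auto
    then show ?thesis using has_derivative_at_withinI[OF has_derivative_fder[OF dD]] by metis
  qed
  then obtain c where c: "\<And>x. x \<in> ball z e \<Longrightarrow> D x = c"
    using has_derivative_zero_constant[OF convex_ball] by blast
  have val: "F x - G (\<tau> x) = c" if "x \<in> ball z e" "chart A x \<in> S" for x
    using c[OF that(1)] N(6)[of x] that e by (auto simp: D_def)
  show thesis
  proof (rule that[of "ball z e"])
    show "ball z e \<subseteq> U" using e N(3) by blast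
    fix x w assume x: "x \<in> ball z e" "chart A x \<in> S" and w: "w \<in> V" "chart B w = chart A x"
    have xT: "x \<in> T" using e x N(3) by blast
    have "\<tau> x = w" using T(5)[OF xT] w(2) chart_inject[OF iB] by metis
    moreover have "\<tau> z = y" by (rule T(4))
    ultimately show "F x - G w = F z - G y" using val[OF x] val[of z] e(1) z(4) by simp
  qed (use e in auto)
qed

text \<open>
  Closed forms on a simply connected hypersurface are exact. Local primitives are compatible local
  potentials, and small balls, moved into the hypersurface by the retraction, provide the short paths.
\<close>
theorem locally_exact_imp_exact:
  assumes S: "real_hypersurface S" and sc: "simply_connected S"
    and loc: "\<And>p. p \<in> S \<Longrightarrow> \<exists>A z U F. chart A z = p \<and> z \<in> U \<and> local_primitive S \<alpha> A U F"
  obtains f where "smooth_fun S f" "\<And>p \<xi>. p \<in> S \<Longrightarrow> \<xi> \<in> T_space S p \<Longrightarrow> differential S f \<xi> = \<alpha> \<xi>"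
proof -
  define P where "P = {(V, f). \<exists>A U F. V = chart A ` U \<and> local_primitive S \<alpha> A U F \<and> (\<forall>z\<in>U. f (chart A z) = F z)}"
  interpret local_potentials S P
  proof
    show "open V" if "(V, f) \<in> P" for V f
      using that open_chart_image unfolding P_def local_primitive_def by blast
    show "\<exists>V f. (V, f) \<in> P \<and> p \<in> V" if p: "p \<in> S" for p
    proof -
      obtain A z U F where A: "chart A z = p" "z \<in> U" "local_primitive S \<alpha> A U F" using loc[OF p] by blast
      have "inj_on (chart A) U" using A(3) chart_inject unfolding local_primitive_def inj_on_def by blast
      then have "(chart A ` U, \<lambda>q. F (inv_into U (chart A) q)) \<in> P"
        unfolding P_def using A by (auto simp: inv_into_f_f intro!: exI[of _ A] exI[of _ U] exI[of _ F])
      then show ?thesis using A by blast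
    qed
    show "\<exists>W. open W \<and> p \<in> W \<and> (\<forall>q\<in>S \<inter> W. f q - f' q = f p - f' p)"
      if pr: "(V, f) \<in> P" "(V', f') \<in> P" "p \<in> S" "p \<in> V" "p \<in> V'" for V f V' f' p
    proof -
      obtain A U F where A: "V = chart A ` U" "local_primitive S \<alpha> A U F" "\<And>z. z \<in> U \<Longrightarrow> f (chart A z) = F z"
        using pr(1) unfolding P_def by blast
      obtain B U' G where B: "V' = chart B ` U'" "local_primitive S \<alpha> B U' G" "\<And>z. z \<in> U' \<Longrightarrow> f' (chart B z) = G z"
        using pr(2) unfolding P_def by blast
      obtain z y where zy: "z \<in> U" "p = chart A z" "y \<in> U'" "p = chart B y" using pr(4,5) A(1) B(1) by blast
      have eq: "chart A z = chart B y" and zS: "chart A z \<in> S" using zy pr(3) by auto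
      obtain W where W: "open W" "z \<in> W" "W \<subseteq> U"
        "\<And>x w. x \<in> W \<Longrightarrow> chart A x \<in> S \<Longrightarrow> w \<in> U' \<Longrightarrow> chart B w = chart A x \<Longrightarrow> F x - G w = F z - G y"
        using local_primitives_differ_by_constant[OF S A(2) B(2) zy(1,3) eq zS] by blast
      let ?W = "chart A ` W \<inter> chart B ` U'"
      have "open ?W" using A(2) B(2) W(1) open_chart_image unfolding local_primitive_def by blast
      moreover have "p \<in> ?W" using W(2) zy by blast
      moreover have "f q - f' q = f p - f' p" if q: "q \<in> S \<inter> ?W" for q
      proof -
        obtain x w where xw: "x \<in> W" "q = chart A x" "w \<in> U'" "q = chart B w" using q by blast
        have "F x - G w = F z - G y" by (rule W(4)) (use xw q in auto)
        moreover have "f q = F x" "f' q = G w" "f p = F z" "f' p = G y"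
          using A(3)[of x] A(3)[of z] B(3)[of w] B(3)[of y] xw zy W(3) by (auto simp: subset_iff)
        ultimately show ?thesis by simp
      qed
      ultimately show ?thesis by (intro exI[of _ ?W] conjI ballI)
    qed
  qed
  have lpc: "\<exists>W. open W \<and> p \<in> W \<and> (\<forall>q\<in>S \<inter> W. \<exists>\<delta>. path \<delta> \<and> path_image \<delta> \<subseteq> S \<inter> V \<and> pathstart \<delta> = p \<and> pathfinish \<delta> = q)"
    if p: "p \<in> S" "open V" "p \<in> V" for p V
  proof -
    obtain A z U \<rho> where A: "invertible A" "chart A z = p" "z \<in> U" "defining_function (chart A -` S) U \<rho>"
      using S p(1) unfolding real_hypersurface_def by blast
    have zM: "z \<in> chart A -` S" "z \<in> chart A -` V" using A(2) p by auto
    obtain N \<pi> where N: "open N" "z \<in> N" "smooth_on N \<pi>"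
      "\<And>z. z \<in> N \<Longrightarrow> \<pi> z \<in> U \<inter> chart A -` V \<inter> chart A -` S" "\<And>z. z \<in> N \<Longrightarrow> z \<in> chart A -` S \<Longrightarrow> \<pi> z = z"
      using defining_function_retraction[OF A(4,3) zM(1) open_chart_preimage[OF A(1) p(2)] zM(2)] by metis
    obtain e where e: "e > 0" "ball z e \<subseteq> N" using N(1,2) open_contains_ball by blast
    have "\<exists>\<delta>. path \<delta> \<and> path_image \<delta> \<subseteq> S \<inter> V \<and> pathstart \<delta> = p \<and> pathfinish \<delta> = q"
      if q: "q \<in> S \<inter> chart A ` ball z e" for q
    proof -
      obtain y where y: "y \<in> ball z e" "q = chart A y" using q by blast
      have seg: "linepath z y t \<in> N" if "t \<in> {0..1}" for t
      proof -
        have "closed_segment z y \<subseteq> ball z e" using y e by (intro closed_segment_subset convex_ball) auto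
        then show ?thesis using e(2) that linepath_in_path[of t z y] by blast
      qed
      define \<delta> where "\<delta> = (\<lambda>t. chart A (\<pi> (linepath z y t)))"
      have c1: "continuous_on {0..1} (\<lambda>t. \<pi> (linepath z y t))"
        by (rule continuous_on_compose2[OF smooth_on_continuous_on[OF N(3)] continuous_on_linepath]) (use seg in blast)
      have "continuous_on UNIV (chart A)"
        using open_chart_preimage[OF A(1)] by (simp add: continuous_on_open_vimage)
      from continuous_on_compose2[OF this c1] have "path \<delta>" by (simp add: path_def \<delta>_def)
      moreover have "path_image \<delta> \<subseteq> S \<inter> V" using N(4)[OF seg] by (auto simp: path_image_def \<delta>_def)
      moreover have "pathstart \<delta> = p" using N(5)[OF N(2) zM(1)] A(2) by (simp add: pathstart_def \<delta>_def linepath_def)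
      moreover have "pathfinish \<delta> = q"
        using N(5)[of y] y q e(2) by (auto simp: pathfinish_def \<delta>_def linepath_def subset_iff)
      ultimately show ?thesis by blast
    qed
    moreover have "p \<in> chart A ` ball z e" using A(2) e(1) by auto
    moreover have "open (chart A ` ball z e)" using open_chart_image[OF A(1)] by blast
    ultimately show ?thesis by (intro exI[of _ "chart A ` ball z e"] conjI ballI)
  qed
  obtain h where h: "\<And>V f p. (V, f) \<in> P \<Longrightarrow> p \<in> S \<Longrightarrow> p \<in> V \<Longrightarrow>
    \<exists>W. open W \<and> p \<in> W \<and> (\<forall>q\<in>S \<inter> W. h q - h p = f q - f p)"
  proof (rule simply_connected_global_potential[OF sc lpc])
    fix h assume "\<And>V f p. (V, f) \<in> P \<Longrightarrow> p \<in> S \<Longrightarrow> p \<in> V \<Longrightarrow>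
      \<exists>W. open W \<and> p \<in> W \<and> (\<forall>q\<in>S \<inter> W. h q - h p = f q - f p)"
    then show thesis by (rule that)
  qed
  have main: "\<exists>A z W F. chart A z = p \<and> z \<in> W \<and> local_extension S h A W F \<and>
      (\<forall>X. dchart A z X \<in> T_space S p \<longrightarrow> fder F z X = \<alpha> (dchart A z X))" if p: "p \<in> S" for p
  proof -
    obtain A z U F where A: "chart A z = p" "z \<in> U" "local_primitive S \<alpha> A U F" using loc[OF p] by blast
    note a = A(3)[unfolded local_primitive_def]
    define f where "f = (\<lambda>q. F (inv_into U (chart A) q))"
    have "inj_on (chart A) U" using a chart_inject unfolding inj_on_def by blast
    then have f: "f (chart A x) = F x" if "x \<in> U" for x using that by (simp add: f_def inv_into_f_f)
    have fP: "(chart A ` U, f) \<in> P" unfolding P_def using A f by blast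
    have pU: "p \<in> chart A ` U" using A by blast
    obtain W where W0: "open W \<and> p \<in> W \<and> (\<forall>q\<in>S \<inter> W. h q - h p = f q - f p)"
      using h[OF fP p pU] by (elim exE)
    let ?W = "U \<inter> chart A -` W"
    let ?F = "\<lambda>x. F x + (h p - F z)"
    have oW: "open ?W" using W0 a open_chart_preimage by blast
    have sF: "smooth_on ?W F" using a smooth_on_subset by blast
    have "local_extension S h A ?W ?F"
      unfolding local_extension_def
    proof (intro conjI ballI impI)
      show "invertible A" using a by blast
      show "smooth_on ?W ?F" by (intro smooth_intros oW sF)
      fix x assume x: "x \<in> ?W" "chart A x \<in> S"
      then have "h (chart A x) - h p = f (chart A x) - f p" using W0 by auto
      then show "F x + (h p - F z) = h (chart A x)"
        using f[of x] f[of z] x A(1,2) by (simp add: algebra_simps)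
    qed (rule oW)
    moreover have zW: "z \<in> ?W" using A W0 by simp
    moreover have "fder ?F z X = \<alpha> (dchart A z X)" if "dchart A z X \<in> T_space S p" for X
    proof -
      have "fder ?F z X = fder F z X"
        using fder_add[OF smooth_on_differentiable[OF sF zW] differentiable_const] by simp
      then show ?thesis using a A(1,2) that p by simp
    qed
    ultimately show ?thesis using A(1)
      by (intro exI[of _ A] exI[of _ z] exI[of _ ?W] exI[of _ ?F]) simp
  qed
  show thesis
  proof (rule that[of h])
    show "smooth_fun S h" unfolding smooth_fun_def using main by blast
    fix p \<xi> assume p: "p \<in> S" and \<xi>: "\<xi> \<in> T_space S p"
    obtain A z W F where A: "chart A z = p" "z \<in> W" "local_extension S h A W F"
      "\<And>X. dchart A z X \<in> T_space S p \<Longrightarrow> fder F z X = \<alpha> (dchart A z X)" using main[OF p] by blast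
    have iA: "invertible A" using A(3) by (simp add: local_extension_def)
    obtain X where X: "\<xi> = dchart A z X" using T_space_E[OF \<xi> iA A(1)] .
    have "differential S h \<xi> = fder F z X"
      unfolding X by (rule differential_eq[OF S A(3,2)]) (use A(1) p \<xi> X in auto)
    then show "differential S h \<xi> = \<alpha> \<xi>" using A(4)[of X] X \<xi> by simp
  qed
qed

section \<open>The dual map and its differential\<close>

text \<open>
  The complex bilinear, not the hermitian, product: the pairing of dual coordinates with points.
\<close>
definition cdot :: "complex^'m \<Rightarrow> complex^'m \<Rightarrow> complex" where
  "cdot u v = (\<Sum>j\<in>UNIV. u $ j * v $ j)"

lemma cdot_commute: "cdot u v = cdot v u"
  by (simp add: cdot_def mult.commute)

lemma cdot_add_right: "cdot u (v + w) = cdot u v + cdot u w"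
  and cdot_add_left: "cdot (u + v) w = cdot u w + cdot v w"
  and cdot_diff_right: "cdot u (v - w) = cdot u v - cdot u w"
  and cdot_diff_left: "cdot (u - v) w = cdot u w - cdot v w"
  and cdot_scale_right: "cdot u (c *s v) = c * cdot u v"
  and cdot_scale_left: "cdot (c *s u) v = c * cdot u v"
  and cdot_minus_left: "cdot (- u) v = - cdot u v"
  and cdot_zero_right [simp]: "cdot u 0 = 0"
  and cdot_zero_left [simp]: "cdot 0 u = 0"
  by (simp_all add: cdot_def algebra_simps sum.distrib sum_subtractf sum_distrib_left sum_negf)

lemma cdot_scaleR_right: "cdot u (r *\<^sub>R v) = r *\<^sub>R cdot u v"
  by (simp add: cdot_def scaleR_sum_right)

lemma cdot_axis: "cdot u (axis j c) = u $ j * c"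
  by (simp add: cdot_def axis_def if_distrib cong: if_cong)

lemma bounded_bilinear_cdot: "bounded_bilinear (cdot :: complex^'m \<Rightarrow> _)"
proof -
  have "bilinear (cdot :: complex^'m \<Rightarrow> complex^'m \<Rightarrow> complex)"
    unfolding bilinear_def
    by (auto intro!: linearI simp: cdot_def algebra_simps sum.distrib scaleR_sum_right)
  then show ?thesis by (simp add: bilinear_conv_bounded_bilinear)
qed

lemma cdot_matrix: "cdot (transpose M *v u) v = cdot u (M *v v)"
proof -
  have "cdot (transpose M *v u) v = (\<Sum>j\<in>UNIV. \<Sum>i\<in>UNIV. M $ i $ j * u $ i * v $ j)"
    by (simp add: cdot_def matrix_vector_mult_def transpose_def sum_distrib_right)
  also have "\<dots> = (\<Sum>i\<in>UNIV. \<Sum>j\<in>UNIV. M $ i $ j * u $ i * v $ j)" by (rule sum.swap)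
  also have "\<dots> = cdot u (M *v v)"
    by (simp add: cdot_def matrix_vector_mult_def sum_distrib_left mult_ac)
  finally show ?thesis .
qed

lemma cdot_homog: "cdot (homog u) v = v $ None + cdot u (\<chi> j. v $ Some j)"
  and cdot_homog0: "cdot v (homog0 X) = cdot (\<chi> j. v $ Some j) X"
proof -
  have s: "(\<Sum>k\<in>UNIV. f k) = f None + (\<Sum>j\<in>UNIV. f (Some j))" for f :: "'a::finite option \<Rightarrow> complex"
    by (simp add: UNIV_option_conv sum.reindex)
  show "cdot (homog u) v = v $ None + cdot u (\<chi> j. v $ Some j)" for u :: "complex^'a" and v
    by (simp add: cdot_def s)
  show "cdot v (homog0 X) = cdot (\<chi> j. v $ Some j) X" for X :: "complex^'a" and v
    by (simp add: cdot_def s)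
qed

lemma cdot_homog_homog: "cdot (homog u) (homog v) = 1 + cdot u v"
  and cdot_homog_homog0: "cdot (homog u) (homog0 X) = cdot u X"
  by (simp_all add: cdot_homog)

lemma complex_vec_real_basis:
  "(X::complex^'n) = (\<Sum>j\<in>UNIV. Re (X $ j) *\<^sub>R axis j 1 + Im (X $ j) *\<^sub>R axis j \<i>)"
  by (auto simp: vec_eq_iff axis_def complex_eq_iff if_distrib[of Re] if_distrib[of Im] if_distrib[of "\<lambda>x. _ * x"] cong: if_cong)

text \<open>
  The \<open>(1,0)\<close> part of a real differential \<open>\<phi>\<close> is \<open>X \<mapsto> (\<phi> X - \<i> \<phi> (\<i> X)) / 2\<close>. In this form no coordinates are
  needed in the sequel.
\<close>
lemma wirtinger_cdot:
  assumes "linear (fder \<rho> z)"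
  shows "cdot (\<chi> j. wirtinger \<rho> z j) X = (complex_of_real (fder \<rho> z X) - \<i> * complex_of_real (fder \<rho> z (\<i> *s X))) / 2"
proof -
  let ?f = "fder \<rho> z"
  have f: "?f X = (\<Sum>j\<in>UNIV. Re (X $ j) * ?f (axis j 1) + Im (X $ j) * ?f (axis j \<i>))" for X
    by (subst complex_vec_real_basis) (simp add: linear_sum[OF assms] linear_add[OF assms] linear_cmul[OF assms])
  have g: "?f (\<i> *s X) = (\<Sum>j\<in>UNIV. - Im (X $ j) * ?f (axis j 1) + Re (X $ j) * ?f (axis j \<i>))"
    by (subst f) simp
  have comb: "(complex_of_real (\<Sum>j\<in>UNIV. a j) - \<i> * complex_of_real (\<Sum>j\<in>UNIV. b j)) / 2
      = (\<Sum>j\<in>UNIV. (complex_of_real (a j) - \<i> * complex_of_real (b j)) / 2)" for a b :: "'a \<Rightarrow> real"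
    by (simp add: sum_divide_distrib[symmetric] sum_subtractf sum_distrib_left)
  have "(complex_of_real (?f X) - \<i> * complex_of_real (?f (\<i> *s X))) / 2 =
    (\<Sum>j\<in>UNIV. (complex_of_real (Re (X $ j) * ?f (axis j 1) + Im (X $ j) * ?f (axis j \<i>))
      - \<i> * complex_of_real (- Im (X $ j) * ?f (axis j 1) + Re (X $ j) * ?f (axis j \<i>))) / 2)"
    unfolding g by (subst f) (rule comb)
  also have "\<dots> = (\<Sum>j\<in>UNIV. wirtinger \<rho> z j * X $ j)"
    by (intro sum.cong refl) (simp add: wirtinger_def complex_eq_iff field_simps)
  finally show ?thesis by (simp add: cdot_def)
qed

abbreviation hess :: "(complex^('n::finite) \<Rightarrow> real) \<Rightarrow> complex^'n \<Rightarrow> complex^'n \<Rightarrow> complex^'n \<Rightarrow> real" where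
  "hess \<rho> z X Y \<equiv> fder (\<lambda>y. fder \<rho> y Y) z X"

lemma hess_minus:
  assumes "open U" "smooth_on U \<rho>" "z \<in> U"
  shows "hess \<rho> z X (- Y) = - hess \<rho> z X Y"
proof -
  have "frechet_derivative (\<lambda>y. fder \<rho> y (- Y)) (at z) = fder (\<lambda>y. - fder \<rho> y Y) z" (is "?l = ?r")
    by (rule frechet_derivative_cong_open[OF assms(1,3)]) (rule linear_neg[OF smooth_on_linear_fder[OF assms(2)]])
  moreover have "?r X = - hess \<rho> z X Y"
    by (rule fder_bounded_linear_compose[OF bounded_linear_minus[OF bounded_linear_ident]
          smooth_on_differentiable[OF smooth_on_fder[OF assms(2)] assms(3)]])
  ultimately show ?thesis by simp
qed

text \<open>
  Charts in which the dual map is defined along the hypersurface.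
\<close>
definition dual_chart where
  "dual_chart S A U \<rho> \<longleftrightarrow> invertible A \<and> defining_function (chart A -` S) U \<rho> \<and>
     (\<forall>y\<in>U. chart A y \<in> S \<longrightarrow> dual_denom \<rho> y \<noteq> 0)"

lemma dual_chartD:
  assumes "dual_chart S A U \<rho>"
  shows "invertible A" "defining_function (chart A -` S) U \<rho>" "open U" "smooth_on U \<rho>"
    "\<And>y. y \<in> U \<Longrightarrow> chart A y \<in> S \<Longrightarrow> dual_denom \<rho> y \<noteq> 0"
  using assms defining_functionD(1,2) unfolding dual_chart_def by auto

lemma dual_denom_cdot: "dual_denom \<rho> z = cdot (\<chi> j. wirtinger \<rho> z j) z"
  by (simp add: dual_denom_def cdot_def mult.commute)

lemma cdot_dual_map: "cdot (dual_map \<rho> z) X = cdot (\<chi> j. wirtinger \<rho> z j) X / dual_denom \<rho> z"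
  by (simp add: cdot_def dual_map_def sum_divide_distrib)

lemma cdot_dual_map_self: "dual_denom \<rho> z \<noteq> 0 \<Longrightarrow> cdot (dual_map \<rho> z) z = 1"
  by (simp add: cdot_dual_map dual_denom_cdot)

lemma H_space_iff_cdot:
  assumes "dual_chart S A U \<rho>" "z \<in> U" "chart A z \<in> S"
  shows "dchart A z X \<in> H_space S (chart A z) \<longleftrightarrow> cdot (dual_map \<rho> z) X = 0"
proof -
  note g = dual_chartD[OF assms(1)]
  have "dchart A z X \<in> H_space S (chart A z) \<longleftrightarrow> fder \<rho> z X = 0 \<and> fder \<rho> z (\<i> *s X) = 0"
    by (rule H_space_iff[OF g(1) assms(2) g(2) assms(3)])
  also have "\<dots> \<longleftrightarrow> cdot (\<chi> j. wirtinger \<rho> z j) X = 0"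
    unfolding wirtinger_cdot[OF smooth_on_linear_fder[OF g(4) assms(2)]]
    by (auto simp: complex_eq_iff)
  also have "\<dots> \<longleftrightarrow> cdot (dual_map \<rho> z) X = 0"
    using g(5)[OF assms(2,3)] by (simp add: cdot_dual_map)
  finally show ?thesis .
qed

lemma smooth_on_wirtinger: "open U \<Longrightarrow> smooth_on U \<rho> \<Longrightarrow> smooth_on U (\<lambda>z. wirtinger \<rho> z j)"
  unfolding wirtinger_def by (intro smooth_intros) auto

lemma smooth_on_dual_denom: "open U \<Longrightarrow> smooth_on U \<rho> \<Longrightarrow> smooth_on U (dual_denom \<rho>)"
  unfolding dual_denom_def[abs_def] by (intro smooth_intros smooth_on_wirtinger)

lemma open_dual_domain:
  assumes "open U" "smooth_on U \<rho>"
  shows "open {z \<in> U. dual_denom \<rho> z \<noteq> 0}"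
  using open_Int_preimage[OF assms(1) _ smooth_on_dual_denom[OF assms], of "- {0}"] by (simp add: open_Compl)

lemma smooth_on_dual_map:
  assumes "open U" "smooth_on U \<rho>"
  shows "smooth_on {z \<in> U. dual_denom \<rho> z \<noteq> 0} (dual_map \<rho>)"
proof -
  have s: "smooth_on {z \<in> U. dual_denom \<rho> z \<noteq> 0} \<rho>" by (rule smooth_on_subset[OF assms(2)]) auto
  show ?thesis unfolding dual_map_def[abs_def]
    by (intro smooth_intros smooth_on_wirtinger smooth_on_dual_denom s open_dual_domain assms) auto
qed

lemma dual_map_differentiable:
  assumes "dual_chart S A U \<rho>" "z \<in> U" "chart A z \<in> S"
  shows "dual_map \<rho> differentiable (at z)" "linear (fder (dual_map \<rho>) z)"
proof -
  note g = dual_chartD[OF assms(1)]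
  have "z \<in> {z \<in> U. dual_denom \<rho> z \<noteq> 0}" using g(5) assms by simp
  then show "dual_map \<rho> differentiable (at z)" using smooth_on_differentiable[OF smooth_on_dual_map[OF g(3,4)]] by blast
  then show "linear (fder (dual_map \<rho>) z)" by (rule fder_linear)
qed

text \<open>
  Differentiating \<open>w \<cdot> z = 1\<close>: the dual map sends complex tangent vectors to the hyperplane of vectors
  annihilated by \<open>z\<close>.
\<close>
lemma fder_dual_map_base:
  assumes "dual_chart S A U \<rho>" "z \<in> U" "chart A z \<in> S" "cdot (dual_map \<rho> z) X = 0"
  shows "cdot (fder (dual_map \<rho>) z X) z = 0"
proof -
  note g = dual_chartD[OF assms(1)]
  let ?V = "{z \<in> U. dual_denom \<rho> z \<noteq> 0}"
  have zV: "z \<in> ?V" using g(5) assms by simp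
  have "frechet_derivative (\<lambda>z. cdot (dual_map \<rho> z) z) (at z) = fder (\<lambda>z. 1) z"
    by (rule frechet_derivative_cong_open[OF open_dual_domain[OF g(3,4)] zV]) (simp add: cdot_dual_map_self)
  then have "fder (\<lambda>z. cdot (dual_map \<rho> z) z) z X = 0" by simp
  then show ?thesis
    using fder_bilinear[OF bounded_bilinear_cdot dual_map_differentiable(1)[OF assms(1-3)] differentiable_ident, of X] assms(4)
    by simp
qed

text \<open>
  Paired with a complex tangent vector, the differential of the dual map is that of the Wirtinger
  gradient up to a scalar, because the derivative of the denominator is multiplied by a vanishing
  pairing. What remains is the real Hessian and its twist by the complex structure.
\<close>
lemma fder_dual_map_hess:
  assumes "dual_chart S A U \<rho>" "z \<in> U" "chart A z \<in> S" "cdot (dual_map \<rho> z) Y = 0"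
  shows "2 * dual_denom \<rho> z * cdot (fder (dual_map \<rho>) z X) Y =
    complex_of_real (hess \<rho> z X Y) - \<i> * complex_of_real (hess \<rho> z X (\<i> *s Y))"
proof -
  note g = dual_chartD[OF assms(1)]
  let ?V = "{z \<in> U. dual_denom \<rho> z \<noteq> 0}"
  have oV: "open ?V" by (rule open_dual_domain[OF g(3,4)])
  have zV: "z \<in> ?V" using g(5) assms by simp
  have d: "(\<lambda>y. fder \<rho> y Y) differentiable (at z)" for Y
    by (rule smooth_on_differentiable[OF smooth_on_fder[OF g(4)] assms(2)])
  have dr: "((\<lambda>y. complex_of_real (fder \<rho> y Y)) has_derivative (\<lambda>X. complex_of_real (hess \<rho> z X Y))) (at z)" for Y
    by (rule bounded_linear.has_derivative[OF bounded_linear_of_real has_derivative_fder[OF d]])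
  have "((\<lambda>y. complex_of_real (fder \<rho> y Y) - \<i> * complex_of_real (fder \<rho> y (\<i> *s Y))) has_derivative
    (\<lambda>X. complex_of_real (hess \<rho> z X Y) - \<i> * complex_of_real (hess \<rho> z X (\<i> *s Y)))) (at z)"
    by (intro has_derivative_diff has_derivative_mult_right dr)
  then have R: "fder (\<lambda>y. complex_of_real (fder \<rho> y Y) - \<i> * complex_of_real (fder \<rho> y (\<i> *s Y))) z X
    = complex_of_real (hess \<rho> z X Y) - \<i> * complex_of_real (hess \<rho> z X (\<i> *s Y))" by (simp add: fder_eq)
  have eq: "frechet_derivative (\<lambda>y. (2 * dual_denom \<rho> y) * cdot (dual_map \<rho> y) Y) (at z) =
    fder (\<lambda>y. complex_of_real (fder \<rho> y Y) - \<i> * complex_of_real (fder \<rho> y (\<i> *s Y))) z"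
  proof (rule frechet_derivative_cong_open[OF oV zV])
    fix y assume y: "y \<in> ?V"
    then have "linear (fder \<rho> y)" using smooth_on_linear_fder[OF g(4)] by simp
    from wirtinger_cdot[OF this, of Y] y
    show "(2 * dual_denom \<rho> y) * cdot (dual_map \<rho> y) Y = complex_of_real (fder \<rho> y Y) - \<i> * complex_of_real (fder \<rho> y (\<i> *s Y))"
      by (simp add: cdot_dual_map mult.commute[of _ 2])
  qed
  have dd: "(\<lambda>y. 2 * dual_denom \<rho> y) differentiable (at z)"
    using smooth_on_differentiable[OF smooth_on_dual_denom[OF g(3,4)] assms(2)] by (intro differentiable_mult) auto
  have dm: "dual_map \<rho> differentiable (at z)" by (rule dual_map_differentiable[OF assms(1-3)])
  have dc: "(\<lambda>y. cdot (dual_map \<rho> y) Y) differentiable (at z)" "fder (\<lambda>y. cdot (dual_map \<rho> y) Y) z X = cdot (fder (dual_map \<rho>) z X) Y"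
    using bounded_linear.has_derivative[OF bounded_bilinear.bounded_linear_left[OF bounded_bilinear_cdot] has_derivative_fder[OF dm], of Y]
    by (auto simp: differentiable_def fder_eq)
  have "fder (\<lambda>y. (2 * dual_denom \<rho> y) * cdot (dual_map \<rho> y) Y) z X = 2 * dual_denom \<rho> z * cdot (fder (dual_map \<rho>) z X) Y"
    unfolding fder_mult[OF dd dc(1)] dc(2) using assms(4) by simp
  then show ?thesis using eq R by simp
qed

text \<open>
  Definiteness of the real Hessian on tangent vectors; the scalar \<open>s\<close> takes care of its sign.
\<close>
definition convex_chart where
  "convex_chart S A U \<rho> \<longleftrightarrow> dual_chart S A U \<rho> \<and>
     (\<forall>y\<in>U. chart A y \<in> S \<longrightarrow> (\<exists>s. \<forall>X. X \<noteq> 0 \<longrightarrow> fder \<rho> y X = 0 \<longrightarrow> s * hess \<rho> y X X > 0))"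

text \<open>
  Twice the antiholomorphic part of the differential \<open>W\<close> of the dual map, up to the factor \<open>- \<i>\<close>. On
  complex tangent vectors it is \<open>W (J - J\<^sup>*)\<close>, so that its injectivity is the invertibility of \<open>J - J\<^sup>*\<close>.
\<close>
definition dual_antihol :: "(complex^('n::finite) \<Rightarrow> real) \<Rightarrow> complex^'n \<Rightarrow> complex^'n \<Rightarrow> complex^'n" where
  "dual_antihol \<rho> z X = fder (dual_map \<rho>) z (\<i> *s X) - \<i> *s fder (dual_map \<rho>) z X"

lemma i_smult_neq_0: "X \<noteq> 0 \<Longrightarrow> \<i> *s X \<noteq> (0 :: complex^'n)"
  by (auto simp: vec_eq_iff)

text \<open>
  Both maps are nondegenerate by convexity. If \<open>W X = 0\<close>, pairing with \<open>X\<close> gives \<open>D\<^sup>2\<rho>(X,X) = 0\<close>. If the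
  antiholomorphic part vanishes at \<open>X\<close>, pairing with \<open>\<i> X\<close> gives \<open>D\<^sup>2\<rho>(X,X) + D\<^sup>2\<rho>(\<i>X,\<i>X) = 0\<close>, i.e. the Levi form
  vanishes on \<open>X\<close>.
\<close>
lemma convex_chart_injective:
  assumes "convex_chart S A U \<rho>" "z \<in> U" "chart A z \<in> S" "cdot (dual_map \<rho> z) X = 0"
  shows "fder (dual_map \<rho>) z X = 0 \<Longrightarrow> X = 0" "dual_antihol \<rho> z X = 0 \<Longrightarrow> X = 0"
proof -
  have gc: "dual_chart S A U \<rho>" using assms(1) by (simp add: convex_chart_def)
  note g = dual_chartD[OF gc]
  obtain s where s: "\<And>X. X \<noteq> 0 \<Longrightarrow> fder \<rho> z X = 0 \<Longrightarrow> s * hess \<rho> z X X > 0"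
    using assms(1-3) unfolding convex_chart_def by blast
  have t: "fder \<rho> z X = 0" "fder \<rho> z (\<i> *s X) = 0"
    using H_space_iff[OF g(1) assms(2) g(2) assms(3), of X] H_space_iff_cdot[OF gc assms(2,3), of X] assms(4) by auto
  have iX: "cdot (dual_map \<rho> z) (\<i> *s X) = 0" using assms(4) by (simp add: cdot_scale_right)
  note h = fder_dual_map_hess[OF gc assms(2,3)]
  show "X = 0" if "fder (dual_map \<rho>) z X = 0"
  proof (rule ccontr)
    assume "X \<noteq> 0"
    then have "hess \<rho> z X X \<noteq> 0" using s[OF _ t(1)] by auto
    moreover have "Re (complex_of_real (hess \<rho> z X X) - \<i> * complex_of_real (hess \<rho> z X (\<i> *s X))) = 0"
      unfolding h[OF assms(4), of X, symmetric] that by simp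
    ultimately show False by simp
  qed
  show "X = 0" if q: "dual_antihol \<rho> z X = 0"
  proof (rule ccontr)
    assume X: "X \<noteq> 0"
    have E: "2 * dual_denom \<rho> z * cdot (dual_antihol \<rho> z X) (\<i> *s X) =
        2 * dual_denom \<rho> z * cdot (fder (dual_map \<rho>) z (\<i> *s X)) (\<i> *s X)
        - \<i> * (2 * dual_denom \<rho> z * cdot (fder (dual_map \<rho>) z X) (\<i> *s X))"
      by (simp add: dual_antihol_def cdot_diff_left cdot_scale_left algebra_simps)
    have Z: "2 * dual_denom \<rho> z * cdot (fder (dual_map \<rho>) z (\<i> *s X)) (\<i> *s X)
        - \<i> * (2 * dual_denom \<rho> z * cdot (fder (dual_map \<rho>) z X) (\<i> *s X)) = 0"
      using E unfolding q by (simp only: cdot_zero_left mult_zero_right)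
    have "hess \<rho> z (\<i> *s X) (\<i> *s X) + hess \<rho> z X X = 0"
      using arg_cong[OF Z, of Re]
      unfolding h[OF iX] i_smult_i_smult hess_minus[OF g(3,4) assms(2)] by simp
    then have "s * hess \<rho> z (\<i> *s X) (\<i> *s X) + s * hess \<rho> z X X = 0" by (simp add: distrib_left[symmetric])
    then show False using s[OF X t(1)] s[OF i_smult_neq_0[OF X] t(2)] by linarith
  qed
qed

text \<open>
  Both hyperplanes have the same dimension. Instead of counting dimensions, the map is extended to
  the whole space by sending the complement \<open>z\<close> of one hyperplane to the complement \<open>w\<close> of the other;
  the extension is injective, hence onto.
\<close>
lemma hyperplane_map_surjective:
  fixes L :: "complex^'n \<Rightarrow> complex^'n"
  assumes L: "linear L" and wz: "cdot w z = 1"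
    and im: "\<And>X. cdot w X = 0 \<Longrightarrow> cdot (L X) z = 0"
    and inj: "\<And>X. cdot w X = 0 \<Longrightarrow> L X = 0 \<Longrightarrow> X = 0"
    and Y: "cdot Y z = 0"
  obtains X where "cdot w X = 0" "L X = Y"
proof -
  define M where "M = (\<lambda>X. L (X - cdot w X *s z) + cdot w X *s w)"
  have sc: "(r *\<^sub>R c) *s v = r *\<^sub>R (c *s v)" for r c and v :: "complex^'n" by (simp add: vec_eq_iff)
  have M: "linear M"
    unfolding M_def
    by (rule linearI) (simp_all add: linear_add[OF L] linear_diff[OF L] linear_cmul[OF L] cdot_add_right cdot_scaleR_right
        vector_sadd_rdistrib sc algebra_simps)
  have Mz: "cdot (M X) z = cdot w X" for X
  proof -
    have "cdot w (X - cdot w X *s z) = 0" by (simp add: cdot_diff_right cdot_scale_right wz)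
    then show ?thesis by (simp add: M_def cdot_add_left cdot_scale_left wz im)
  qed
  have "X = 0" if "M X = 0" for X
  proof -
    have "cdot w X = 0" using Mz[of X] that by simp
    moreover from this have "L X = 0" using that by (simp add: M_def)
    ultimately show ?thesis by (rule inj)
  qed
  then have "inj M" using linear_injective_0[OF M] by blast
  then obtain X where X: "M X = Y" using linear_injective_imp_surjective[OF M] by (metis surjD)
  have "cdot w X = 0" using Mz[of X] X Y by simp
  moreover from this have "L X = Y" using X by (simp add: M_def)
  ultimately show thesis by (rule that)
qed

lemma linear_i_smult: "linear (\<lambda>X. \<i> *s (X :: complex^'n))"
  by (rule linearI) (simp_all add: vec_eq_iff algebra_simps)

lemma dual_antihol_linear: "linear (fder (dual_map \<rho>) z) \<Longrightarrow> linear (dual_antihol \<rho> z)"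
  unfolding dual_antihol_def[abs_def]
  using linear_compose_sub[OF linear_compose[OF linear_i_smult] linear_compose[OF _ linear_i_smult]]
  by (simp add: o_def)

lemma convex_chart_surjective:
  assumes "convex_chart S A U \<rho>" "z \<in> U" "chart A z \<in> S" "cdot Y z = 0"
  shows "\<exists>X. cdot (dual_map \<rho> z) X = 0 \<and> fder (dual_map \<rho>) z X = Y"
    "\<exists>X. cdot (dual_map \<rho> z) X = 0 \<and> dual_antihol \<rho> z X = Y"
proof -
  have gc: "dual_chart S A U \<rho>" using assms(1) by (simp add: convex_chart_def)
  note g = dual_chartD[OF gc]
  have w: "cdot (dual_map \<rho> z) z = 1" by (rule cdot_dual_map_self[OF g(5)[OF assms(2,3)]])
  note lin = dual_map_differentiable(2)[OF gc assms(2,3)]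
  note b = fder_dual_map_base[OF gc assms(2,3)]
  have b2: "cdot (dual_antihol \<rho> z X) z = 0" if "cdot (dual_map \<rho> z) X = 0" for X
    using b[of X] b[of "\<i> *s X"] that by (simp add: dual_antihol_def cdot_diff_left cdot_scale_left cdot_scale_right)
  show "\<exists>X. cdot (dual_map \<rho> z) X = 0 \<and> fder (dual_map \<rho>) z X = Y"
    using hyperplane_map_surjective[OF lin w b _ assms(4)] convex_chart_injective(1)[OF assms(1-3)] by metis
  show "\<exists>X. cdot (dual_map \<rho> z) X = 0 \<and> dual_antihol \<rho> z X = Y"
    using hyperplane_map_surjective[OF dual_antihol_linear[OF lin] w b2 _ assms(4)]
      convex_chart_injective(2)[OF assms(1-3)] by metis
qed

section \<open>Projective invariance of the dual complex structure\<close>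

text \<open>
  The dual map is the Gauss map of projective geometry: \<open>- w\<close> is the affine coordinate, in the chart
  of the contragredient matrix, of the complex tangent hyperplane. A tangent hyperplane is determined
  by the point and the complex tangent space, so its covector is unique up to a scalar.
\<close>
lemma dual_point_invariant:
  assumes A: "dual_chart S A U \<rho>" "x \<in> U" "chart A x \<in> S" and B: "dual_chart S B V \<sigma>" "y \<in> V" "chart B y = chart A x"
    and A': "A ** A' = mat 1" "A' ** A = mat 1" and B': "B ** B' = mat 1" "B' ** B = mat 1"
  shows "chart (transpose A') (- dual_map \<rho> x) = chart (transpose B') (- dual_map \<sigma> y)"
proof -
  note a = dual_chartD[OF A(1)] and b = dual_chartD[OF B(1)]
  have yS: "chart B y \<in> S" using A(3) B(3) by simp
  let ?w = "dual_map \<rho> x" and ?v = "dual_map \<sigma> y"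
  have wx: "cdot ?w x = 1" by (rule cdot_dual_map_self[OF a(5)[OF A(2,3)]])
  have vy: "cdot ?v y = 1" by (rule cdot_dual_map_self[OF b(5)[OF B(2) yS]])
  define l where "l = transpose B' *v homog (- ?v)"
  have lB: "cdot l (B *v u) = cdot (homog (- ?v)) u" for u
    using B' by (simp add: l_def cdot_matrix matrix_vector_mul_assoc del: transpose_matrix_vector)
  define \<zeta> where "\<zeta> = transpose A *v l"
  have \<zeta>: "cdot \<zeta> u = cdot l (A *v u)" for u by (simp add: \<zeta>_def cdot_matrix del: transpose_matrix_vector)
  obtain c where c: "c \<noteq> 0" "B *v homog y = c *s (A *v homog x)"
    using B(3) unfolding chart_eq_iff[OF a(1) b(1), of x y, symmetric] eq_commute[of "chart B y"]
    using chart_eq_iff[OF a(1) b(1)] by metis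
  have "cdot l (B *v homog y) = 0" by (simp add: lB cdot_homog_homog cdot_minus_left vy)
  then have \<zeta>x: "cdot \<zeta> (homog x) = 0" using c by (simp add: \<zeta> cdot_scale_right)
  have \<zeta>H: "cdot \<zeta> (homog0 X) = 0" if X: "cdot ?w X = 0" for X
  proof -
    have H: "dchart A x X \<in> H_space S (chart A x)" using H_space_iff_cdot[OF A] X by simp
    obtain Y where Y: "dchart A x X = dchart B y Y"
      using T_space_E[OF H_space_subset_T_space[OF H] b(1) B(3)] .
    then have "cdot ?v Y = 0" using H_space_iff_cdot[OF B(1,2) yS] H B(3) by simp
    then have 0: "cdot l (B *v homog0 Y) = 0" by (simp add: lB cdot_homog_homog0 cdot_minus_left)
    obtain c m where cm: "c \<noteq> 0" "B *v homog0 Y = c *s (A *v homog0 X) + m *s (A *v homog x)"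
      using Y unfolding dchart_eq_iff[OF a(1) b(1)] by blast
    have "c * cdot \<zeta> (homog0 X) + m * cdot \<zeta> (homog x) = 0"
      using 0 unfolding cm(2) by (simp add: \<zeta> cdot_add_right cdot_scale_right)
    then show ?thesis using \<zeta>x cm(1) by simp
  qed
  define \<kappa> where "\<kappa> = \<zeta> $ None"
  have \<zeta>0: "cdot \<zeta> (homog0 x) = - \<kappa>"
    using \<zeta>x by (simp add: homog_affine cdot_add_right cdot_axis \<kappa>_def add_eq_0_iff)
  have "cdot \<zeta> (homog0 X) = - \<kappa> * cdot ?w X" for X
  proof -
    have "cdot \<zeta> (homog0 (X - cdot ?w X *s x)) = 0"
      by (rule \<zeta>H) (simp add: cdot_diff_right cdot_scale_right wx)
    moreover have "homog0 (X - cdot ?w X *s x) = homog0 X - cdot ?w X *s homog0 x" by (simp add: vec_option_eq_iff)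
    ultimately show ?thesis by (simp add: cdot_diff_right cdot_scale_right \<zeta>0 add_eq_0_iff2 mult.commute)
  qed
  then have "\<zeta> $ Some j = - \<kappa> * ?w $ j" for j
    using cdot_homog0[of \<zeta> "axis j 1"] by (simp add: cdot_axis)
  then have \<zeta>eq: "\<zeta> = \<kappa> *s homog (- ?w)" by (simp add: vec_option_eq_iff \<kappa>_def)
  have leq: "l = \<kappa> *s (transpose A' *v homog (- ?w))"
  proof -
    have "transpose A' *v \<zeta> = l"
      using A' by (simp add: \<zeta>_def matrix_vector_mul_assoc matrix_transpose_mul[symmetric] del: transpose_matrix_vector)
    then show ?thesis by (simp add: \<zeta>eq vector_scalar_commute del: transpose_matrix_vector)
  qed
  have iA: "invertible (transpose A')" and iB: "invertible (transpose B')"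
    using A' B' unfolding invertible_def by (metis matrix_transpose_mul transpose_mat)+
  have "l \<noteq> 0" using iB by (simp add: l_def invertible_mult_eq_0_iff del: transpose_matrix_vector)
  then have "\<kappa> \<noteq> 0" using leq by auto
  then show ?thesis unfolding chart_eq_iff[OF iA iB] using leq unfolding l_def by blast
qed

text \<open>
  A change of chart of the hypersurface induces a change of chart of the dual hypersurface, and the
  latter is holomorphic. This is why \<open>J\<^sup>*\<close> does not depend on the chart.
\<close>
lemma dual_derivative_transition:
  assumes A: "dual_chart S A U \<rho>" "z \<in> U" "chart A z \<in> S" and B: "dual_chart S B V \<sigma>" "y \<in> V" "chart B y = chart A z"
  obtains T T' where "\<And>X. dchart B y (T X) = dchart A z X" "inj T'" "linear T'" "\<And>\<eta>. T' (\<i> *s \<eta>) = \<i> *s T' \<eta>"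
    "\<And>X. dchart A z X \<in> T_space S (chart A z) \<Longrightarrow> fder (dual_map \<sigma>) y (T X) = T' (fder (dual_map \<rho>) z X)"
proof -
  note a = dual_chartD[OF A(1)] and b = dual_chartD[OF B(1)]
  have yS: "chart B y \<in> S" using A(3) B(3) by simp
  obtain A' where A': "A ** A' = mat 1" "A' ** A = mat 1" using a(1) by (auto simp: invertible_def)
  obtain B' where B': "B ** B' = mat 1" "B' ** B = mat 1" using b(1) by (auto simp: invertible_def)
  have iA: "invertible (transpose A')" and iB: "invertible (transpose B')"
    using A' B' unfolding invertible_def by (metis matrix_transpose_mul transpose_mat)+
  obtain W \<tau> where W: "open W" "z \<in> W" "smooth_on W \<tau>" "\<tau> z = y"
    "\<And>z. z \<in> W \<Longrightarrow> chart B (\<tau> z) = chart A z"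
    "\<And>z X. z \<in> W \<Longrightarrow> dchart B (\<tau> z) (fder \<tau> z X) = dchart A z X"
    using chart_transition[OF a(1) b(1) B(3)[symmetric]] by blast
  have eq0: "chart (transpose A') (- dual_map \<rho> z) = chart (transpose B') (- dual_map \<sigma> y)"
    by (rule dual_point_invariant[OF A B A' B'])
  obtain N \<tau>' where N: "open N" "- dual_map \<rho> z \<in> N" "smooth_on N \<tau>'" "\<tau>' (- dual_map \<rho> z) = - dual_map \<sigma> y"
    "\<And>z. z \<in> N \<Longrightarrow> chart (transpose B') (\<tau>' z) = chart (transpose A') z"
    "\<And>z X. z \<in> N \<Longrightarrow> dchart (transpose B') (\<tau>' z) (fder \<tau>' z X) = dchart (transpose A') z X"
    using chart_transition[OF iA iB eq0] by blast
  let ?T = "fder \<tau> z" and ?T' = "fder \<tau>' (- dual_map \<rho> z)"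
  have m\<rho>: "dual_map \<rho> differentiable (at z)" by (rule dual_map_differentiable[OF A])
  have m\<sigma>: "dual_map \<sigma> differentiable (at y)" by (rule dual_map_differentiable[OF B(1,2) yS])
  have l': "linear ?T'" by (rule smooth_on_linear_fder[OF N(3,2)])
  show thesis
  proof (rule that[of ?T ?T'])
    show "dchart B y (?T X) = dchart A z X" for X using W(6)[OF W(2)] W(4) by simp
    show "inj ?T'" using N(6)[OF N(2)] dchart_inject[OF iA] by (metis injI)
    show "linear ?T'" by (rule l')
    show "?T' (\<i> *s \<eta>) = \<i> *s ?T' \<eta>" for \<eta> by (rule transition_complex_linear[OF iA iB N(6)[OF N(2)]])
    fix X assume X: "dchart A z X \<in> T_space S (chart A z)"
    let ?U = "{x \<in> {x \<in> U. dual_denom \<rho> x \<noteq> 0}. dual_map \<rho> x \<in> uminus ` N} \<inter> {x \<in> W. \<tau> x \<in> V}"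
    have "open (uminus ` N)" using open_negations[OF N(1)] .
    then have oU: "open ?U"
      by (intro open_Int open_Int_preimage open_dual_domain smooth_on_dual_map a(3,4) W(1,3) b(3))
    have zU: "z \<in> ?U" using A(2) a(5)[OF A(2,3)] N(2) W(2,4) B(2) by (auto intro: image_eqI[of _ _ "- dual_map \<rho> z"])
    have "((\<lambda>x. - dual_map \<rho> x) has_derivative (\<lambda>X. - fder (dual_map \<rho>) z X)) (at z)"
      by (intro has_derivative_minus has_derivative_fder m\<rho>)
    then have nd: "(\<lambda>x. - dual_map \<rho> x) differentiable (at z)" "fder (\<lambda>x. - dual_map \<rho> x) z = (\<lambda>X. - fder (dual_map \<rho>) z X)"
      by (auto simp: differentiable_def fder_eq)
    have ms: "((\<lambda>x. - dual_map \<sigma> x) has_derivative (\<lambda>X. - fder (dual_map \<sigma>) y X)) (at y)"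
      by (intro has_derivative_minus has_derivative_fder m\<sigma>)
    then have nd2: "(\<lambda>x. - dual_map \<sigma> x) differentiable (at (\<tau> z))" "fder (\<lambda>x. - dual_map \<sigma> x) (\<tau> z) = (\<lambda>X. - fder (dual_map \<sigma>) y X)"
      using W(4) by (auto simp: differentiable_def fder_eq)
    have d\<tau>: "\<tau> differentiable (at z)" by (rule smooth_on_differentiable[OF W(3,2)])
    have d\<tau>': "\<tau>' differentiable (at (- dual_map \<rho> z))" by (rule smooth_on_differentiable[OF N(3,2)])
    have "fder (\<lambda>x. \<tau>' (- dual_map \<rho> x)) z X = fder (\<lambda>x. - dual_map \<sigma> (\<tau> x)) z X"
    proof (rule tangent_derivative_unique[OF a(2) A(2) _ _ oU zU])
      show "z \<in> chart A -` S" using A(3) by simp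
      show "fder \<rho> z X = 0" using T_space_iff[OF a(1) A(2) a(2) A(3)] X by simp
      show "(\<lambda>x. \<tau>' (- dual_map \<rho> x)) differentiable (at z)"
        using differentiable_chain_at[OF nd(1) d\<tau>'] by (simp add: o_def)
      show "(\<lambda>x. - dual_map \<sigma> (\<tau> x)) differentiable (at z)"
        using differentiable_chain_at[OF d\<tau> nd2(1)] by (simp add: o_def)
      fix x assume x: "x \<in> ?U" "x \<in> chart A -` S"
      have xN: "- dual_map \<rho> x \<in> N" using x by auto
      have "chart (transpose A') (- dual_map \<rho> x) = chart (transpose B') (- dual_map \<sigma> (\<tau> x))"
        by (rule dual_point_invariant[OF A(1) _ _ B(1) _ _ A' B']) (use x W(5) in auto)
      then have "chart (transpose B') (\<tau>' (- dual_map \<rho> x)) = chart (transpose B') (- dual_map \<sigma> (\<tau> x))"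
        using N(5)[OF xN] by simp
      then show "\<tau>' (- dual_map \<rho> x) = - dual_map \<sigma> (\<tau> x)" using chart_inject[OF iB] by blast
    qed
    also have "fder (\<lambda>x. \<tau>' (- dual_map \<rho> x)) z X = ?T' (- fder (dual_map \<rho>) z X)"
      using fder_compose[of \<tau>' "\<lambda>x. - dual_map \<rho> x" z X] d\<tau>' nd by simp
    also have "fder (\<lambda>x. - dual_map \<sigma> (\<tau> x)) z X = - fder (dual_map \<sigma>) y (?T X)"
      using fder_compose[OF nd2(1) d\<tau>, of X] nd2(2) by simp
    finally show "fder (dual_map \<sigma>) y (?T X) = ?T' (fder (dual_map \<rho>) z X)"
      using linear_neg[OF l'] by simp
  qed
qed

text \<open>
  The value of \<open>dual_J\<close> can be computed in a single convex chart. In every other chart the differential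
  of the dual map is the one in the given chart followed by a complex linear injection.
\<close>
lemma dual_J_eq:
  assumes A: "convex_chart S A U \<rho>" "z \<in> U" "chart A z \<in> S"
    and X: "cdot (dual_map \<rho> z) X = 0" "cdot (dual_map \<rho> z) X' = 0"
    and X': "fder (dual_map \<rho>) z X' = \<i> *s fder (dual_map \<rho>) z X"
  shows "dual_J S (dchart A z X) = dchart A z X'"
proof -
  have gc: "dual_chart S A U \<rho>" using A(1) by (simp add: convex_chart_def)
  note a = dual_chartD[OF gc]
  note HA = H_space_iff_cdot[OF gc A(2,3)]
  note lin = dual_map_differentiable(2)[OF gc A(2,3)]
  have injA: "Y1 = Y2" if "cdot (dual_map \<rho> z) Y1 = 0" "cdot (dual_map \<rho> z) Y2 = 0"
    "fder (dual_map \<rho>) z Y1 = fder (dual_map \<rho>) z Y2" for Y1 Y2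
    using convex_chart_injective(1)[OF A, of "Y1 - Y2"] that by (simp add: cdot_diff_right linear_diff[OF lin])
  have val: "dchart B y (the_inv_into {Y. dchart B y Y \<in> H_space S (chart B y)} (fder (dual_map \<sigma>) y)
      (\<i> *s fder (dual_map \<sigma>) y Y)) = dchart A z X'"
    if B: "dual_chart S B V \<sigma>" "y \<in> V" "chart B y \<in> S" and Y: "dchart A z X = dchart B y Y" for B y Y V \<sigma>
  proof -
    note b = dual_chartD[OF B(1)]
    have base: "chart B y = chart A z" using dchart_base[OF a(1) b(1) Y] by simp
    obtain T T' where T: "\<And>X. dchart B y (T X) = dchart A z X" "inj T'" "\<And>\<eta>. T' (\<i> *s \<eta>) = \<i> *s T' \<eta>"
      "\<And>X. dchart A z X \<in> T_space S (chart A z) \<Longrightarrow> fder (dual_map \<sigma>) y (T X) = T' (fder (dual_map \<rho>) z X)"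
      using dual_derivative_transition[OF gc A(2,3) B(1,2) base] by metis
    have TH: "fder (dual_map \<sigma>) y (T X) = T' (fder (dual_map \<rho>) z X)" if "cdot (dual_map \<rho> z) X = 0" for X
      using T(4) HA that H_space_subset_T_space by blast
    have HB: "\<exists>X. Y = T X \<and> cdot (dual_map \<rho> z) X = 0" if Y: "dchart B y Y \<in> H_space S (chart B y)" for Y
    proof -
      obtain X where "dchart B y Y = dchart A z X"
        using T_space_E[OF H_space_subset_T_space[OF Y] a(1) base[symmetric]] .
      then show ?thesis using T(1) dchart_inject[OF b(1)] HA Y base by metis
    qed
    let ?H = "{Y. dchart B y Y \<in> H_space S (chart B y)}"
    have inj: "inj_on (fder (dual_map \<sigma>) y) ?H"
    proof (rule inj_onI)
      fix Y1 Y2 assume "Y1 \<in> ?H" "Y2 \<in> ?H" and eq: "fder (dual_map \<sigma>) y Y1 = fder (dual_map \<sigma>) y Y2"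
      then obtain X1 X2 where X12: "Y1 = T X1" "cdot (dual_map \<rho> z) X1 = 0" "Y2 = T X2" "cdot (dual_map \<rho> z) X2 = 0"
        using HB by blast
      then have "T' (fder (dual_map \<rho>) z X1) = T' (fder (dual_map \<rho>) z X2)" using eq TH by simp
      then show "Y1 = Y2" using injA X12 T(2) by (metis injD)
    qed
    have YT: "Y = T X" using T(1) Y dchart_inject[OF b(1)] by metis
    have "fder (dual_map \<sigma>) y (T X') = \<i> *s fder (dual_map \<sigma>) y Y"
      unfolding YT TH[OF X(1)] TH[OF X(2)] X' T(3) by simp
    moreover have "T X' \<in> ?H" using T(1) HA X(2) base by simp
    ultimately have "the_inv_into ?H (fder (dual_map \<sigma>) y) (\<i> *s fder (dual_map \<sigma>) y Y) = T X'"
      using the_inv_into_f_eq[OF inj] by blast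
    then show ?thesis using T(1) by simp
  qed
  show ?thesis
    unfolding dual_J_def Let_def
  proof (rule the_equality)
    show "\<exists>B y Y V \<sigma>. invertible B \<and> chart B y \<in> S \<and> y \<in> V \<and> defining_function (chart B -` S) V \<sigma> \<and>
      (\<forall>y\<in>V. chart B y \<in> S \<longrightarrow> dual_denom \<sigma> y \<noteq> 0) \<and> dchart A z X = dchart B y Y \<and>
      dchart A z X' = dchart B y (the_inv_into {Y. dchart B y Y \<in> H_space S (chart B y)} (fder (dual_map \<sigma>) y)
      (\<i> *s fder (dual_map \<sigma>) y Y))"
      using val[OF gc A(2,3) refl] gc A(2,3) unfolding dual_chart_def by metis
  next
    fix \<eta> assume "\<exists>B y Y V \<sigma>. invertible B \<and> chart B y \<in> S \<and> y \<in> V \<and> defining_function (chart B -` S) V \<sigma> \<and>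
      (\<forall>y\<in>V. chart B y \<in> S \<longrightarrow> dual_denom \<sigma> y \<noteq> 0) \<and> dchart A z X = dchart B y Y \<and>
      \<eta> = dchart B y (the_inv_into {Y. dchart B y Y \<in> H_space S (chart B y)} (fder (dual_map \<sigma>) y)
      (\<i> *s fder (dual_map \<sigma>) y Y))"
    then show "\<eta> = dchart A z X'" using val unfolding dual_chart_def by metis
  qed
qed

section \<open>Strongly convex charts\<close>

text \<open>
  Normalising the gradient changes its derivative by a multiple of the gradient, which is orthogonal to
  tangent vectors, and by a positive factor.
\<close>
lemma definite_at_hess:
  fixes \<rho> :: "complex^('n::finite) \<Rightarrow> real"
  assumes U: "open U" and s: "smooth_on U \<rho>" and z: "z \<in> U" and d: "definite_at \<rho> z" and nz: "fder \<rho> z N \<noteq> 0"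
  shows "\<exists>s. \<forall>X. X \<noteq> 0 \<longrightarrow> fder \<rho> z X = 0 \<longrightarrow> s * hess \<rho> z X X > 0"
proof -
  let ?g = "gradient \<rho>"
  have gX: "?g y \<bullet> X = fder \<rho> y X" if "y \<in> U" for y X
  proof -
    have "fder \<rho> y X = (\<Sum>b\<in>Basis. (X \<bullet> b) *\<^sub>R fder \<rho> y b)"
      by (rule linear_basis_sum[OF smooth_on_linear_fder[OF s that]])
    then show ?thesis unfolding gradient_def inner_sum_left
      by (simp only: inner_scaleR_left real_scaleR_def) (simp add: inner_commute mult.commute)
  qed
  have gs: "smooth_on U ?g" unfolding gradient_def[abs_def] by (intro smooth_intros U s)
  have gd: "?g differentiable (at z)" by (rule smooth_on_differentiable[OF gs z])
  have g0: "?g z \<noteq> 0" using gX[OF z, of N] nz by auto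
  have nd: "(\<lambda>y. inverse (norm (?g y))) differentiable (at z)"
  proof -
    have "((\<lambda>y. norm (?g y)) has_derivative (\<lambda>X. fder ?g z X \<bullet> sgn (?g z))) (at z)"
      using diff_chain_at[OF has_derivative_fder[OF gd] has_derivative_norm[OF g0]] by (simp add: o_def inner_commute)
    then show ?thesis using g0 by (intro differentiable_inverse) (auto simp: differentiable_def)
  qed
  have sff: "second_fundamental_form \<rho> z X X = - inverse (norm (?g z)) * hess \<rho> z X X" if X: "fder \<rho> z X = 0" for X
  proof -
    have "fder (\<lambda>y. sgn (?g y)) z X = inverse (norm (?g z)) *\<^sub>R fder ?g z X + fder (\<lambda>y. inverse (norm (?g y))) z X *\<^sub>R ?g z"
      unfolding sgn_div_norm divide_inverse using fder_bilinear[OF bounded_bilinear_scaleR nd gd] by simp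
    then have "fder (\<lambda>y. sgn (?g y)) z X \<bullet> X = inverse (norm (?g z)) * (fder ?g z X \<bullet> X)"
      using gX[OF z, of X] X by (simp add: inner_add_left)
    also have "fder ?g z X \<bullet> X = fder (\<lambda>y. ?g y \<bullet> X) z X"
      by (rule fder_bounded_linear_compose[OF bounded_linear_inner_left gd, symmetric])
    also have "frechet_derivative (\<lambda>y. ?g y \<bullet> X) (at z) = fder (\<lambda>y. fder \<rho> y X) z"
      by (rule frechet_derivative_cong_open[OF U z gX])
    finally show ?thesis by (simp add: second_fundamental_form_def)
  qed
  show ?thesis
  proof (cases "\<forall>X. fder \<rho> z X = 0 \<and> X \<noteq> 0 \<longrightarrow> second_fundamental_form \<rho> z X X > 0")
    case True
    then show ?thesis using sff by (intro exI[of _ "- inverse (norm (?g z))"]) auto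
  next
    case False
    then have "\<forall>X. fder \<rho> z X = 0 \<and> X \<noteq> 0 \<longrightarrow> second_fundamental_form \<rho> z X X < 0"
      using d by (auto simp: definite_at_def)
    then show ?thesis using sff by (intro exI[of _ "inverse (norm (?g z))"]) force
  qed
qed

text \<open>
  The affine translation by \<open>c\<close>, which is \<open>(t, v) \<mapsto> (t, v + t c)\<close> in homogeneous coordinates.
\<close>
definition translation :: "complex^('n::finite) \<Rightarrow> complex^('n option)^('n option)" where
  "translation c = (\<chi> i j. (if j = i then 1 else 0) + (if j = None then homog0 c $ i else 0))"

lemma translation_mult: "translation c *v v = v + v $ None *s homog0 c"
proof -
  have "(translation c *v v) $ i = (\<Sum>j\<in>UNIV. (if j = i then v $ j else 0) + (if j = None then homog0 c $ i * v $ j else 0))" for i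
    unfolding translation_def matrix_vector_mult_def by (auto intro!: sum.cong simp: distrib_right)
  then show ?thesis by (simp add: vec_eq_iff sum.distrib mult.commute)
qed

lemma translation_homog: "translation c *v homog z = homog (z + c)" "translation c *v homog0 X = homog0 X"
  by (simp_all add: translation_mult vec_option_eq_iff)

lemma invertible_translation: "invertible (translation c)"
proof -
  have "translation c ** translation (- c) = mat 1" for c :: "complex^'a"
    unfolding matrix_eq
    by (simp add: matrix_vector_mul_assoc[symmetric] translation_mult vec_option_eq_iff)
  from this[of c] this[of "- c"] show ?thesis unfolding invertible_def by auto
qed

lemma has_derivative_translate:
  "((\<lambda>y. f (y + c)) has_derivative f') (at z) \<longleftrightarrow> (f has_derivative f') (at (z + c))"
proof
  have t: "((\<lambda>y. y + a) has_derivative (\<lambda>X. X)) (at z)" for a z :: 'a by (auto intro!: derivative_eq_intros)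
  show "((\<lambda>y. f (y + c)) has_derivative f') (at z)" if "(f has_derivative f') (at (z + c))"
    using diff_chain_at[OF t that] by (simp add: o_def)
  show "(f has_derivative f') (at (z + c))" if a: "((\<lambda>y. f (y + c)) has_derivative f') (at z)"
  proof -
    have "((\<lambda>y. f (y + c)) has_derivative f') (at (z + c + - c))" using a by simp
    from diff_chain_at[OF t this] show ?thesis by (simp add: o_def)
  qed
qed

lemma frechet_derivative_translate:
  "frechet_derivative (\<lambda>y. f (y + c)) (at z) = frechet_derivative f (at (z + c))"
  unfolding frechet_derivative_def has_derivative_translate ..

text \<open>
  Strong convexity and the existence of the dual map are asked for in possibly different charts. An
  affine translation preserves the former and moves the origin off the complex tangent hyperplane.
\<close>
theorem convex_chart_exists:
  assumes "strongly_C_convex S" "p \<in> S"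
  obtains A z U \<rho> where "chart A z = p" "z \<in> U" "convex_chart S A U \<rho>"
proof -
  obtain A z0 U \<rho> where A: "invertible A" "chart A z0 = p" "z0 \<in> U" "defining_function (chart A -` S) U \<rho>"
    "\<And>y. y \<in> U \<Longrightarrow> chart A y \<in> S \<Longrightarrow> definite_at \<rho> y"
    using assms unfolding strongly_C_convex_def by metis
  note D = defining_functionD[OF A(4)]
  let ?w = "\<chi> j. wirtinger \<rho> z0 j"
  \<comment> \<open>with the conjugate gradient as new coordinates of the point, the denominator is \<open>\<Sum> \<bar>w\<^sub>j\<bar>\<^sup>2\<close>\<close>
  define b where "b = (\<chi> j. cnj (?w $ j))"
  define c where "c = z0 - b"
  let ?A = "A ** translation c"
  let ?\<rho> = "\<lambda>z. \<rho> (z + c)"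
  have ch: "chart ?A z = chart A (z + c)" for z
    by (simp add: chart_homog matrix_vector_mul_assoc[symmetric] translation_homog)
  have iA: "invertible ?A" by (rule invertible_mult[OF A(1) invertible_translation])
  let ?U = "{z. z + c \<in> U}"
  have oU: "open ?U"
    using open_vimage[OF D(1), of "\<lambda>z. z + c"] by (simp add: vimage_def continuous_intros)
  have sm: "smooth_on ?U ?\<rho>"
    by (rule smooth_on_compose[OF oU D(1) _ D(2)]) (auto intro!: smooth_intros oU)
  have fd: "frechet_derivative ?\<rho> (at z) = fder \<rho> (z + c)" for z by (rule frechet_derivative_translate)
  have def': "defining_function (chart ?A -` S) ?U ?\<rho>"
    unfolding defining_function_def fd
    using oU sm D(3) A(4) by (auto simp: ch defining_function_def)
  have "dual_denom ?\<rho> b \<noteq> 0"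
  proof
    assume "dual_denom ?\<rho> b = 0"
    moreover have "b + c = z0" by (simp add: c_def)
    ultimately have "cdot ?w b = 0" by (simp add: dual_denom_cdot wirtinger_def fd)
    then have "(\<Sum>j\<in>UNIV. complex_of_real ((cmod (?w $ j))\<^sup>2)) = 0"
      by (simp add: cdot_def b_def complex_norm_square[symmetric])
    then have "complex_of_real (\<Sum>j\<in>UNIV. (cmod (?w $ j))\<^sup>2) = 0" by simp
    then have "(\<Sum>j\<in>UNIV. (cmod (?w $ j))\<^sup>2) = 0" by (simp only: of_real_eq_0_iff)
    then have "\<forall>j\<in>UNIV. (cmod (?w $ j))\<^sup>2 = 0" by (subst (asm) sum_nonneg_eq_0_iff) auto
    then have w0: "?w = 0" by (simp add: vec_eq_iff)
    obtain N where N: "fder \<rho> z0 N \<noteq> 0" using D(4)[OF A(3)] A(2) assms(2) by auto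
    have "complex_of_real (fder \<rho> z0 N) - \<i> * complex_of_real (fder \<rho> z0 (\<i> *s N)) = 0"
      using wirtinger_cdot[OF smooth_on_linear_fder[OF D(2) A(3)], of N] unfolding w0 by simp
    then show False using N by (simp add: complex_eq_iff)
  qed
  moreover have bU: "b \<in> ?U" using A(3) by (simp add: c_def)
  let ?V = "{z \<in> ?U. dual_denom ?\<rho> z \<noteq> 0}"
  have oV: "open ?V" by (rule open_dual_domain[OF oU sm])
  have "convex_chart S ?A ?V ?\<rho>"
    unfolding convex_chart_def dual_chart_def
  proof (intro conjI ballI impI)
    show "defining_function (chart ?A -` S) ?V ?\<rho>" by (rule defining_function_subset[OF def' oV]) auto
    fix y assume y: "y \<in> ?V" "chart ?A y \<in> S"
    then have yU: "y + c \<in> U" "chart A (y + c) \<in> S" by (auto simp: ch)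
    obtain N where N: "fder \<rho> (y + c) N \<noteq> 0" using D(4)[OF yU(1)] yU(2) by auto
    have "hess ?\<rho> y X X = hess \<rho> (y + c) X X" for X
      unfolding fd by (simp add: frechet_derivative_translate[of "\<lambda>y. fder \<rho> y X" c y])
    then show "\<exists>s. \<forall>X. X \<noteq> 0 \<longrightarrow> fder ?\<rho> y X = 0 \<longrightarrow> s * hess ?\<rho> y X X > 0"
      using definite_at_hess[OF D(1,2) yU(1) A(5)[OF yU] N] unfolding fd by simp
  qed (use iA in auto)
  moreover have "chart ?A b = p" unfolding ch using A(2) by (simp add: c_def)
  ultimately show thesis using that[of ?A b ?V ?\<rho>] bU by blast
qed

section \<open>The splitting of the differential\<close>

lemma antilinear_expansion:
  fixes M :: "complex^'n \<Rightarrow> complex^'m"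
  assumes "linear M" "\<And>X. M (\<i> *s X) = - (\<i> *s M X)"
  shows "M X = (\<Sum>k\<in>UNIV. cnj (X $ k) *s M (axis k 1))"
proof -
  have i: "axis k \<i> = \<i> *s (axis k 1 :: complex^'n)" for k by (simp add: vec_eq_iff axis_def)
  have "M X = (\<Sum>k\<in>UNIV. Re (X $ k) *\<^sub>R M (axis k 1) + Im (X $ k) *\<^sub>R M (axis k \<i>))"
    by (subst complex_vec_real_basis) (simp add: linear_sum[OF assms(1)] linear_add[OF assms(1)] linear_cmul[OF assms(1)])
  also have "\<dots> = (\<Sum>k\<in>UNIV. cnj (X $ k) *s M (axis k 1))"
    unfolding i assms(2) by (intro sum.cong refl) (simp add: vec_eq_iff complex_eq_iff)
  finally show ?thesis .
qed

lemma antilinear_expansion_scalar: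
  fixes \<psi> :: "complex^'n \<Rightarrow> complex"
  assumes "linear \<psi>" "\<And>X. \<psi> (\<i> *s X) = - (\<i> * \<psi> X)"
  shows "\<psi> X = (\<Sum>k\<in>UNIV. cnj (X $ k) * \<psi> (axis k 1))"
proof -
  have i: "axis k \<i> = \<i> *s (axis k 1 :: complex^'n)" for k by (simp add: vec_eq_iff axis_def)
  have "\<psi> X = (\<Sum>k\<in>UNIV. Re (X $ k) *\<^sub>R \<psi> (axis k 1) + Im (X $ k) *\<^sub>R \<psi> (axis k \<i>))"
    by (subst complex_vec_real_basis) (simp add: linear_sum[OF assms(1)] linear_add[OF assms(1)] linear_cmul[OF assms(1)])
  also have "\<dots> = (\<Sum>k\<in>UNIV. cnj (X $ k) * \<psi> (axis k 1))"
    unfolding i assms(2) by (intro sum.cong refl) (simp add: complex_eq_iff)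
  finally show ?thesis .
qed

lemma smooth_on_det:
  fixes M :: "'a::euclidean_space \<Rightarrow> complex^('n::finite)^'n"
  assumes "open U" "\<And>i j. smooth_on U (\<lambda>z. M z $ i $ j)"
  shows "smooth_on U (\<lambda>z. det (M z))"
  unfolding det_def by (intro smooth_intros assms)

lemma cdot_sum_left: "cdot (\<Sum>k\<in>I. f k) v = (\<Sum>k\<in>I. cdot (f k) v)"
  by (induction I rule: infinite_finite_induct) (simp_all add: cdot_add_left)

lemma cdot_nondegenerate: "(\<And>v. cdot v b = 0) \<Longrightarrow> b = 0"
  by (simp add: vec_eq_iff) (metis cdot_axis cdot_commute mult.right_neutral)

text \<open>
  The key to the splitting. A form \<open>b \<cdot> dw\<close> can be subtracted from \<open>dF\<close>, with coefficients \<open>b\<close> that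
  depend smoothly on the point, so that the rest is linear for the standard complex structure on
  complex tangent vectors. This is a linear system whose coefficients are given by the antiholomorphic
  part of the differential of the dual map; it is solved by Cramer's rule, which yields smoothness.
\<close>
lemma dual_coefficients_exist:
  assumes A: "convex_chart S A U \<rho>" "z0 \<in> U" "chart A z0 \<in> S" and F: "smooth_on U F"
  obtains V b where "open V" "z0 \<in> V" "V \<subseteq> U" "V \<subseteq> {z \<in> U. dual_denom \<rho> z \<noteq> 0}" "smooth_on V b"
    "\<forall>z\<in>V. \<forall>X. cdot (dual_map \<rho> z) X = 0 \<longrightarrow>
      cdot (dual_antihol \<rho> z X) (b z) = fder F z (\<i> *s X) - \<i> * fder F z X"
proof -
  have gc: "dual_chart S A U \<rho>" using A(1) by (simp add: convex_chart_def)
  note g = dual_chartD[OF gc]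
  let ?U = "{z \<in> U. dual_denom \<rho> z \<noteq> 0}"
  have oU: "open ?U" by (rule open_dual_domain[OF g(3,4)])
  have ws: "smooth_on ?U (dual_map \<rho>)" by (rule smooth_on_dual_map[OF g(3,4)])
  have Fs: "smooth_on ?U F" by (rule smooth_on_subset[OF F]) auto
  \<comment> \<open>the projection to the complex tangent space along \<open>z\<close>; \<open>M\<close> extends the system to a square one that is still uniquely solvable\<close>
  define P where "P = (\<lambda>z X. X - cdot (dual_map \<rho> z) X *s z)"
  define M where "M = (\<lambda>z X. dual_antihol \<rho> z (P z X) + cnj (cdot (dual_map \<rho> z) X) *s dual_map \<rho> z)"
  define \<psi> where "\<psi> = (\<lambda>z X. fder F z (\<i> *s X) - \<i> * fder F z X)"
  have bl_s: "bounded_bilinear (\<lambda>c (v::complex^'a). c *s v)"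
  proof -
    have "bilinear (\<lambda>c (v::complex^'a). c *s v)"
      unfolding bilinear_def by (auto intro!: linearI simp: vec_eq_iff algebra_simps)
    then show ?thesis by (simp add: bilinear_conv_bounded_bilinear)
  qed
  have bl_i: "bounded_linear (\<lambda>v::complex^'a. \<i> *s v)"
    by (rule bounded_bilinear.bounded_linear_right[OF bl_s])
  have Ps: "smooth_on ?U (\<lambda>z. P z X)" for X unfolding P_def
    by (intro smooth_on_diff smooth_on_const smooth_on_bilinear[OF bl_s] smooth_on_bilinear[OF bounded_bilinear_cdot] ws smooth_on_ident oU)
  have Ws: "smooth_on ?U h \<Longrightarrow> smooth_on ?U (\<lambda>z. fder (dual_map \<rho>) z (h z))" for h
    using smooth_on_fder_at[OF oU oU _ ws smooth_on_ident[OF oU]] by blast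
  have Fds: "smooth_on ?U h \<Longrightarrow> smooth_on ?U (\<lambda>z. fder F z (h z))" for h
    using smooth_on_fder_at[OF oU oU _ Fs smooth_on_ident[OF oU]] by blast
  have Qs: "smooth_on ?U h \<Longrightarrow> smooth_on ?U (\<lambda>z. dual_antihol \<rho> z (h z))" for h
    unfolding dual_antihol_def by (intro smooth_on_diff smooth_on_bounded_linear_compose[OF bl_i] Ws oU)
  have Ms: "smooth_on ?U (\<lambda>z. M z X)" for X unfolding M_def
    by (intro smooth_on_add Qs Ps smooth_on_bilinear[OF bl_s] smooth_on_bounded_linear_compose[OF bounded_linear_cnj]
        smooth_on_bilinear[OF bounded_bilinear_cdot] ws smooth_on_const oU)
  have \<psi>s: "smooth_on ?U (\<lambda>z. \<psi> z (P z X))" for X unfolding \<psi>_def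
    by (intro smooth_on_diff smooth_on_mult smooth_on_const Fds smooth_on_bounded_linear_compose[OF bl_i] Ps oU)
  define G where "G = (\<lambda>z. \<chi> k j. M z (axis k 1) $ j)"
  define r where "r = (\<lambda>z. \<chi> k. \<psi> z (P z (axis k 1)))"
  have Gs: "smooth_on ?U (\<lambda>z. G z $ k $ j)" for k j unfolding G_def by (simp add: smooth_on_vec_nth[OF oU Ms])
  have rs: "smooth_on ?U (\<lambda>z. r z $ k)" for k unfolding r_def by (simp add: \<psi>s)
  let ?V = "{z \<in> ?U. det (G z) \<noteq> 0}"
  have oV: "open ?V"
    using open_Int_preimage[OF oU _ smooth_on_det[OF oU Gs], of "- {0}"] by (simp add: open_Compl)
  define b where "b = (\<lambda>z. \<chi> k. det (\<chi> i j. if j = k then r z $ i else G z $ i $ j) / det (G z))"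
  have Gr: "smooth_on ?U (\<lambda>z. (\<chi> i j. if j = k then r z $ i else G z $ i $ j) $ i $ j)" for i j k
    using rs[of i] Gs[of i j] by (cases "j = k") simp_all
  have bs: "smooth_on ?V b" unfolding b_def
    by (intro smooth_on_vec_lambda smooth_on_divide smooth_on_subset[OF smooth_on_det[OF oU Gr]]
        smooth_on_subset[OF smooth_on_det[OF oU Gs]] oV) auto
  have solve: "G z *v b z = r z" if "z \<in> ?V" for z
    using cramer[of "G z" "b z" "r z"] that by (simp add: b_def)
  have lins: "linear (fder (dual_map \<rho>) z)" "linear (fder F z)" if "z \<in> ?U" for z
    using smooth_on_linear_fder[OF ws that] smooth_on_linear_fder[OF Fs that] by auto
  have linQ: "linear (dual_antihol \<rho> z)" if "z \<in> ?U" for z by (rule dual_antihol_linear[OF lins(1)[OF that]])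
  have Pi: "P z (\<i> *s X) = \<i> *s P z X" for z X
    by (simp add: P_def cdot_scale_right vec_eq_iff algebra_simps)
  have Plin: "linear (P z)" for z unfolding P_def
    by (rule linearI) (simp_all add: cdot_add_right cdot_scaleR_right vec_eq_iff algebra_simps)
  have Qi: "dual_antihol \<rho> z (\<i> *s X) = - (\<i> *s dual_antihol \<rho> z X)" if "z \<in> ?U" for z X
    using linear_neg[OF lins(1)[OF that], of X]
    by (simp add: dual_antihol_def i_smult_i_smult vec_eq_iff algebra_simps)
  have Mlin: "linear (M z)" if "z \<in> ?U" for z
  proof -
    have "linear (\<lambda>X. cnj (cdot (dual_map \<rho> z) X) *s dual_map \<rho> z)"
      by (rule linearI) (simp_all add: cdot_add_right cdot_scaleR_right vec_eq_iff algebra_simps)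
    then show ?thesis unfolding M_def
      using linear_compose_add[OF linear_compose[OF Plin linQ[OF that]]] by (simp add: o_def)
  qed
  have Mi: "M z (\<i> *s X) = - (\<i> *s M z X)" if "z \<in> ?U" for z X
    unfolding M_def Pi Qi[OF that] by (simp add: cdot_scale_right vec_eq_iff algebra_simps)
  have \<psi>lin: "linear (\<lambda>X. \<psi> z (P z X))" if "z \<in> ?U" for z
  proof -
    have "linear (\<psi> z)" unfolding \<psi>_def
      by (rule linearI) (simp_all add: linear_add[OF lins(2)[OF that]] linear_cmul[OF lins(2)[OF that]]
          linear_add[OF linear_i_smult] linear_cmul[OF linear_i_smult] algebra_simps)
    then show ?thesis using linear_compose[OF Plin] by (simp add: o_def)
  qed
  have \<psi>i: "\<psi> z (P z (\<i> *s X)) = - (\<i> * \<psi> z (P z X))" if "z \<in> ?U" for z X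
    unfolding Pi \<psi>_def i_smult_i_smult using linear_neg[OF lins(2)[OF that], of "P z X"] by (simp add: algebra_simps)
  have Gk: "(G z *v v) $ k = cdot (M z (axis k 1)) v" for z v k
    by (simp add: G_def matrix_vector_mult_def cdot_def)
  have main: "cdot (dual_antihol \<rho> z X) (b z) = fder F z (\<i> *s X) - \<i> * fder F z X"
    if z: "z \<in> ?V" and X: "cdot (dual_map \<rho> z) X = 0" for z X
  proof -
    have zU: "z \<in> ?U" using z by simp
    have "cdot (dual_antihol \<rho> z X) (b z) = cdot (M z X) (b z)" using X by (simp add: M_def P_def)
    also have "\<dots> = (\<Sum>k\<in>UNIV. cnj (X $ k) * cdot (M z (axis k 1)) (b z))"
      by (subst antilinear_expansion[OF Mlin[OF zU] Mi[OF zU]]) (simp add: cdot_sum_left cdot_scale_left)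
    also have "\<dots> = (\<Sum>k\<in>UNIV. cnj (X $ k) * \<psi> z (P z (axis k 1)))"
      unfolding Gk[symmetric] solve[OF z] by (simp add: r_def)
    also have "\<dots> = \<psi> z (P z X)"
      by (rule antilinear_expansion_scalar[OF \<psi>lin[OF zU] \<psi>i[OF zU], symmetric])
    also have "\<dots> = fder F z (\<i> *s X) - \<i> * fder F z X" using X by (simp add: P_def \<psi>_def)
    finally show ?thesis .
  qed
  have z0U: "z0 \<in> ?U" using A g(5) by simp
  have wz: "cdot (dual_map \<rho> z0) z0 = 1" by (rule cdot_dual_map_self) (use z0U in simp)
  have "det (G z0) \<noteq> 0"
  proof
    assume "det (G z0) = 0"
    then have "\<not> invertible (G z0)" by (simp add: invertible_det_nz)
    then obtain v where v: "v \<noteq> 0" "G z0 *v v = 0"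
      unfolding invertible_left_inverse matrix_left_invertible_ker by blast
    have Mv: "cdot (M z0 X) v = 0" for X
      using v(2) by (subst antilinear_expansion[OF Mlin[OF z0U] Mi[OF z0U]])
        (simp add: cdot_sum_left cdot_scale_left Gk[symmetric])
    have Qv: "cdot \<eta> v = 0" if \<eta>: "cdot \<eta> z0 = 0" for \<eta>
    proof -
      obtain X where "cdot (dual_map \<rho> z0) X = 0" "dual_antihol \<rho> z0 X = \<eta>"
        using convex_chart_surjective(2)[OF A \<eta>] by blast
      then have "M z0 X = \<eta>" by (simp add: M_def P_def)
      then show ?thesis using Mv[of X] by simp
    qed
    have wv: "cdot (dual_map \<rho> z0) v = 0"
    proof -
      have "P z0 z0 = 0" using wz by (simp add: P_def)
      then have "M z0 z0 = dual_map \<rho> z0" using wz linear_0[OF linQ[OF z0U]] by (simp add: M_def)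
      then show ?thesis using Mv[of z0] by simp
    qed
    have "cdot \<eta> v = 0" for \<eta>
    proof -
      have "cdot (\<eta> - cdot \<eta> z0 *s dual_map \<rho> z0) v = 0"
        by (rule Qv) (simp add: cdot_diff_left cdot_scale_left wz)
      then show ?thesis by (simp add: cdot_diff_left cdot_scale_left wv)
    qed
    then show False using cdot_nondegenerate v(1) by blast
  qed
  then have "z0 \<in> ?V" using z0U by simp
  then show thesis using that[OF oV _ _ _ bs] main by blast
qed

lemma H_space_E:
  assumes "\<xi> \<in> H_space S p" "invertible A" "chart A z = p"
  obtains X where "\<xi> = dchart A z X"
  using T_space_E[OF H_space_subset_T_space[OF assms(1)] assms(2,3)] .

lemma tangent_J_in_H_space:
  assumes S: "real_hypersurface S" and p: "p \<in> S" and \<xi>: "\<xi> \<in> H_space S p"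
  shows "tangent_J \<xi> \<in> H_space S p"
proof -
  obtain A z U \<rho> where A: "invertible A" "chart A z = p" "z \<in> U" "defining_function (chart A -` S) U \<rho>"
    using S p unfolding real_hypersurface_def by blast
  obtain X where X: "\<xi> = dchart A z X" using H_space_E[OF \<xi> A(1,2)] .
  have zS: "chart A z \<in> S" using A(2) p by simp
  note H = H_space_iff[OF A(1,3,4) zS]
  have lin: "linear (fder \<rho> z)" using smooth_on_linear_fder[OF defining_functionD(2)[OF A(4)] A(3)] .
  have "fder \<rho> z X = 0 \<and> fder \<rho> z (\<i> *s X) = 0" using H[of X] \<xi> X A(2) by simp
  then have "dchart A z (\<i> *s X) \<in> H_space S p" using H[of "\<i> *s X"] A(2) linear_neg[OF lin] by (simp add: i_smult_i_smult)
  then show ?thesis by (simp add: X tangent_J_dchart[OF A(1)])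
qed

lemma dual_J_exists:
  assumes A: "convex_chart S A U \<rho>" "z \<in> U" "chart A z \<in> S" and X: "cdot (dual_map \<rho> z) X = 0"
  obtains X' where "cdot (dual_map \<rho> z) X' = 0" "fder (dual_map \<rho>) z X' = \<i> *s fder (dual_map \<rho>) z X"
    "dual_J S (dchart A z X) = dchart A z X'"
proof -
  have gc: "dual_chart S A U \<rho>" using A(1) by (simp add: convex_chart_def)
  have "cdot (\<i> *s fder (dual_map \<rho>) z X) z = 0"
    using fder_dual_map_base[OF gc A(2,3) X] by (simp add: cdot_scale_left)
  from convex_chart_surjective(1)[OF A this] obtain X' where
    X': "cdot (dual_map \<rho> z) X' = 0" "fder (dual_map \<rho>) z X' = \<i> *s fder (dual_map \<rho>) z X" by blast
  show thesis by (rule that[OF X' dual_J_eq[OF A X X']])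
qed

lemma dual_J_in_H_space:
  assumes S: "strongly_C_convex S" and p: "p \<in> S" and \<xi>: "\<xi> \<in> H_space S p"
  shows "dual_J S \<xi> \<in> H_space S p"
proof -
  obtain A z U \<rho> where A: "chart A z = p" "z \<in> U" "convex_chart S A U \<rho>" using convex_chart_exists[OF S p] .
  have gc: "dual_chart S A U \<rho>" using A(3) by (simp add: convex_chart_def)
  have zS: "chart A z \<in> S" using A p by simp
  obtain X where X: "\<xi> = dchart A z X" using H_space_E[OF \<xi> dual_chartD(1)[OF gc] A(1)] .
  note H = H_space_iff_cdot[OF gc A(2) zS]
  have "cdot (dual_map \<rho> z) X = 0" using H \<xi> X A(1) by simp
  then obtain X' where "cdot (dual_map \<rho> z) X' = 0" "dual_J S (dchart A z X) = dchart A z X'"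
    using dual_J_exists[OF A(3,2) zS] by blast
  then show ?thesis using H[of X'] X A(1) by simp
qed

definition linear_on_H :: "'n::finite cproj set \<Rightarrow> 'n cproj \<Rightarrow> ('n cproj_tangent \<Rightarrow> complex) \<Rightarrow> bool" where
  "linear_on_H S p a \<longleftrightarrow> (\<exists>A z L. invertible A \<and> chart A z = p \<and> linear L \<and>
     (\<forall>X. dchart A z X \<in> H_space S p \<longrightarrow> a (dchart A z X) = L X))"

lemma linear_on_H_chart:
  assumes "linear_on_H S p a" "invertible B" "chart B y = p"
  obtains L where "linear L" "\<And>X. dchart B y X \<in> H_space S p \<Longrightarrow> a (dchart B y X) = L X"
proof -
  obtain A z L where A: "invertible A" "chart A z = p" "linear L"
    "\<And>X. dchart A z X \<in> H_space S p \<Longrightarrow> a (dchart A z X) = L X"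
    using assms(1) unfolding linear_on_H_def by blast
  have eq: "chart B y = chart A z" using A(2) assms(3) by simp
  obtain V \<tau> where V: "y \<in> V" "smooth_on V \<tau>" "\<tau> y = z"
    "\<And>x X. x \<in> V \<Longrightarrow> dchart A (\<tau> x) (fder \<tau> x X) = dchart B x X"
    using chart_transition[OF assms(2) A(1) eq] by metis
  have t: "dchart A z (fder \<tau> y X) = dchart B y X" for X using V(4)[OF V(1)] V(3) by simp
  show thesis
  proof (rule that[of "\<lambda>X. L (fder \<tau> y X)"])
    show "linear (\<lambda>X. L (fder \<tau> y X))"
      using linear_compose[OF smooth_on_linear_fder[OF V(2,1)] A(3)] by (simp add: o_def)
    show "a (dchart B y X) = L (fder \<tau> y X)" if "dchart B y X \<in> H_space S p" for X
      using A(4)[of "fder \<tau> y X"] t that by simp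
  qed
qed

text \<open>
  The conditions of a splitting at a single point. Uniqueness can be proved, and a global splitting can
  be assembled from local ones, at this level.
\<close>
definition pointwise_split :: "'n::finite cproj set \<Rightarrow> ('n cproj \<Rightarrow> complex) \<Rightarrow> 'n cproj \<Rightarrow>
    ('n cproj_tangent \<Rightarrow> complex) \<Rightarrow> ('n cproj_tangent \<Rightarrow> complex) \<Rightarrow> bool" where
  "pointwise_split S u p a b \<longleftrightarrow> linear_on_H S p a \<and> linear_on_H S p b \<and>
     (\<forall>\<xi>\<in>H_space S p. differential S u \<xi> = a \<xi> + b \<xi> \<and>
        a (tangent_J \<xi>) = \<i> * a \<xi> \<and> b (dual_J S \<xi>) = \<i> * b \<xi>)"

text \<open>
  The difference \<open>\<phi>\<close> of two candidates for \<open>d'u\<close> is linear for both complex structures, hence vanishes on the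
  range of \<open>J - J\<^sup>*\<close>. This range is the whole complex tangent space.
\<close>
lemma pointwise_split_unique:
  assumes S: "real_hypersurface S" "strongly_C_convex S" and p: "p \<in> S"
    and ab: "pointwise_split S u p a b" and ab': "pointwise_split S u p a' b'" and \<xi>: "\<xi> \<in> H_space S p"
  shows "a \<xi> = a' \<xi>"
proof -
  obtain A z U \<rho> where A: "chart A z = p" "z \<in> U" "convex_chart S A U \<rho>" using convex_chart_exists[OF S(2) p] .
  have gc: "dual_chart S A U \<rho>" using A(3) by (simp add: convex_chart_def)
  have iA: "invertible A" by (rule dual_chartD(1)[OF gc])
  have zS: "chart A z \<in> S" using A p by simp
  have H: "dchart A z X \<in> H_space S p \<longleftrightarrow> cdot (dual_map \<rho> z) X = 0" for X
    using H_space_iff_cdot[OF gc A(2) zS] A(1) by simp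
  obtain L where L: "linear L" "\<And>X. dchart A z X \<in> H_space S p \<Longrightarrow> a (dchart A z X) = L X"
    using ab linear_on_H_chart[OF _ iA A(1)] unfolding pointwise_split_def by metis
  obtain L' where L': "linear L'" "\<And>X. dchart A z X \<in> H_space S p \<Longrightarrow> a' (dchart A z X) = L' X"
    using ab' linear_on_H_chart[OF _ iA A(1)] unfolding pointwise_split_def by metis
  define \<phi> where "\<phi> = (\<lambda>X. L X - L' X)"
  have \<phi>: "linear \<phi>" unfolding \<phi>_def by (rule linear_compose_sub[OF L(1) L'(1)])
  have \<phi>a: "\<phi> X = a (dchart A z X) - a' (dchart A z X)" if "cdot (dual_map \<rho> z) X = 0" for X
    using L(2) L'(2) H that by (simp add: \<phi>_def)
  have \<phi>b: "\<phi> X = b' (dchart A z X) - b (dchart A z X)" if "cdot (dual_map \<rho> z) X = 0" for X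
  proof -
    have "dchart A z X \<in> H_space S p" using H that by simp
    then have "a (dchart A z X) + b (dchart A z X) = a' (dchart A z X) + b' (dchart A z X)"
      using ab ab' unfolding pointwise_split_def by metis
    then show ?thesis unfolding \<phi>a[OF that] by (simp add: algebra_simps)
  qed
  have 1: "\<phi> (\<i> *s X) = \<i> * \<phi> X" if X: "cdot (dual_map \<rho> z) X = 0" for X
  proof -
    have "dchart A z X \<in> H_space S p" using H X by simp
    then have "a (dchart A z (\<i> *s X)) = \<i> * a (dchart A z X)" "a' (dchart A z (\<i> *s X)) = \<i> * a' (dchart A z X)"
      using ab ab' tangent_J_dchart[OF iA, of z X] unfolding pointwise_split_def by metis+
    moreover have iX: "cdot (dual_map \<rho> z) (\<i> *s X) = 0" using X by (simp add: cdot_scale_right)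
    ultimately show ?thesis unfolding \<phi>a[OF X] \<phi>a[OF iX] by (simp add: right_diff_distrib)
  qed
  have 2: "\<phi> X' = \<i> * \<phi> X" if X: "cdot (dual_map \<rho> z) X = 0" "cdot (dual_map \<rho> z) X' = 0"
    and J: "dual_J S (dchart A z X) = dchart A z X'" for X X'
  proof -
    have "dchart A z X \<in> H_space S p" using H X by simp
    then have "b (dchart A z X') = \<i> * b (dchart A z X)" "b' (dchart A z X') = \<i> * b' (dchart A z X)"
      using ab ab' J unfolding pointwise_split_def by metis+
    then show ?thesis unfolding \<phi>b[OF X(1)] \<phi>b[OF X(2)] by (simp add: right_diff_distrib)
  qed
  obtain Y where Y: "\<xi> = dchart A z Y" using H_space_E[OF \<xi> iA A(1)] .
  have Y0: "cdot (dual_map \<rho> z) Y = 0" using H \<xi> Y by simp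
  note lin = dual_map_differentiable(2)[OF gc A(2) zS]
  obtain X where X: "cdot (dual_map \<rho> z) X = 0" "dual_antihol \<rho> z X = fder (dual_map \<rho>) z Y"
    using convex_chart_surjective(2)[OF A(3,2) zS fder_dual_map_base[OF gc A(2) zS Y0]] by blast
  obtain X' where X': "cdot (dual_map \<rho> z) X' = 0" "fder (dual_map \<rho>) z X' = \<i> *s fder (dual_map \<rho>) z X"
    "dual_J S (dchart A z X) = dchart A z X'"
    using dual_J_exists[OF A(3,2) zS X(1)] .
  have "fder (dual_map \<rho>) z (\<i> *s X - X' - Y) = 0"
    using X(2) X'(2) by (simp add: linear_diff[OF lin] dual_antihol_def)
  moreover have "cdot (dual_map \<rho> z) (\<i> *s X - X' - Y) = 0"
    using X(1) X'(1) Y0 by (simp add: cdot_diff_right cdot_scale_right)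
  ultimately have "\<i> *s X - X' - Y = 0" using convex_chart_injective(1)[OF A(3,2) zS] by blast
  then have "Y = \<i> *s X - X'" by simp
  then have "\<phi> Y = \<phi> (\<i> *s X) - \<phi> X'" using linear_diff[OF \<phi>] by simp
  then have "\<phi> Y = 0" using 1[OF X(1)] 2[OF X(1) X'(1,3)] by simp
  then show ?thesis using \<phi>a[OF Y0] Y by simp
qed

lemma smooth_covectors_linear_on_H:
  assumes "smooth_covectors S (H_space S) a" "p \<in> S"
  shows "linear_on_H S p a"
proof -
  obtain A z U l where A: "chart A z = p" "z \<in> U" "local_form_extension S (H_space S) a A U l"
    using assms unfolding smooth_covectors_def by metis
  then have "local_form S (H_space S) a A U (\<lambda>z. blinfun_apply (l z))" by (simp add: local_form_of_extension)
  then show ?thesis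
    unfolding linear_on_H_def local_form_def smooth_form_def using A(1,2) assms(2)
    by (intro exI[of _ A] exI[of _ z] exI[of _ "blinfun_apply (l z)"]) auto
qed

lemma splitting_pointwise:
  "splitting S u a b \<Longrightarrow> p \<in> S \<Longrightarrow> pointwise_split S u p a b"
  unfolding splitting_def pointwise_split_def using smooth_covectors_linear_on_H by metis

text \<open>
  Writing \<open>w\<close> for the dual map, \<open>d''u\<close> is a combination of the forms \<open>dw\<^sub>j\<close>, which are linear for \<open>J\<^sup>*\<close> by
  construction, and \<open>d'u\<close> is what remains.
\<close>
lemma local_split_forms:
  assumes S: "real_hypersurface S" "strongly_C_convex S" and u: "smooth_fun S u" and p: "p \<in> S"
  obtains A z V \<alpha> \<beta> where "invertible A" "chart A z = p" "z \<in> V" "open V" "smooth_form V \<alpha>" "smooth_form V \<beta>"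
    "\<And>y X. y \<in> V \<Longrightarrow> chart A y \<in> S \<Longrightarrow> dchart A y X \<in> H_space S (chart A y) \<Longrightarrow>
       differential S u (dchart A y X) = \<alpha> y X + \<beta> y X \<and> \<alpha> y (\<i> *s X) = \<i> * \<alpha> y X \<and>
       (\<forall>X'. dual_J S (dchart A y X) = dchart A y X' \<longrightarrow> \<beta> y X' = \<i> * \<beta> y X)"
proof -
  obtain A z U \<rho> where A: "chart A z = p" "z \<in> U" "convex_chart S A U \<rho>" using convex_chart_exists[OF S(2) p] .
  have gc: "dual_chart S A U \<rho>" using A(3) by (simp add: convex_chart_def)
  note g = dual_chartD[OF gc]
  have zS: "chart A z \<in> S" using A p by simp
  obtain W F where W: "z \<in> W" "local_extension S u A W F" using smooth_fun_local_extension[OF u g(1) zS] .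
  have oW: "open W" and Fs: "smooth_on W F" using W(2) by (auto simp: local_extension_def)
  let ?U = "U \<inter> W"
  have oU: "open ?U" using g(3) oW by blast
  have cc: "convex_chart S A ?U \<rho>"
    using A(3) defining_function_subset[OF g(2) oU] unfolding convex_chart_def dual_chart_def by blast
  have zU: "z \<in> ?U" using A W by blast
  have FU: "smooth_on ?U F" by (rule smooth_on_subset[OF Fs]) blast
  obtain V b where V: "open V" "z \<in> V" "V \<subseteq> ?U" "V \<subseteq> {z \<in> ?U. dual_denom \<rho> z \<noteq> 0}" "smooth_on V b"
    "\<forall>z\<in>V. \<forall>X. cdot (dual_map \<rho> z) X = 0 \<longrightarrow>
      cdot (dual_antihol \<rho> z X) (b z) = fder F z (\<i> *s X) - \<i> * fder F z X"
    using dual_coefficients_exist[OF cc zU zS FU] .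
  define \<beta> where "\<beta> = (\<lambda>z X. cdot (fder (dual_map \<rho>) z X) (b z))"
  define \<alpha> where "\<alpha> = (\<lambda>z X. fder F z X - \<beta> z X)"
  have ws: "smooth_on V (dual_map \<rho>)"
    by (rule smooth_on_subset[OF smooth_on_dual_map[OF g(3,4)]]) (use V(4) in auto)
  have FV: "smooth_on V F" using smooth_on_subset[OF FU V(3)] .
  have \<beta>f: "smooth_form V \<beta>"
    unfolding smooth_form_def
  proof (intro conjI ballI allI)
    show "linear (\<beta> y)" if "y \<in> V" for y
      unfolding \<beta>_def using linear_compose[OF smooth_on_linear_fder[OF ws that]
        bounded_linear.linear[OF bounded_bilinear.bounded_linear_left[OF bounded_bilinear_cdot]]] by (simp add: o_def)
    show "smooth_on V (\<lambda>y. \<beta> y X)" for X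
      unfolding \<beta>_def by (intro smooth_on_bilinear[OF bounded_bilinear_cdot] V(1,5) smooth_on_fder ws)
  qed
  have \<alpha>f: "smooth_form V \<alpha>"
    using \<beta>f smooth_form_fder[OF FV] V(1) unfolding smooth_form_def \<alpha>_def
    by (auto intro: linear_compose_sub smooth_on_diff)
  show thesis
  proof (rule that[OF g(1) A(1) V(2,1) \<alpha>f \<beta>f])
    fix y X assume y: "y \<in> V" "chart A y \<in> S" and X: "dchart A y X \<in> H_space S (chart A y)"
    have yU: "y \<in> U" "y \<in> W" "y \<in> ?U" using V(3) y by auto
    have X0: "cdot (dual_map \<rho> y) X = 0" using H_space_iff_cdot[OF gc yU(1) y(2)] X by simp
    have "differential S u (dchart A y X) = fder F y X"
      by (rule differential_eq[OF S(1) W(2) yU(2) y(2) H_space_subset_T_space[OF X]])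
    then have 1: "differential S u (dchart A y X) = \<alpha> y X + \<beta> y X" by (simp add: \<alpha>_def)
    have 2: "\<alpha> y (\<i> *s X) = \<i> * \<alpha> y X"
      using V(6)[rule_format, OF y(1) X0] by (simp add: \<alpha>_def \<beta>_def dual_antihol_def cdot_diff_left cdot_scale_left algebra_simps)
    have 3: "\<beta> y X' = \<i> * \<beta> y X" if J: "dual_J S (dchart A y X) = dchart A y X'" for X'
    proof -
      obtain X'' where X'': "cdot (dual_map \<rho> y) X'' = 0" "fder (dual_map \<rho>) y X'' = \<i> *s fder (dual_map \<rho>) y X"
        "dual_J S (dchart A y X) = dchart A y X''"
        using dual_J_exists[OF cc yU(3) y(2) X0] .
      then have "X' = X''" using J dchart_inject[OF g(1)] by metis
      then show ?thesis using X''(2) by (simp add: \<beta>_def cdot_scale_left)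
    qed
    show "differential S u (dchart A y X) = \<alpha> y X + \<beta> y X \<and> \<alpha> y (\<i> *s X) = \<i> * \<alpha> y X \<and>
       (\<forall>X'. dual_J S (dchart A y X) = dchart A y X' \<longrightarrow> \<beta> y X' = \<i> * \<beta> y X)"
      using 1 2 3 by blast
  qed
qed

text \<open>
  A form in a chart as a function on tangent vectors of projective space.
\<close>
definition on_tangent_vectors where
  "on_tangent_vectors A \<alpha> \<xi> = (case SOME (z, X). \<xi> = dchart A z X of (z, X) \<Rightarrow> \<alpha> z X)"

lemma on_tangent_vectors_dchart:
  assumes "invertible A"
  shows "on_tangent_vectors A \<alpha> (dchart A z X) = \<alpha> z X"
proof -
  have "(SOME (z', X'). dchart A z X = dchart A z' X') = (z, X)"
    by (rule some_equality) (auto simp: dchart_inject[OF assms])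
  then show ?thesis by (simp add: on_tangent_vectors_def)
qed

text \<open>
  Local splittings agree on overlaps by pointwise uniqueness.
\<close>
lemma splitting_exists:
  assumes S: "real_hypersurface S" "strongly_C_convex S" and u: "smooth_fun S u"
  shows "\<exists>a b. splitting S u a b"
proof -
  \<comment> \<open>a vector determines its base point, so the choice is unambiguous\<close>
  define a where "a = (\<lambda>\<xi>. SOME c. \<exists>q a' b'. q \<in> S \<and> \<xi> \<in> H_space S q \<and> pointwise_split S u q a' b' \<and> c = a' \<xi>)"
  define b where "b = (\<lambda>\<xi>. differential S u \<xi> - a \<xi>)"
  have base: "q = q'" if qq': "\<xi> \<in> H_space S q" "\<xi> \<in> H_space S q'" for q q' and \<xi> :: "'a cproj_tangent"
  proof -
    obtain A z X where A: "\<xi> = dchart A z X" "invertible A" "chart A z = q"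
      using qq'(1) unfolding H_space_def T_space_def by blast
    obtain B y Y where B: "\<xi> = dchart B y Y" "invertible B" "chart B y = q'"
      using qq'(2) unfolding H_space_def T_space_def by blast
    show ?thesis using dchart_base[OF A(2) B(2), of z X y Y] A B by metis
  qed
  have a: "a \<xi> = a' \<xi>" "b \<xi> = b' \<xi>" if ps: "pointwise_split S u q a' b'" and q: "q \<in> S" and \<xi>: "\<xi> \<in> H_space S q" for q a' b' \<xi>
  proof -
    show *: "a \<xi> = a' \<xi>" unfolding a_def
    proof (rule some_equality)
      show "\<exists>q a'' b''. q \<in> S \<and> \<xi> \<in> H_space S q \<and> pointwise_split S u q a'' b'' \<and> a' \<xi> = a'' \<xi>"
        using ps q \<xi> by blast
      fix c assume "\<exists>q a'' b''. q \<in> S \<and> \<xi> \<in> H_space S q \<and> pointwise_split S u q a'' b'' \<and> c = a'' \<xi>"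
      then obtain q' a'' b'' where "\<xi> \<in> H_space S q'" "pointwise_split S u q' a'' b''" "c = a'' \<xi>" by blast
      then show "c = a' \<xi>" using base[OF \<xi>, of q'] pointwise_split_unique[OF S q ps _ \<xi>] by metis
    qed
    show "b \<xi> = b' \<xi>" using ps \<xi> unfolding b_def * pointwise_split_def by auto
  qed
  have loc: "\<exists>A z V. chart A z = p \<and> z \<in> V \<and> (\<exists>\<alpha>. local_form S (H_space S) a A V \<alpha>) \<and> (\<exists>\<beta>. local_form S (H_space S) b A V \<beta>)
      \<and> (\<forall>\<xi>\<in>H_space S p. differential S u \<xi> = a \<xi> + b \<xi> \<and> a (tangent_J \<xi>) = \<i> * a \<xi> \<and> b (dual_J S \<xi>) = \<i> * b \<xi>)"
    if p: "p \<in> S" for p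
  proof -
    obtain A z V \<alpha> \<beta> where A: "invertible A" "chart A z = p" "z \<in> V" "open V" "smooth_form V \<alpha>" "smooth_form V \<beta>"
      and ab: "\<And>y X. y \<in> V \<Longrightarrow> chart A y \<in> S \<Longrightarrow> dchart A y X \<in> H_space S (chart A y) \<Longrightarrow>
       differential S u (dchart A y X) = \<alpha> y X + \<beta> y X \<and> \<alpha> y (\<i> *s X) = \<i> * \<alpha> y X \<and>
       (\<forall>X'. dual_J S (dchart A y X) = dchart A y X' \<longrightarrow> \<beta> y X' = \<i> * \<beta> y X)"
      using local_split_forms[OF S u p] by blast
    let ?a = "on_tangent_vectors A \<alpha>" and ?b = "on_tangent_vectors A \<beta>"
    note o = on_tangent_vectors_dchart[OF A(1)]
    have ps: "pointwise_split S u (chart A y) ?a ?b" if y: "y \<in> V" "chart A y \<in> S" for y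
      unfolding pointwise_split_def
    proof (intro conjI ballI)
      show "linear_on_H S (chart A y) ?a" "linear_on_H S (chart A y) ?b"
        unfolding linear_on_H_def using A(1,5,6) y(1) o unfolding smooth_form_def by blast+
      fix \<xi> assume \<xi>: "\<xi> \<in> H_space S (chart A y)"
      obtain X where X: "\<xi> = dchart A y X" using H_space_E[OF \<xi> A(1) refl] .
      note abX = ab[OF y \<xi>[unfolded X]]
      show "differential S u \<xi> = ?a \<xi> + ?b \<xi>" using abX by (simp add: X o)
      show "?a (tangent_J \<xi>) = \<i> * ?a \<xi>" using abX by (simp add: X o tangent_J_dchart[OF A(1)])
      have "dual_J S \<xi> \<in> H_space S (chart A y)" by (rule dual_J_in_H_space[OF S(2) y(2) \<xi>])
      then obtain X' where X': "dual_J S \<xi> = dchart A y X'" using H_space_E[OF _ A(1) refl] by blast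
      show "?b (dual_J S \<xi>) = \<i> * ?b \<xi>" using abX X' by (simp add: X o)
    qed
    have eq: "a (dchart A y X) = \<alpha> y X" "b (dchart A y X) = \<beta> y X"
      if y: "y \<in> V" "chart A y \<in> S" "dchart A y X \<in> H_space S (chart A y)" for y X
      using a[OF ps[OF y(1,2)] y(2,3)] o by simp_all
    have "local_form S (H_space S) a A V \<alpha>" "local_form S (H_space S) b A V \<beta>"
      unfolding local_form_def using A(1,4-6) eq by auto
    moreover have "differential S u \<xi> = a \<xi> + b \<xi> \<and> a (tangent_J \<xi>) = \<i> * a \<xi> \<and> b (dual_J S \<xi>) = \<i> * b \<xi>"
      if \<xi>: "\<xi> \<in> H_space S p" for \<xi>
    proof -
      have pp: "pointwise_split S u p ?a ?b" using ps[OF A(3)] A(2) p by simp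
      have "tangent_J \<xi> \<in> H_space S p" "dual_J S \<xi> \<in> H_space S p"
        using tangent_J_in_H_space[OF S(1) p \<xi>] dual_J_in_H_space[OF S(2) p \<xi>] by auto
      then show ?thesis using a[OF pp p] pp \<xi> unfolding pointwise_split_def by simp
    qed
    ultimately show ?thesis using A(2,3) by blast
  qed
  have "splitting S u a b"
    unfolding splitting_def
  proof (intro conjI)
    show "smooth_covectors S (H_space S) a" "smooth_covectors S (H_space S) b"
      using loc smooth_covectorsI by metis+
    show "\<forall>p\<in>S. \<forall>\<xi>\<in>H_space S p. differential S u \<xi> = a \<xi> + b \<xi> \<and>
        a (tangent_J \<xi>) = \<i> * a \<xi> \<and> b (dual_J S \<xi>) = \<i> * b \<xi>" using loc by blast
  qed
  then show ?thesis by blast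
qed

lemma d_prime_eq:
  assumes S: "real_hypersurface S" "strongly_C_convex S" and ab: "splitting S u a b" and p: "p \<in> S" and \<xi>: "\<xi> \<in> H_space S p"
  shows "d_prime S u \<xi> = a \<xi>"
proof -
  obtain b' where "splitting S u (d_prime S u) b'"
    using ab someI_ex[of "\<lambda>a. \<exists>b. splitting S u a b"] unfolding d_prime_def by blast
  from pointwise_split_unique[OF S p splitting_pointwise[OF this p] splitting_pointwise[OF ab p] \<xi>] show ?thesis .
qed

section \<open>Rigidity of closed forms along a contact structure\<close>

lemma smooth_form_fder_apply:
  assumes "open U" "smooth_form U a" "z \<in> U"
  shows "fder (\<lambda>z. a z Y) z X = blinfun_apply (fder (\<lambda>z. Blinfun (a z)) z X) Y"
proof -
  note B = smooth_on_Blinfun_form[OF assms(1,2)]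
  have "frechet_derivative (\<lambda>z. a z Y) (at z) = fder (\<lambda>z. blinfun_apply (Blinfun (a z)) Y) z"
    by (rule frechet_derivative_cong_open[OF assms(1,3)]) (simp add: B)
  then show ?thesis using fder_blinfun_apply[OF smooth_on_differentiable[OF B(1) assms(3)]] by simp
qed

lemma dform_antisym: "dform a z X Y = - dform a z Y X"
  by (simp add: dform_def)

lemma dform_linear_right:
  assumes "open U" "smooth_form U a" "z \<in> U"
  shows "linear (dform a z X)"
proof -
  have "linear (fder (\<lambda>z. a z X) z)"
    using assms(2,3) smooth_on_linear_fder unfolding smooth_form_def by blast
  moreover have "linear (\<lambda>Y. fder (\<lambda>z. a z Y) z X)"
    unfolding smooth_form_fder_apply[OF assms] by (rule bounded_linear.linear[OF blinfun.bounded_linear_right])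
  ultimately show ?thesis unfolding dform_def[abs_def] by (intro linear_compose_sub)
qed

lemma smooth_on_dform: "open U \<Longrightarrow> smooth_form U a \<Longrightarrow> smooth_on U (\<lambda>z. dform a z X Y)"
  unfolding dform_def smooth_form_def by (intro smooth_on_diff smooth_on_fder) auto

text \<open>
  \<open>d\<^sup>2 = 0\<close>, for constant vectors: a cyclic sum of symmetric second derivatives.
\<close>
lemma dform_closed:
  assumes "open U" "smooth_form U a" "z \<in> U"
  shows "fder (\<lambda>z. dform a z X Y) z Z + fder (\<lambda>z. dform a z Y Z) z X + fder (\<lambda>z. dform a z Z X) z Y = 0"
proof -
  have s: "smooth_on U (\<lambda>z. a z v)" for v using assms(2) by (simp add: smooth_form_def)
  have *: "fder (\<lambda>z. dform a z X Y) z Z =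
      fder (\<lambda>y. fder (\<lambda>z. a z Y) y X) z Z - fder (\<lambda>y. fder (\<lambda>z. a z X) y Y) z Z" for X Y Z
    unfolding dform_def by (rule fder_diff) (rule smooth_on_differentiable[OF smooth_on_fder[OF s] assms(3)])+
  show ?thesis
    unfolding *
    using second_derivative_symmetric[OF assms(1) s assms(3), of Y X Z]
      second_derivative_symmetric[OF assms(1) s assms(3), of X Y Z]
      second_derivative_symmetric[OF assms(1) s assms(3), of Z X Y]
    by simp
qed

text \<open>
  A closed 2-form \<open>db\<close> that vanishes on the contact planes \<open>ker \<theta>\<close> is \<open>\<beta> \<and> \<theta>\<close> with \<open>\<beta> = db(\<cdot>, T) / \<theta>(T)\<close>.
  Then \<open>0 = d\<beta> \<and> \<theta> - \<beta> \<and> d\<theta>\<close>, so that \<open>\<beta> \<and> d\<theta>\<close> vanishes on contact planes. If the planes are large enough for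
  each \<open>X\<close> in them to be \<open>d\<theta>\<close>-orthogonal to some pair \<open>Y, Z\<close> with \<open>d\<theta>(Y, Z) \<noteq> 0\<close>, this forces \<open>\<beta>(X) = 0\<close>.
\<close>
lemma contact_rigidity:
  fixes b :: "'a::euclidean_space \<Rightarrow> 'a \<Rightarrow> 'b::euclidean_space" and \<theta> :: "'a \<Rightarrow> 'a \<Rightarrow> real"
  assumes V: "open V" "z0 \<in> V" and b: "smooth_form V b" and \<theta>: "smooth_form V \<theta>" and T: "\<theta> z0 T \<noteq> 0"
    and van: "\<And>z X Y. z \<in> V \<Longrightarrow> \<theta> z X = 0 \<Longrightarrow> \<theta> z Y = 0 \<Longrightarrow> dform b z X Y = 0"
    and nd: "\<And>X. \<theta> z0 X = 0 \<Longrightarrow> \<exists>Y Z. \<theta> z0 Y = 0 \<and> \<theta> z0 Z = 0 \<and> dform \<theta> z0 X Y = 0 \<and>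
      dform \<theta> z0 X Z = 0 \<and> dform \<theta> z0 Y Z \<noteq> 0"
  shows "dform b z0 X Y = 0"
proof -
  have \<theta>s: "smooth_on V (\<lambda>z. \<theta> z v)" for v using \<theta> by (simp add: smooth_form_def)
  have \<theta>l: "linear (\<theta> z)" if "z \<in> V" for z using \<theta> that by (simp add: smooth_form_def)
  let ?V = "{z \<in> V. \<theta> z T \<noteq> 0}"
  have oV: "open ?V" using open_Int_preimage[OF V(1) _ \<theta>s, of "- {0}" T] by (simp add: open_Compl)
  have z0V: "z0 \<in> ?V" using V T by simp
  \<comment> \<open>\<open>db = \<beta> \<and> \<theta>\<close>, cleared of the denominator\<close>
  have id: "\<theta> z T *\<^sub>R dform b z X Y = \<theta> z Y *\<^sub>R dform b z X T - \<theta> z X *\<^sub>R dform b z Y T" if z: "z \<in> ?V" for z X Y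
  proof -
    have zV: "z \<in> V" and t: "\<theta> z T \<noteq> 0" using z by auto
    note l = \<theta>l[OF zV] and L = dform_linear_right[OF V(1) b zV]
    let ?x = "\<theta> z X / \<theta> z T" and ?y = "\<theta> z Y / \<theta> z T"
    have k: "\<theta> z (X - ?x *\<^sub>R T) = 0" "\<theta> z (Y - ?y *\<^sub>R T) = 0"
      using t by (simp_all add: linear_diff[OF l] linear_cmul[OF l])
    have TT: "dform b z T T = 0" by (simp add: dform_def)
    have "0 = dform b z (X - ?x *\<^sub>R T) (Y - ?y *\<^sub>R T)" using van[OF zV k] by simp
    also have "\<dots> = dform b z (X - ?x *\<^sub>R T) Y - ?y *\<^sub>R dform b z (X - ?x *\<^sub>R T) T"
      by (simp add: linear_diff[OF L] linear_cmul[OF L])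
    also have "dform b z (X - ?x *\<^sub>R T) Y = dform b z X Y + ?x *\<^sub>R dform b z Y T"
      unfolding dform_antisym[of b z "X - ?x *\<^sub>R T" Y] dform_antisym[of b z X Y]
      by (simp add: linear_diff[OF L] linear_cmul[OF L])
    also have "dform b z (X - ?x *\<^sub>R T) T = dform b z X T"
      unfolding dform_antisym[of b z "X - ?x *\<^sub>R T" T] dform_antisym[of b z X T]
      by (simp add: linear_diff[OF L] linear_cmul[OF L] TT)
    finally have "dform b z X Y = ?y *\<^sub>R dform b z X T - ?x *\<^sub>R dform b z Y T" by (simp add: algebra_simps)
    then show ?thesis using t by (simp add: scaleR_diff_right)
  qed
  have D: "\<theta> z0 T *\<^sub>R fder (\<lambda>z. dform b z X Y) z0 Z =
      fder (\<lambda>z. \<theta> z Y) z0 Z *\<^sub>R dform b z0 X T - fder (\<lambda>z. \<theta> z X) z0 Z *\<^sub>R dform b z0 Y T"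
    if k: "\<theta> z0 X = 0" "\<theta> z0 Y = 0" for X Y Z
  proof -
    have d\<theta>: "(\<lambda>z. \<theta> z v) differentiable (at z0)" for v by (rule smooth_on_differentiable[OF \<theta>s V(2)])
    have db: "(\<lambda>z. dform b z X Y) differentiable (at z0)" for X Y
      by (rule smooth_on_differentiable[OF smooth_on_dform[OF V(1) b] V(2)])
    have dp: "(\<lambda>z. \<theta> z v *\<^sub>R dform b z X Y) differentiable (at z0)" for v X Y
      by (rule smooth_on_differentiable[OF smooth_on_scaleR[OF V(1) \<theta>s smooth_on_dform[OF V(1) b]] V(2)])
    note P = fder_bilinear[OF bounded_bilinear_scaleR d\<theta> db]
    have "frechet_derivative (\<lambda>z. \<theta> z T *\<^sub>R dform b z X Y) (at z0) =
      fder (\<lambda>z. \<theta> z Y *\<^sub>R dform b z X T - \<theta> z X *\<^sub>R dform b z Y T) z0"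
      by (rule frechet_derivative_cong_open[OF oV z0V id])
    then have "fder (\<lambda>z. \<theta> z T *\<^sub>R dform b z X Y) z0 Z =
      fder (\<lambda>z. \<theta> z Y *\<^sub>R dform b z X T - \<theta> z X *\<^sub>R dform b z Y T) z0 Z" by simp
    then show ?thesis
      unfolding fder_diff[OF dp dp] P using k van[OF V(2) k] by simp
  qed
  have \<beta>0: "dform b z0 X T = 0" if X: "\<theta> z0 X = 0" for X
  proof -
    obtain Y Z where YZ: "\<theta> z0 Y = 0" "\<theta> z0 Z = 0" "dform \<theta> z0 X Y = 0" "dform \<theta> z0 X Z = 0" "dform \<theta> z0 Y Z \<noteq> 0"
      using nd[OF X] by blast
    \<comment> \<open>\<open>d(db) = 0\<close>, evaluated on three vectors of the contact plane\<close>
    have "\<theta> z0 T *\<^sub>R (fder (\<lambda>z. dform b z X Y) z0 Z + fder (\<lambda>z. dform b z Y Z) z0 X + fder (\<lambda>z. dform b z Z X) z0 Y) = 0"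
      using dform_closed[OF V(1) b V(2)] by simp
    then have "(fder (\<lambda>z. \<theta> z Y) z0 Z *\<^sub>R dform b z0 X T - fder (\<lambda>z. \<theta> z X) z0 Z *\<^sub>R dform b z0 Y T)
      + (fder (\<lambda>z. \<theta> z Z) z0 X *\<^sub>R dform b z0 Y T - fder (\<lambda>z. \<theta> z Y) z0 X *\<^sub>R dform b z0 Z T)
      + (fder (\<lambda>z. \<theta> z X) z0 Y *\<^sub>R dform b z0 Z T - fder (\<lambda>z. \<theta> z Z) z0 Y *\<^sub>R dform b z0 X T) = 0"
      unfolding scaleR_add_right D[OF X YZ(1)] D[OF YZ(1,2)] D[OF YZ(2) X] .
    then have "- (dform \<theta> z0 Y Z) *\<^sub>R dform b z0 X T + dform \<theta> z0 X Z *\<^sub>R dform b z0 Y T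
      - dform \<theta> z0 X Y *\<^sub>R dform b z0 Z T = 0"
      unfolding dform_def by (simp add: algebra_simps)
    then show ?thesis using YZ by simp
  qed
  have \<beta>: "dform b z0 X T = 0" for X
  proof -
    note l = \<theta>l[OF V(2)] and L = dform_linear_right[OF V(1) b V(2)]
    let ?x = "\<theta> z0 X / \<theta> z0 T"
    have "\<theta> z0 (X - ?x *\<^sub>R T) = 0" using T by (simp add: linear_diff[OF l] linear_cmul[OF l])
    then have "dform b z0 T (X - ?x *\<^sub>R T) = 0" using \<beta>0 dform_antisym[of b z0 T] by simp
    moreover have "dform b z0 T T = 0" by (simp add: dform_def)
    ultimately have "dform b z0 T X = 0" by (simp add: linear_diff[OF L] linear_cmul[OF L])
    then show ?thesis using dform_antisym[of b z0 X T] by simp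
  qed
  show ?thesis using id[OF z0V, of X Y] \<beta> T by simp
qed

lemma nontrivial_kernel:
  fixes L :: "complex^('n::finite) \<Rightarrow> complex \<times> complex"
  assumes "CARD('n) > 2" "linear L"
  obtains Y where "Y \<noteq> 0" "L Y = 0"
proof -
  have "\<not> inj L"
  proof
    assume "inj L"
    have "dim (L ` UNIV) = dim (UNIV :: (complex^'n) set)"
      by (rule dim_image_eq[OF assms(2)]) (use \<open>inj L\<close> in simp)
    then have "DIM(complex^'n) \<le> DIM(complex \<times> complex)" using dim_subset_UNIV[of "L ` UNIV"] by simp
    then show False using assms(1) by simp
  qed
  then show thesis using that linear_injective_0[OF assms(2)] by blast
qed

text \<open>
  The real tangent space is not invariant under the complex structure.
\<close>
lemma transversal_tangent_vector:
  assumes "linear f" "f N \<noteq> (0::real)"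
  obtains T :: "complex^'n" where "f T = 0" "f (\<i> *s T) \<noteq> 0"
proof
  define c where "c = f (\<i> *s N) / f N"
  let ?T = "c *\<^sub>R N - \<i> *s N"
  show "f ?T = 0" using assms by (simp add: c_def linear_diff linear_cmul)
  have "\<i> *s ?T = c *\<^sub>R (\<i> *s N) + N" by (simp add: vec_eq_iff algebra_simps)
  then have "f (\<i> *s ?T) * f N = (f (\<i> *s N))\<^sup>2 + (f N)\<^sup>2"
    using assms by (simp add: linear_add linear_cmul c_def power2_eq_square field_simps)
  moreover have "(f (\<i> *s N))\<^sup>2 + (f N)\<^sup>2 > 0" using assms(2) by (simp add: add_nonneg_pos)
  ultimately show "f (\<i> *s ?T) \<noteq> 0" by auto
qed

text \<open>
  The contact form \<open>X \<mapsto> d\<rho>(\<i> X)\<close> has the Levi form as its derivative on complex tangent vectors: \<open>Y\<close> and \<open>\<i> Y\<close>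
  pair nontrivially for every \<open>Y \<noteq> 0\<close>. Orthogonality of \<open>Y\<close> and \<open>\<i> Y\<close> to a given \<open>X\<close>, together with \<open>Y\<close> being complex
  tangent, amounts to four real equations for a vector with \<open>2n > 4\<close> real coordinates.
\<close>
lemma closed_on_H_imp_closed:
  fixes S :: "'n::finite cproj set"
  assumes n: "CARD('n) > 2" and A: "convex_chart S A U \<rho>" "z \<in> U" "chart A z \<in> S"
    and a: "open W" "z \<in> W" "smooth_form W a"
    and van: "\<And>y X Y. y \<in> U \<Longrightarrow> y \<in> W \<Longrightarrow> chart A y \<in> S \<Longrightarrow> cdot (dual_map \<rho> y) X = 0 \<Longrightarrow>
        cdot (dual_map \<rho> y) Y = 0 \<Longrightarrow> dform a y X Y = 0"
    and X: "fder \<rho> z X = 0" and Y: "fder \<rho> z Y = 0"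
  shows "dform a z X Y = 0"
proof -
  have gc: "dual_chart S A U \<rho>" using A(1) by (simp add: convex_chart_def)
  note g = dual_chartD[OF gc]
  have zM: "z \<in> chart A -` S" using A(3) by simp
  obtain s where s: "\<And>X. X \<noteq> 0 \<Longrightarrow> fder \<rho> z X = 0 \<Longrightarrow> s * hess \<rho> z X X > 0"
    using A unfolding convex_chart_def by blast
  have H: "cdot (dual_map \<rho> y) X = 0 \<longleftrightarrow> fder \<rho> y X = 0 \<and> fder \<rho> y (\<i> *s X) = 0"
    if "y \<in> U" "chart A y \<in> S" for y X
    using H_space_iff[OF g(1) that(1) g(2) that(2)] H_space_iff_cdot[OF gc that] by simp
  obtain V \<pi> where V: "open V" "z \<in> V" "V \<subseteq> U \<inter> W" "smooth_on V \<pi>"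
    "\<And>y. y \<in> V \<Longrightarrow> \<pi> y \<in> U \<inter> W \<inter> chart A -` S" "\<And>y. y \<in> V \<Longrightarrow> y \<in> chart A -` S \<Longrightarrow> \<pi> y = y"
    "\<And>y X. y \<in> V \<Longrightarrow> y \<in> chart A -` S \<Longrightarrow> fder \<rho> y X = 0 \<Longrightarrow> fder \<pi> y X = X"
    "\<And>y X. y \<in> V \<Longrightarrow> fder \<rho> (\<pi> y) (fder \<pi> y X) = 0"
    using defining_function_retraction[OF g(2) A(2) zM a(1,2)] by blast
  have \<pi>z: "\<pi> z = z" by (rule V(6)[OF V(2) zM])
  have d\<pi>: "fder \<pi> z X = X" if "fder \<rho> z X = 0" for X by (rule V(7)[OF V(2) zM that])
  define \<theta>0 where "\<theta>0 = (\<lambda>y X. fder \<rho> y (\<i> *s X))"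
  have \<theta>0: "smooth_form U \<theta>0"
    unfolding smooth_form_def \<theta>0_def
    using linear_compose[OF linear_i_smult smooth_on_linear_fder[OF g(4)]] smooth_on_fder[OF g(4)] by (simp add: o_def)
  have \<pi>U: "\<pi> y \<in> U" and \<pi>W: "\<pi> y \<in> W" if "y \<in> V" for y using V(5)[OF that] by auto
  let ?b = "pullback \<pi> a" and ?\<theta> = "pullback \<pi> \<theta>0"
  have db: "dform ?b y X Y = dform a (\<pi> y) (fder \<pi> y X) (fder \<pi> y Y)" if "y \<in> V" for y X Y
    by (rule dform_pullback[OF V(1) a(1) \<pi>W V(4) a(3) that])
  have d\<theta>: "dform ?\<theta> y X Y = dform \<theta>0 (\<pi> y) (fder \<pi> y X) (fder \<pi> y Y)" if "y \<in> V" for y X Y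
    by (rule dform_pullback[OF V(1) g(3) \<pi>U V(4) \<theta>0 that])
  have d\<theta>0: "dform \<theta>0 z X Y = hess \<rho> z X (\<i> *s Y) - hess \<rho> z Y (\<i> *s X)" for X Y
    by (simp add: dform_def \<theta>0_def)
  have lin: "linear (fder \<rho> z)" by (rule smooth_on_linear_fder[OF g(4) A(2)])
  obtain N where N: "fder \<rho> z N \<noteq> 0" using defining_functionD(4)[OF g(2) A(2) zM] by blast
  obtain T where T: "fder \<rho> z T = 0" "fder \<rho> z (\<i> *s T) \<noteq> 0" using transversal_tangent_vector[OF lin N] .
  have "dform ?b z X Y = 0"
  proof (rule contact_rigidity[of V z ?b ?\<theta> T])
    show "open V" "z \<in> V" by (rule V)+
    show "smooth_form V ?b" by (rule smooth_form_pullback[OF V(1) a(1) \<pi>W V(4) a(3)])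
    show "smooth_form V ?\<theta>" by (rule smooth_form_pullback[OF V(1) g(3) \<pi>U V(4) \<theta>0])
    show "?\<theta> z T \<noteq> 0" using T \<pi>z d\<pi>[OF T(1)] by (simp add: pullback_def \<theta>0_def)
    show "dform ?b y X Y = 0" if y: "y \<in> V" and k: "?\<theta> y X = 0" "?\<theta> y Y = 0" for y X Y
    proof -
      have \<pi>S: "chart A (\<pi> y) \<in> S" using V(5)[OF y] by simp
      have "cdot (dual_map \<rho> (\<pi> y)) (fder \<pi> y X) = 0" "cdot (dual_map \<rho> (\<pi> y)) (fder \<pi> y Y) = 0"
        using H[OF \<pi>U[OF y] \<pi>S] V(8)[OF y] k by (auto simp: pullback_def \<theta>0_def)
      then show ?thesis unfolding db[OF y] by (rule van[OF \<pi>U[OF y] \<pi>W[OF y] \<pi>S])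
    qed
    fix X1 assume k: "?\<theta> z X1 = 0"
    let ?X = "fder \<pi> z X1"
    let ?L = "\<lambda>Y. (cdot (dual_map \<rho> z) Y, complex_of_real (dform \<theta>0 z ?X Y) + \<i> * complex_of_real (dform \<theta>0 z ?X (\<i> *s Y)))"
    have l1: "linear (dform \<theta>0 z ?X)" by (rule dform_linear_right[OF g(3) \<theta>0 A(2)])
    have l2: "linear (\<lambda>Y. dform \<theta>0 z ?X (\<i> *s Y))" using linear_compose[OF linear_i_smult l1] by (simp add: o_def)
    have "linear ?L"
      by (rule linearI) (simp_all add: cdot_add_right cdot_scaleR_right linear_add[OF l1] linear_cmul[OF l1]
          linear_add[OF l2] linear_cmul[OF l2] complex_eq_iff)
    then obtain Y where Y: "Y \<noteq> 0" "?L Y = 0" using nontrivial_kernel[OF n] by blast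
    then have Y0: "cdot (dual_map \<rho> z) Y = 0" and Yd: "dform \<theta>0 z ?X Y = 0" "dform \<theta>0 z ?X (\<i> *s Y) = 0"
      by (auto simp: complex_eq_iff zero_prod_def)
    have tY: "fder \<rho> z Y = 0" "fder \<rho> z (\<i> *s Y) = 0" using H[OF A(2,3)] Y0 by auto
    have nz: "dform \<theta>0 z Y (\<i> *s Y) \<noteq> 0"
    proof -
      have "dform \<theta>0 z Y (\<i> *s Y) = - (hess \<rho> z Y Y + hess \<rho> z (\<i> *s Y) (\<i> *s Y))"
        unfolding d\<theta>0 i_smult_i_smult hess_minus[OF g(3,4) A(2)] by simp
      moreover have "s * (hess \<rho> z Y Y + hess \<rho> z (\<i> *s Y) (\<i> *s Y)) > 0"
        using s[OF Y(1) tY(1)] s[OF i_smult_neq_0[OF Y(1)] tY(2)] by (simp add: distrib_left)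
      ultimately show ?thesis by (metis less_irrefl mult_zero_right neg_equal_0_iff_equal)
    qed
    have e: "fder \<pi> z Y = Y" "fder \<pi> z (\<i> *s Y) = \<i> *s Y" using d\<pi> tY by auto
    have miY: "fder \<rho> z (\<i> *s (\<i> *s Y)) = 0" using tY(1) linear_neg[OF lin] by (simp add: i_smult_i_smult)
    show "\<exists>Y Z. ?\<theta> z Y = 0 \<and> ?\<theta> z Z = 0 \<and> dform ?\<theta> z X1 Y = 0 \<and> dform ?\<theta> z X1 Z = 0 \<and> dform ?\<theta> z Y Z \<noteq> 0"
      unfolding d\<theta>[OF V(2)]
      by (rule exI[of _ Y], rule exI[of _ "\<i> *s Y"])
         (use e \<pi>z Yd nz tY miY in \<open>simp add: pullback_def \<theta>0_def\<close>)
  qed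
  then show ?thesis using db[OF V(2), of X Y] \<pi>z d\<pi>[OF X] d\<pi>[OF Y] by simp
qed

text \<open>
  The Poincare lemma applies to the pullback under the retraction: it is closed on a full
  neighbourhood, since the retraction takes values in the hypersurface.
\<close>
lemma closed_imp_local_primitive:
  assumes A: "invertible A" "defining_function (chart A -` S) U \<rho>" "z \<in> U" "chart A z \<in> S"
    and a: "local_form S (T_space S) \<alpha> A W a" "z \<in> W"
    and cl: "\<And>y X Y. y \<in> U \<Longrightarrow> y \<in> W \<Longrightarrow> chart A y \<in> S \<Longrightarrow> fder \<rho> y X = 0 \<Longrightarrow> fder \<rho> y Y = 0 \<Longrightarrow> dform a y X Y = 0"
  obtains V F where "z \<in> V" "local_primitive S \<alpha> A V F"
proof -
  have oW: "open W" and fa: "smooth_form W a" using a(1) by (auto simp: local_form_def)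
  have zM: "z \<in> chart A -` S" using A(4) by simp
  obtain V \<pi> where V: "open V" "z \<in> V" "V \<subseteq> U \<inter> W" "smooth_on V \<pi>"
    "\<And>y. y \<in> V \<Longrightarrow> \<pi> y \<in> U \<inter> W \<inter> chart A -` S" "\<And>y. y \<in> V \<Longrightarrow> y \<in> chart A -` S \<Longrightarrow> \<pi> y = y"
    "\<And>y X. y \<in> V \<Longrightarrow> y \<in> chart A -` S \<Longrightarrow> fder \<rho> y X = 0 \<Longrightarrow> fder \<pi> y X = X"
    "\<And>y X. y \<in> V \<Longrightarrow> fder \<rho> (\<pi> y) (fder \<pi> y X) = 0"
    using defining_function_retraction[OF A(2,3) zM oW a(2)] by blast
  have \<pi>W: "\<pi> y \<in> W" if "y \<in> V" for y using V(5)[OF that] by auto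
  let ?b = "pullback \<pi> a"
  have bV: "smooth_form V ?b" by (rule smooth_form_pullback[OF V(1) oW \<pi>W V(4) fa])
  have cb: "dform ?b y X Y = 0" if y: "y \<in> V" for y X Y
  proof -
    have "dform a (\<pi> y) (fder \<pi> y X) (fder \<pi> y Y) = 0"
      by (rule cl) (use V(5,8)[OF y] in auto)
    then show ?thesis by (simp add: dform_pullback[OF V(1) oW \<pi>W V(4) fa y])
  qed
  obtain r where r: "r > 0" "ball z r \<subseteq> V" using V(1,2) open_contains_ball by blast
  obtain F where F: "smooth_on (ball z r) F" "\<And>y X. y \<in> ball z r \<Longrightarrow> fder F y X = ?b y X"
    using poincare_ball[OF smooth_form_subset[OF bV r(2)]] cb r(2) by blast
  have "local_primitive S \<alpha> A (ball z r) F"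
    unfolding local_primitive_def
  proof (intro conjI ballI allI impI)
    fix y X assume y: "y \<in> ball z r" "chart A y \<in> S" and X: "dchart A y X \<in> T_space S (chart A y)"
    have yV: "y \<in> V" "y \<in> chart A -` S" "y \<in> U" "y \<in> W" using r y V(3) by auto
    have t: "fder \<rho> y X = 0" using T_space_iff[OF A(1) yV(3) A(2) y(2)] X by simp
    have "fder F y X = a y X" using F(2)[OF y(1)] V(6)[OF yV(1,2)] V(7)[OF yV(1,2) t] by (simp add: pullback_def)
    also have "\<dots> = \<alpha> (dchart A y X)" using a(1) yV(4) y(2) X unfolding local_form_def by blast
    finally show "fder F y X = \<alpha> (dchart A y X)" .
  qed (use A(1) F(1) in auto)
  then show thesis using that[of "ball z r" F] r(1) by simp
qed

section \<open>The decomposition theorem\<close>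

lemma dform_scale:
  fixes a :: "'a::euclidean_space \<Rightarrow> 'a \<Rightarrow> complex" and l :: "'a \<Rightarrow> complex"
  assumes "open U" "z \<in> U" "smooth_form U a" "smooth_on U l"
  shows "dform (\<lambda>z X. l z * a z X) z X Y = l z * dform a z X Y + fder l z X * a z Y - fder l z Y * a z X"
proof -
  have d: "(\<lambda>z. a z v) differentiable (at z)" for v
    using assms(2,3) smooth_on_differentiable unfolding smooth_form_def by blast
  have l: "l differentiable (at z)" by (rule smooth_on_differentiable[OF assms(4,2)])
  show ?thesis unfolding dform_def fder_mult[OF l d] by (simp add: algebra_simps)
qed

lemma dform_add:
  assumes "z \<in> U" "smooth_form U a" "smooth_form U b"
  shows "dform (\<lambda>z X. a z X + b z X) z X Y = dform a z X Y + dform b z X Y"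
proof -
  have d: "(\<lambda>z. a z v) differentiable (at z)" "(\<lambda>z. b z v) differentiable (at z)" for v
    using assms smooth_on_differentiable unfolding smooth_form_def by blast+
  show ?thesis unfolding dform_def fder_add[OF d] by simp
qed

lemma smooth_form_add: "open U \<Longrightarrow> smooth_form U a \<Longrightarrow> smooth_form U b \<Longrightarrow> smooth_form U (\<lambda>z X. a z X + b z X)"
  unfolding smooth_form_def by (auto intro: linear_compose_add smooth_on_add)

lemma smooth_form_scale:
  fixes a :: "'a::euclidean_space \<Rightarrow> 'a \<Rightarrow> complex"
  assumes "open U" "smooth_on U l" "smooth_form U a"
  shows "smooth_form U (\<lambda>z X. l z * a z X)"
  unfolding smooth_form_def
proof (intro conjI ballI allI)
  show "linear (\<lambda>X. l z * a z X)" if "z \<in> U" for z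
    using assms(3) that linear_compose[OF _ bounded_linear.linear[OF bounded_linear_mult_right]]
    unfolding smooth_form_def o_def by blast
  show "smooth_on U (\<lambda>z. l z * a z v)" for v
    using assms smooth_on_mult unfolding smooth_form_def by blast
qed

text \<open>
  Needed to multiply a form, which is a function of tangent vectors only, by a function on \<open>S\<close>.
\<close>
definition base_point :: "'n::finite cproj_tangent \<Rightarrow> 'n cproj" where
  "base_point \<xi> = (SOME p. \<exists>A z X. invertible A \<and> \<xi> = dchart A z X \<and> p = chart A z)"

lemma base_point_dchart:
  assumes "invertible A"
  shows "base_point (dchart A z X) = chart A z"
  unfolding base_point_def
proof (rule some_equality)
  show "\<exists>A' z' X'. invertible A' \<and> dchart A z X = dchart A' z' X' \<and> chart A z = chart A' z'" using assms by blast
  show "p = chart A z" if pr: "\<exists>A' z' X'. invertible A' \<and> dchart A z X = dchart A' z' X' \<and> p = chart A' z'" for p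
  proof -
    obtain B y Y where "invertible B" "dchart A z X = dchart B y Y" "p = chart B y" using pr by blast
    then show ?thesis using dchart_base[OF assms, of B z X y Y] by simp
  qed
qed

lemma local_extension_subset:
  "local_extension S u A U F \<Longrightarrow> open V \<Longrightarrow> V \<subseteq> U \<Longrightarrow> local_extension S u A V F"
  unfolding local_extension_def using smooth_on_subset by blast

lemma differential_combination:
  assumes S: "real_hypersurface S" and f: "smooth_fun S f" and g: "smooth_fun S g"
    and u: "\<And>p. p \<in> S \<Longrightarrow> u p = f p + c * g p"
  shows "smooth_fun S u"
    "\<And>p \<xi>. p \<in> S \<Longrightarrow> \<xi> \<in> T_space S p \<Longrightarrow> differential S u \<xi> = differential S f \<xi> + c * differential S g \<xi>"
proof -
  have main: "\<exists>A z W F G. chart A z = p \<and> z \<in> W \<and> local_extension S f A W F \<and> local_extension S g A W G \<and>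
      local_extension S u A W (\<lambda>x. F x + c * G x)" if p: "p \<in> S" for p
  proof -
    obtain A z where A: "invertible A" "chart A z = p" using S p unfolding real_hypersurface_def by blast
    have zS: "chart A z \<in> S" using A p by simp
    obtain W1 F where F: "z \<in> W1" "local_extension S f A W1 F" using smooth_fun_local_extension[OF f A(1) zS] .
    obtain W2 G where G: "z \<in> W2" "local_extension S g A W2 G" using smooth_fun_local_extension[OF g A(1) zS] .
    let ?W = "W1 \<inter> W2"
    have o: "open ?W" using F G by (auto simp: local_extension_def)
    have FW: "local_extension S f A ?W F" "local_extension S g A ?W G"
      using local_extension_subset[OF F(2) o] local_extension_subset[OF G(2) o] by auto
    then have "local_extension S u A ?W (\<lambda>x. F x + c * G x)"
      using o u unfolding local_extension_def by (auto intro!: smooth_on_add smooth_on_mult smooth_on_const)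
    then show ?thesis using A FW F G by blast
  qed
  show "smooth_fun S u" unfolding smooth_fun_def using main by blast
  fix p \<xi> assume p: "p \<in> S" and \<xi>: "\<xi> \<in> T_space S p"
  obtain A z W F G where A: "chart A z = p" "z \<in> W" "local_extension S f A W F" "local_extension S g A W G"
    "local_extension S u A W (\<lambda>x. F x + c * G x)" using main[OF p] by blast
  have iA: "invertible A" using A(3) by (simp add: local_extension_def)
  obtain X where X: "\<xi> = dchart A z X" using T_space_E[OF \<xi> iA A(1)] .
  have zS: "chart A z \<in> S" and T: "dchart A z X \<in> T_space S (chart A z)" using A(1) p \<xi> X by auto
  have sF: "smooth_on W F" "smooth_on W G" using A by (auto simp: local_extension_def)
  have dF: "F differentiable (at z)" "G differentiable (at z)" using smooth_on_differentiable sF A(2) by blast+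
  have dG: "(\<lambda>x. c * G x) differentiable (at z)" "fder (\<lambda>x. c * G x) z X = c * fder G z X"
    using fder_bounded_linear_compose[OF bounded_linear_mult_right dF(2), of c X] dF(2)
      bounded_linear.has_derivative[OF bounded_linear_mult_right has_derivative_fder[OF dF(2)]]
    by (auto simp: differentiable_def)
  show "differential S u \<xi> = differential S f \<xi> + c * differential S g \<xi>"
    unfolding X differential_eq[OF S A(3,2) zS T] differential_eq[OF S A(4,2) zS T] differential_eq[OF S A(5,2) zS T]
    using fder_add[OF dF(1) dG(1), of X] dG(2) by simp
qed

lemma differential_local_form:
  assumes "real_hypersurface S" "local_extension S f A U F"
  shows "local_form S (T_space S) (differential S f) A U (\<lambda>z. fder F z)"
  unfolding local_form_def
  using assms differential_eq[OF assms] smooth_form_fder unfolding local_extension_def by metis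

lemma smooth_covectors_differential_H:
  assumes "real_hypersurface S" "smooth_fun S f"
  shows "smooth_covectors S (H_space S) (differential S f)"
proof (rule smooth_covectorsI)
  fix p assume "p \<in> S"
  then obtain A z U F where A: "chart A z = p" "z \<in> U" "local_extension S f A U F"
    using assms(2) unfolding smooth_fun_def by blast
  have "local_form S (H_space S) (differential S f) A U (\<lambda>z. fder F z)"
    using differential_local_form[OF assms(1) A(3)] H_space_subset_T_space unfolding local_form_def by metis
  then show "\<exists>A z U a. chart A z = p \<and> z \<in> U \<and> local_form S (H_space S) (differential S f) A U a" using A by blast
qed

text \<open>
  The hypothesis says that \<open>\<alpha> = \<delta> + l \<theta>\<close> satisfies \<open>d\<alpha> = 0\<close> on complex tangent vectors, the term \<open>dl \<and> \<theta>\<close> being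
  zero there. By rigidity \<open>\<alpha>\<close> is closed, hence \<open>\<alpha> = df\<close>. On complex tangent vectors \<open>df\<close> is \<open>d'u\<close> and
  \<open>d(u - f)\<close> is \<open>d''u\<close>.
\<close>
lemma closed_implies_decomposable:
  fixes S :: "'n::finite cproj set"
  assumes n: "CARD('n) > 2" and S: "real_hypersurface S" "strongly_C_convex S" "simply_connected S"
    and \<theta>: "contact_form S \<theta>" and Du: "smooth_one_form S \<delta>"
    and dp: "\<And>p \<xi>. p \<in> S \<Longrightarrow> \<xi> \<in> H_space S p \<Longrightarrow> \<delta> \<xi> = d_prime S u \<xi>" and u: "smooth_fun S u"
    and l: "smooth_fun S l" "\<And>p \<xi> \<eta>. p \<in> S \<Longrightarrow> \<xi> \<in> H_space S p \<Longrightarrow> \<eta> \<in> H_space S p \<Longrightarrow>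
        ext_deriv S \<delta> \<xi> \<eta> = - l p * ext_deriv S \<theta> \<xi> \<eta>"
  shows "\<exists>f g. CR S f \<and> dual_CR S g \<and> (\<forall>p\<in>S. u p = f p + g p)"
proof -
  have \<theta>s: "smooth_one_form S \<theta>" and \<theta>H: "\<And>p \<xi>. p \<in> S \<Longrightarrow> \<xi> \<in> H_space S p \<Longrightarrow> \<theta> \<xi> = 0"
    using \<theta> by (auto simp: contact_form_def)
  define \<alpha> where "\<alpha> = (\<lambda>\<xi>. \<delta> \<xi> + l (base_point \<xi>) * \<theta> \<xi>)"
  have loc: "\<exists>A z U F. chart A z = p \<and> z \<in> U \<and> local_primitive S \<alpha> A U F" if p: "p \<in> S" for p
  proof -
    obtain A z U \<rho> where A: "chart A z = p" "z \<in> U" "convex_chart S A U \<rho>" using convex_chart_exists[OF S(2) p] .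
    have gc: "dual_chart S A U \<rho>" using A(3) by (simp add: convex_chart_def)
    note g = dual_chartD[OF gc]
    have zS: "chart A z \<in> S" using A p by simp
    obtain W1 d where d: "z \<in> W1" "local_form S (T_space S) \<delta> A W1 d" using smooth_covectors_local_form[OF Du g(1) zS] .
    obtain W2 t where t: "z \<in> W2" "local_form S (T_space S) \<theta> A W2 t" using smooth_covectors_local_form[OF \<theta>s g(1) zS] .
    obtain W3 L where L: "z \<in> W3" "local_extension S l A W3 L" using smooth_fun_local_extension[OF l(1) g(1) zS] .
    let ?W = "W1 \<inter> W2 \<inter> W3"
    have oW: "open ?W" using d t L by (auto simp: local_form_def local_extension_def)
    have dW: "local_form S (T_space S) \<delta> A ?W d" by (rule local_form_subset[OF d(2) oW]) auto
    have tW: "local_form S (T_space S) \<theta> A ?W t" by (rule local_form_subset[OF t(2) oW]) auto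
    have LW: "local_extension S l A ?W L" by (rule local_extension_subset[OF L(2) oW]) auto
    have sd: "smooth_form ?W d" and st: "smooth_form ?W t" and sL: "smooth_on ?W L"
      using dW tW LW by (auto simp: local_form_def local_extension_def)
    have slt: "smooth_form ?W (\<lambda>z X. L z * t z X)" by (rule smooth_form_scale[OF oW sL st])
    define a where "a = (\<lambda>z X. d z X + L z * t z X)"
    have sa: "smooth_form ?W a" unfolding a_def by (rule smooth_form_add[OF oW sd slt])
    have la: "local_form S (T_space S) \<alpha> A ?W a"
      unfolding local_form_def
    proof (intro conjI ballI allI impI)
      fix y X assume y: "y \<in> ?W" "chart A y \<in> S" "dchart A y X \<in> T_space S (chart A y)"
      have "d y X = \<delta> (dchart A y X)" "t y X = \<theta> (dchart A y X)" "L y = l (chart A y)"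
        using dW tW LW y unfolding local_form_def local_extension_def by blast+
      then show "a y X = \<alpha> (dchart A y X)" by (simp add: a_def \<alpha>_def base_point_dchart[OF g(1)])
    qed (use g(1) oW sa in auto)
    have zW: "z \<in> ?W" using d t L by simp
    have van: "dform a y X Y = 0"
      if y: "y \<in> U" "y \<in> ?W" "chart A y \<in> S" and X: "cdot (dual_map \<rho> y) X = 0" and Y: "cdot (dual_map \<rho> y) Y = 0" for y X Y
    proof -
      have HX: "dchart A y X \<in> H_space S (chart A y)" "dchart A y Y \<in> H_space S (chart A y)"
        using H_space_iff_cdot[OF gc y(1,3)] X Y by auto
      note TX = HX[THEN H_space_subset_T_space]
      have t0: "t y X = 0" "t y Y = 0"
        using tW y TX \<theta>H[OF y(3)] HX unfolding local_form_def by auto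
      have "dform a y X Y = dform d y X Y + dform (\<lambda>z X. L z * t z X) y X Y"
        unfolding a_def by (rule dform_add[OF y(2) sd slt])
      also have "dform (\<lambda>z X. L z * t z X) y X Y = L y * dform t y X Y"
        using dform_scale[OF oW y(2) st sL, of X Y] t0 by simp
      also have "dform d y X Y = ext_deriv S \<delta> (dchart A y X) (dchart A y Y)"
        by (rule ext_deriv_eq[OF S(1) dW y(2,3) TX, symmetric])
      also have "dform t y X Y = ext_deriv S \<theta> (dchart A y X) (dchart A y Y)"
        by (rule ext_deriv_eq[OF S(1) tW y(2,3) TX, symmetric])
      also have "L y = l (chart A y)" using LW y unfolding local_extension_def by blast
      finally show ?thesis using l(2)[OF y(3) HX] by simp
    qed
    obtain V F where "z \<in> V" "local_primitive S \<alpha> A V F"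
    proof (rule closed_imp_local_primitive[OF g(1,2) A(2) zS la zW])
      fix y X Y assume y: "y \<in> U" "y \<in> ?W" "chart A y \<in> S" and X: "fder \<rho> y X = 0" and Y: "fder \<rho> y Y = 0"
      show "dform a y X Y = 0"
        by (rule closed_on_H_imp_closed[OF n A(3) y(1,3) oW y(2) sa van X Y])
    qed
    then show ?thesis using A(1) by blast
  qed
  obtain f where f: "smooth_fun S f" "\<And>p \<xi>. p \<in> S \<Longrightarrow> \<xi> \<in> T_space S p \<Longrightarrow> differential S f \<xi> = \<alpha> \<xi>"
    using locally_exact_imp_exact[OF S(1,3) loc] by blast
  obtain a b where ab: "splitting S u a b" using splitting_exists[OF S(1,2) u] by blast
  have fH: "differential S f \<xi> = a \<xi>" if p: "p \<in> S" and \<xi>: "\<xi> \<in> H_space S p" for p \<xi>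
    using f(2)[OF p H_space_subset_T_space[OF \<xi>]] \<theta>H[OF p \<xi>] dp[OF p \<xi>] d_prime_eq[OF S(1,2) ab p \<xi>]
    by (simp add: \<alpha>_def)
  have CRf: "CR S f"
    unfolding CR_def
  proof (intro conjI ballI)
    fix p \<xi> assume p: "p \<in> S" and \<xi>: "\<xi> \<in> H_space S p"
    show "differential S f (tangent_J \<xi>) = \<i> * differential S f \<xi>"
      using fH[OF p \<xi>] fH[OF p tangent_J_in_H_space[OF S(1) p \<xi>]] ab p \<xi> unfolding splitting_def by simp
  qed (rule f(1))
  define g where "g = (\<lambda>p. u p + (-1) * f p)"
  note dg = differential_combination[OF S(1) u f(1), of g "-1"]
  have g: "smooth_fun S g" by (rule dg(1)) (simp add: g_def)
  have gH: "differential S g \<xi> = b \<xi>" if p: "p \<in> S" and \<xi>: "\<xi> \<in> H_space S p" for p \<xi>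
  proof -
    have "differential S g \<xi> = differential S u \<xi> + (-1) * differential S f \<xi>"
      by (rule dg(2)[OF _ p H_space_subset_T_space[OF \<xi>]]) (simp add: g_def)
    moreover have "differential S u \<xi> = a \<xi> + b \<xi>" using ab p \<xi> unfolding splitting_def by blast
    ultimately show ?thesis using fH[OF p \<xi>] by simp
  qed
  have "dual_CR S g"
    unfolding dual_CR_def
  proof (intro conjI ballI)
    fix p \<xi> assume p: "p \<in> S" and \<xi>: "\<xi> \<in> H_space S p"
    show "differential S g (dual_J S \<xi>) = \<i> * differential S g \<xi>"
      using gH[OF p \<xi>] gH[OF p dual_J_in_H_space[OF S(2) p \<xi>]] ab p \<xi> unfolding splitting_def by simp
  qed (rule g)
  moreover have "\<forall>p\<in>S. u p = f p + g p" by (simp add: g_def)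
  ultimately show ?thesis using CRf by blast
qed

text \<open>
  Complex tangent vectors have real codimension one among the tangent vectors, so two complex valued
  real-linear forms that vanish on the former are proportional.
\<close>
lemma form_multiple_of_contact:
  fixes k t :: "complex^'n \<Rightarrow> complex" and f :: "complex^'n \<Rightarrow> real"
  assumes "linear k" "linear t" "linear f"
    and T: "f T = 0" "f (\<i> *s T) \<noteq> 0"
    and H: "\<And>X. f X = 0 \<Longrightarrow> f (\<i> *s X) = 0 \<Longrightarrow> k X = 0 \<and> t X = 0"
    and nz: "f X0 = 0" "t X0 \<noteq> 0"
  shows "t T \<noteq> 0" "f X = 0 \<Longrightarrow> k X = k T / t T * t X"
proof -
  have *: "k X = r *\<^sub>R k T \<and> t X = r *\<^sub>R t T" if "f X = 0" "r = f (\<i> *s X) / f (\<i> *s T)" for X r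
  proof -
    have "\<i> *s (X - r *\<^sub>R T) = \<i> *s X - r *\<^sub>R (\<i> *s T)" by (simp add: vec_eq_iff algebra_simps)
    then have "f (\<i> *s (X - r *\<^sub>R T)) = 0" using T(2) that(2) assms(3) by (simp add: linear_diff linear_cmul)
    moreover have "f (X - r *\<^sub>R T) = 0" using T(1) that(1) assms(3) by (simp add: linear_diff linear_cmul)
    ultimately have "k (X - r *\<^sub>R T) = 0 \<and> t (X - r *\<^sub>R T) = 0" using H by blast
    then show ?thesis using assms(1,2) by (simp add: linear_diff linear_cmul)
  qed
  show tT: "t T \<noteq> 0" using *[OF nz(1) refl] nz(2) by auto
  show "k X = k T / t T * t X" if "f X = 0" using *[OF that refl] tT by (simp add: scaleR_conv_of_real)
qed

text \<open>
  If \<open>u = f + g\<close> then \<open>d'u = df\<close> on complex tangent vectors by uniqueness of the splitting. Hence \<open>\<delta> - df\<close>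
  is a multiple \<open>m \<theta>\<close> of the contact form, and \<open>d\<delta> = dm \<and> \<theta> + m d\<theta>\<close> where the first term vanishes on complex
  tangent vectors.
\<close>
lemma decomposable_implies_closed:
  fixes S :: "'n::finite cproj set"
  assumes S: "real_hypersurface S" "strongly_C_convex S"
    and \<theta>: "contact_form S \<theta>" and Du: "smooth_one_form S \<delta>"
    and dp: "\<And>p \<xi>. p \<in> S \<Longrightarrow> \<xi> \<in> H_space S p \<Longrightarrow> \<delta> \<xi> = d_prime S u \<xi>"
    and f: "CR S f" and g: "dual_CR S g" and u: "\<And>p. p \<in> S \<Longrightarrow> u p = f p + g p"
  shows "\<exists>l. smooth_fun S l \<and> (\<forall>p\<in>S. \<forall>\<xi>\<in>H_space S p. \<forall>\<eta>\<in>H_space S p.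
        ext_deriv S \<delta> \<xi> \<eta> = - l p * ext_deriv S \<theta> \<xi> \<eta>)"
proof -
  have \<theta>s: "smooth_one_form S \<theta>" and \<theta>H: "\<And>p \<xi>. p \<in> S \<Longrightarrow> \<xi> \<in> H_space S p \<Longrightarrow> \<theta> \<xi> = 0"
    and \<theta>0: "\<And>p. p \<in> S \<Longrightarrow> \<exists>\<xi>\<in>T_space S p. \<theta> \<xi> \<noteq> 0"
    using \<theta> by (auto simp: contact_form_def)
  have fs: "smooth_fun S f" and gs: "smooth_fun S g" using f g by (auto simp: CR_def dual_CR_def)
  have du: "differential S u \<xi> = differential S f \<xi> + differential S g \<xi>" if "p \<in> S" "\<xi> \<in> H_space S p" for p \<xi>
    using differential_combination(2)[OF S(1) fs gs, of u 1 p \<xi>] u that H_space_subset_T_space[of \<xi> S p] by simp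
  have "splitting S u (differential S f) (differential S g)"
    unfolding splitting_def
    using smooth_covectors_differential_H[OF S(1)] fs gs du f g unfolding CR_def dual_CR_def by blast
  then have \<delta>H: "\<delta> \<xi> = differential S f \<xi>" if "p \<in> S" "\<xi> \<in> H_space S p" for p \<xi>
    using d_prime_eq[OF S] dp that by metis
  define m where "m = (\<lambda>p. SOME c. \<forall>\<xi>\<in>T_space S p. \<delta> \<xi> - differential S f \<xi> = c * \<theta> \<xi>)"
  have loc: "\<exists>A z V G d t F. chart A z = p \<and> z \<in> V \<and> local_extension S m A V G \<and> local_extension S f A V F \<and>
      local_form S (T_space S) \<delta> A V d \<and> local_form S (T_space S) \<theta> A V t \<and>
      (\<forall>y\<in>V. chart A y \<in> S \<longrightarrow> (\<forall>\<xi>\<in>T_space S (chart A y). \<delta> \<xi> - differential S f \<xi> = m (chart A y) * \<theta> \<xi>))"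
    if p: "p \<in> S" for p
  proof -
    obtain A z U \<rho> where A: "invertible A" "chart A z = p" "z \<in> U" "defining_function (chart A -` S) U \<rho>"
      using S(1) p unfolding real_hypersurface_def by blast
    have zS: "chart A z \<in> S" and zM: "z \<in> chart A -` S" using A p by auto
    note D = defining_functionD[OF A(4)]
    obtain W1 d where d: "z \<in> W1" "local_form S (T_space S) \<delta> A W1 d" using smooth_covectors_local_form[OF Du A(1) zS] .
    obtain W2 t where t: "z \<in> W2" "local_form S (T_space S) \<theta> A W2 t" using smooth_covectors_local_form[OF \<theta>s A(1) zS] .
    obtain W3 F where F: "z \<in> W3" "local_extension S f A W3 F" using smooth_fun_local_extension[OF fs A(1) zS] .
    let ?W = "W1 \<inter> W2 \<inter> W3"
    have oW: "open ?W" using d t F by (auto simp: local_form_def local_extension_def)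
    have dW: "local_form S (T_space S) \<delta> A ?W d" by (rule local_form_subset[OF d(2) oW]) auto
    have tW: "local_form S (T_space S) \<theta> A ?W t" by (rule local_form_subset[OF t(2) oW]) auto
    have FW: "local_extension S f A ?W F" by (rule local_extension_subset[OF F(2) oW]) auto
    have sd: "smooth_form ?W d" and st: "smooth_form ?W t" and sF: "smooth_on ?W F"
      using dW tW FW by (auto simp: local_form_def local_extension_def)
    have zW: "z \<in> ?W" using d t F by simp
    obtain V \<pi> where V: "open V" "z \<in> V" "V \<subseteq> U \<inter> ?W" "smooth_on V \<pi>"
      "\<And>y. y \<in> V \<Longrightarrow> \<pi> y \<in> U \<inter> ?W \<inter> chart A -` S" "\<And>y. y \<in> V \<Longrightarrow> y \<in> chart A -` S \<Longrightarrow> \<pi> y = y"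
      "\<And>y X. y \<in> V \<Longrightarrow> y \<in> chart A -` S \<Longrightarrow> fder \<rho> y X = 0 \<Longrightarrow> fder \<pi> y X = X"
      "\<And>y X. y \<in> V \<Longrightarrow> fder \<rho> (\<pi> y) (fder \<pi> y X) = 0"
      using defining_function_retraction[OF A(4,3) zM oW zW] by blast
    have \<pi>W: "\<pi> y \<in> ?W" if "y \<in> V" for y using V(5)[OF that] by auto
    define k where "k = (\<lambda>y X. d y X - fder F y X)"
    have sk: "smooth_form ?W k"
      unfolding k_def using sd smooth_form_fder[OF sF] oW
      unfolding smooth_form_def by (simp add: linear_compose_sub smooth_on_diff)
    have kt: "k y X = \<delta> (dchart A y X) - differential S f (dchart A y X)" "t y X = \<theta> (dchart A y X)"
      if y: "y \<in> ?W" "chart A y \<in> S" "dchart A y X \<in> T_space S (chart A y)" for y X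
    proof -
      have "d y X = \<delta> (dchart A y X)" "t y X = \<theta> (dchart A y X)" using dW tW y unfolding local_form_def by blast+
      then show "k y X = \<delta> (dchart A y X) - differential S f (dchart A y X)" "t y X = \<theta> (dchart A y X)"
        using differential_eq[OF S(1) FW y] by (auto simp: k_def)
    qed
    have mult: "t y T \<noteq> 0" "fder \<rho> y X = 0 \<Longrightarrow> k y X = k y T / t y T * t y X"
      if y: "y \<in> U" "y \<in> ?W" "chart A y \<in> S" and T: "fder \<rho> y T = 0" "fder \<rho> y (\<i> *s T) \<noteq> 0" for y T X
    proof -
      note Ti = T_space_iff[OF A(1) y(1) A(4) y(3)] and Hi = H_space_iff[OF A(1) y(1) A(4) y(3)]
      obtain \<xi> where \<xi>: "\<xi> \<in> T_space S (chart A y)" "\<theta> \<xi> \<noteq> 0" using \<theta>0[OF y(3)] by blast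
      obtain X0 where X0: "\<xi> = dchart A y X0" using T_space_E[OF \<xi>(1) A(1) refl] .
      have X0': "fder \<rho> y X0 = 0" "t y X0 \<noteq> 0" using Ti kt(2)[OF y(2,3)] \<xi> X0 by auto
      have H: "k y X = 0 \<and> t y X = 0" if X: "fder \<rho> y X = 0" "fder \<rho> y (\<i> *s X) = 0" for X
      proof -
        have h: "dchart A y X \<in> H_space S (chart A y)" using Hi X by simp
        show ?thesis using kt[OF y(2,3) H_space_subset_T_space[OF h]] \<theta>H[OF y(3) h] \<delta>H[OF y(3) h] by simp
      qed
      have lin: "linear (k y)" "linear (t y)" "linear (fder \<rho> y)"
        using sk st smooth_on_linear_fder[OF D(2) y(1)] y(2) unfolding smooth_form_def by auto
      show "t y T \<noteq> 0" by (rule form_multiple_of_contact(1)[OF lin T H X0'])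
      show "k y X = k y T / t y T * t y X" if "fder \<rho> y X = 0"
        by (rule form_multiple_of_contact(2)[OF lin T H X0' that])
    qed
    have lin\<rho>: "linear (fder \<rho> y)" if "y \<in> U" for y by (rule smooth_on_linear_fder[OF D(2) that])
    have ex: "\<exists>c. \<forall>\<xi>\<in>T_space S (chart A y). \<delta> \<xi> - differential S f \<xi> = c * \<theta> \<xi>"
      if y: "y \<in> U" "y \<in> ?W" "chart A y \<in> S" for y
    proof -
      obtain N where "fder \<rho> y N \<noteq> 0" using D(4)[OF y(1)] y(3) by auto
      then obtain T where T: "fder \<rho> y T = 0" "fder \<rho> y (\<i> *s T) \<noteq> 0"
        using transversal_tangent_vector[OF lin\<rho>[OF y(1)]] by blast
      have "\<delta> \<xi> - differential S f \<xi> = k y T / t y T * \<theta> \<xi>" if \<xi>: "\<xi> \<in> T_space S (chart A y)" for \<xi>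
      proof -
        obtain X where X: "\<xi> = dchart A y X" using T_space_E[OF \<xi> A(1) refl] .
        have "fder \<rho> y X = 0" using T_space_iff[OF A(1) y(1) A(4) y(3)] \<xi> X by simp
        from mult(2)[OF y T this] show ?thesis using kt[OF y(2,3)] \<xi> X by simp
      qed
      then show ?thesis by blast
    qed
    have m: "\<delta> \<xi> - differential S f \<xi> = m (chart A y) * \<theta> \<xi>"
      if y: "y \<in> U" "y \<in> ?W" "chart A y \<in> S" and \<xi>: "\<xi> \<in> T_space S (chart A y)" for y \<xi>
      using someI_ex[OF ex[OF y]] \<xi> unfolding m_def by blast
    obtain N where "fder \<rho> z N \<noteq> 0" using D(4)[OF A(3) zM] by blast
    then obtain T where T: "fder \<rho> z T = 0" "fder \<rho> z (\<i> *s T) \<noteq> 0"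
      using transversal_tangent_vector[OF lin\<rho>[OF A(3)]] by blast
    let ?k = "\<lambda>y. pullback \<pi> k y T" and ?t = "\<lambda>y. pullback \<pi> t y T"
    have sk': "smooth_on V ?k" and st': "smooth_on V ?t"
      using smooth_form_pullback[OF V(1) oW \<pi>W V(4) sk] smooth_form_pullback[OF V(1) oW \<pi>W V(4) st]
      unfolding smooth_form_def by auto
    let ?V = "{y \<in> V. ?t y \<noteq> 0}"
    have oV: "open ?V" using open_Int_preimage[OF V(1) _ st', of "- {0}"] by (simp add: open_Compl)
    have zV: "z \<in> ?V"
      using V(2) V(6)[OF V(2) zM] V(7)[OF V(2) zM T(1)] mult(1)[OF A(3) zW zS T] by (simp add: pullback_def)
    \<comment> \<open>evaluating on one transversal vector, moved into the tangent spaces by the retraction, shows that the factor is smooth\<close>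
    define G where "G = (\<lambda>y. ?k y / ?t y)"
    have sG: "smooth_on ?V G" unfolding G_def
      by (intro smooth_on_divide oV smooth_on_subset[OF sk'] smooth_on_subset[OF st']) auto
    have VW: "?V \<subseteq> ?W" using V(3) by blast
    have mG: "local_extension S m A ?V G"
      unfolding local_extension_def
    proof (intro conjI ballI impI)
      fix y assume y: "y \<in> ?V" "chart A y \<in> S"
      have yV: "y \<in> V" "y \<in> chart A -` S" "y \<in> U" "y \<in> ?W" using y V(3) by auto
      have \<pi>y: "\<pi> y = y" by (rule V(6)[OF yV(1,2)])
      let ?T = "fder \<pi> y T"
      have "fder \<rho> y ?T = 0" using V(8)[OF yV(1), of T] \<pi>y by simp
      then have tan: "dchart A y ?T \<in> T_space S (chart A y)"
        using T_space_iff[OF A(1) yV(3) A(4) y(2)] by simp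
      have "k y ?T = m (chart A y) * t y ?T"
        using m[OF yV(3,4) y(2) tan] kt[OF yV(4) y(2) tan] by simp
      then show "G y = m (chart A y)" using y(1) \<pi>y by (simp add: G_def pullback_def)
    qed (use A(1) oV sG in auto)
    have "local_form S (T_space S) \<delta> A ?V d" "local_form S (T_space S) \<theta> A ?V t" "local_extension S f A ?V F"
      using local_form_subset[OF dW oV VW] local_form_subset[OF tW oV VW] local_extension_subset[OF FW oV VW] by auto
    moreover have "\<forall>y\<in>?V. chart A y \<in> S \<longrightarrow> (\<forall>\<xi>\<in>T_space S (chart A y). \<delta> \<xi> - differential S f \<xi> = m (chart A y) * \<theta> \<xi>)"
    proof (intro ballI impI)
      fix y \<xi> assume y: "y \<in> ?V" "chart A y \<in> S" and \<xi>: "\<xi> \<in> T_space S (chart A y)"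
      have "y \<in> U" "y \<in> ?W" using y(1) V(3) by blast+
      then show "\<delta> \<xi> - differential S f \<xi> = m (chart A y) * \<theta> \<xi>" using y(2) \<xi> by (rule m)
    qed
    ultimately show ?thesis using A(2) zV mG
      by (intro exI[of _ A] exI[of _ z] exI[of _ ?V] exI[of _ G] exI[of _ d] exI[of _ t] exI[of _ F]) blast
  qed
  have ms: "smooth_fun S m" unfolding smooth_fun_def using loc by blast
  have "smooth_fun S (\<lambda>p. - m p)"
    by (rule differential_combination(1)[OF S(1) ms ms, of _ "-2"]) simp
  moreover have "ext_deriv S \<delta> \<xi> \<eta> = - (- m p) * ext_deriv S \<theta> \<xi> \<eta>"
    if p: "p \<in> S" and \<xi>: "\<xi> \<in> H_space S p" and \<eta>: "\<eta> \<in> H_space S p" for p \<xi> \<eta>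
  proof -
    obtain A z V G d t F where A: "chart A z = p" "z \<in> V" "local_extension S m A V G" "local_extension S f A V F"
      "local_form S (T_space S) \<delta> A V d" "local_form S (T_space S) \<theta> A V t"
      "\<forall>y\<in>V. chart A y \<in> S \<longrightarrow> (\<forall>\<xi>\<in>T_space S (chart A y). \<delta> \<xi> - differential S f \<xi> = m (chart A y) * \<theta> \<xi>)"
      using loc[OF p] by blast
    have iA: "invertible A" and oV: "open V" and sF: "smooth_on V F" and sG: "smooth_on V G" and st: "smooth_form V t"
      using A(3,4,6) by (auto simp: local_form_def local_extension_def)
    have zS: "chart A z \<in> S" using A p by simp
    obtain X where X: "\<xi> = dchart A z X" using H_space_E[OF \<xi> iA A(1)] .
    obtain Y where Y: "\<eta> = dchart A z Y" using H_space_E[OF \<eta> iA A(1)] .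
    have T: "dchart A z X \<in> T_space S (chart A z)" "dchart A z Y \<in> T_space S (chart A z)"
      using \<xi> \<eta> X Y A(1) H_space_subset_T_space by auto
    have sGt: "smooth_form V (\<lambda>z X. G z * t z X)" by (rule smooth_form_scale[OF oV sG st])
    note sdF = smooth_form_fder[OF sF]
    have "local_form S (T_space S) \<delta> A V (\<lambda>z X. fder F z X + G z * t z X)"
      unfolding local_form_def
    proof (intro conjI ballI allI impI)
      show "smooth_form V (\<lambda>z X. fder F z X + G z * t z X)" by (rule smooth_form_add[OF oV sdF sGt])
      fix y X assume y: "y \<in> V" "chart A y \<in> S" "dchart A y X \<in> T_space S (chart A y)"
      have "\<delta> (dchart A y X) - differential S f (dchart A y X) = m (chart A y) * \<theta> (dchart A y X)"
        using A(7) y by blast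
      moreover have "G y = m (chart A y)" using A(3) y unfolding local_extension_def by blast
      moreover have "t y X = \<theta> (dchart A y X)" using A(6) y unfolding local_form_def by blast
      moreover have "differential S f (dchart A y X) = fder F y X" by (rule differential_eq[OF S(1) A(4) y])
      ultimately show "fder F y X + G y * t y X = \<delta> (dchart A y X)" by (simp add: algebra_simps)
    qed (use iA oV in auto)
    note form = this
    have t0: "t z X = 0" "t z Y = 0"
      using A(6,2) zS T \<theta>H[OF p] \<xi> \<eta> X Y unfolding local_form_def by auto
    from ext_deriv_eq[OF S(1) form A(2) zS T]
    have "ext_deriv S \<delta> \<xi> \<eta> = dform (\<lambda>z X. fder F z X + G z * t z X) z X Y" by (simp add: X Y)
    also have "\<dots> = dform (\<lambda>z. fder F z) z X Y + dform (\<lambda>z X. G z * t z X) z X Y"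
      by (rule dform_add[OF A(2) sdF sGt])
    also have "\<dots> = G z * dform t z X Y + fder G z X * t z Y - fder G z Y * t z X"
      by (simp add: dform_fder[OF oV A(2) sF] dform_scale[OF oV A(2) st sG])
    also have "\<dots> = G z * dform t z X Y" by (simp add: t0)
    also have "dform t z X Y = ext_deriv S \<theta> \<xi> \<eta>"
      using ext_deriv_eq[OF S(1) A(6,2) zS T] by (simp add: X Y)
    also have "G z = m p" using A(1-3) zS unfolding local_extension_def by blast
    finally show ?thesis by simp
  qed
  ultimately show ?thesis by (intro exI[of _ "\<lambda>p. - m p"]) simp
qed

theorem theorem7:
  fixes S :: "'n::finite cproj set"
    and \<theta> :: "'n cproj_tangent \<Rightarrow> complex"
    and D :: "('n cproj \<Rightarrow> complex) \<Rightarrow> 'n cproj_tangent \<Rightarrow> complex"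
    and u :: "'n cproj \<Rightarrow> complex"
  assumes "CARD('n) > 2"
    and "real_hypersurface S"
    and "strongly_C_convex S"
    and "simply_connected S"
    and "contact_form S \<theta>"
    and "linear_operator S D"
    and "\<And>v p \<xi>. smooth_fun S v \<Longrightarrow> p \<in> S \<Longrightarrow> \<xi> \<in> H_space S p \<Longrightarrow> D v \<xi> = d_prime S v \<xi>"
    and "smooth_fun S u"
  shows "(\<exists>l. smooth_fun S l \<and>
            (\<forall>p\<in>S. \<forall>\<xi>\<in>H_space S p. \<forall>\<eta>\<in>H_space S p.
               ext_deriv S (D u) \<xi> \<eta> = - l p * ext_deriv S \<theta> \<xi> \<eta>))
     \<longleftrightarrow> (\<exists>f g. CR S f \<and> dual_CR S g \<and> (\<forall>p\<in>S. u p = f p + g p))"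
proof -
  have Du: "smooth_one_form S (D u)" using assms(6,8) by (simp add: linear_operator_def)
  have dp: "D u \<xi> = d_prime S u \<xi>" if "p \<in> S" "\<xi> \<in> H_space S p" for p \<xi>
    by (rule assms(7)[OF assms(8) that])
  show ?thesis (is "?closed \<longleftrightarrow> ?decomposable")
  proof
    assume ?closed
    then obtain l where l: "smooth_fun S l" "\<And>p \<xi> \<eta>. p \<in> S \<Longrightarrow> \<xi> \<in> H_space S p \<Longrightarrow> \<eta> \<in> H_space S p \<Longrightarrow>
        ext_deriv S (D u) \<xi> \<eta> = - l p * ext_deriv S \<theta> \<xi> \<eta>" by blast
    show ?decomposable by (rule closed_implies_decomposable[OF assms(1-5) Du dp assms(8) l])
  next
    assume ?decomposable
    then obtain f g where fg: "CR S f" "dual_CR S g" "\<And>p. p \<in> S \<Longrightarrow> u p = f p + g p" by blast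
    show ?closed by (rule decomposable_implies_closed[OF assms(2,3,5) Du dp fg])
  qed
qed

end
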